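(* For every $\alpha>0$ there exist $\beta>0$ and a sequence of graphs $(G_j)_{j\ge 1}$, where $G_j$ has $n_j$ vertices and $n_j\to\infty$, such that, as $j\to\infty$: \begin{itemize} \item $|G_j| \geq \beta \binom{n_j}{2}$ for all $j$; \item $\tau_3(G_j) > (1-o(1))\,|G_j|/2$; \item $\nu_3(G_j) < (1+\alpha)\,|G_j|/4$ for all $j$. \end{itemize}
   Context: All graphs are finite, simple and undirected; $|G|$ denotes the number of edges of $G$. $\tau_3(G)$ is the minimum size of a set of edges of $G$ meeting every triangle of $G$, and $\nu_3(G)$ is the maximum number of pairwise edge-disjoint triangles in $G$. The $o(1)$ refers to a quantity tending to $0$ as $j\to\infty$ (equivalently $n_j\to\infty$). *)

theory Defs
  imports "HOL-Analysis.Analysis"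
begin

definition graph_on :: "nat \<Rightarrow> nat set set \<Rightarrow> bool" where
  "graph_on n E \<longleftrightarrow> (\<forall>e\<in>E. e \<subseteq> {0..<n} \<and> card e = 2)"

abbreviation num_edges :: "nat set set \<Rightarrow> nat" where
  "num_edges E \<equiv> card E"

definition triangles :: "nat set set \<Rightarrow> nat set set" where
  "triangles E = {{a,b,c} | a b c. a \<noteq> b \<and> b \<noteq> c \<and> a \<noteq> c \<and>
                     {a,b} \<in> E \<and> {b,c} \<in> E \<and> {a,c} \<in> E}"

definition tri_edges :: "nat set \<Rightarrow> nat set set" where
  "tri_edges t = {e. e \<subseteq> t \<and> card e = 2}"

definition tau3 :: "nat set set \<Rightarrow> nat" where
  "tau3 E = (LEAST k. \<exists>F. F \<subseteq> E \<and> card F = k \<and>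
              (\<forall>t\<in>triangles E. F \<inter> tri_edges t \<noteq> {}))"

definition nu3 :: "nat set set \<Rightarrow> nat" where
  "nu3 E = (GREATEST k. \<exists>T. T \<subseteq> triangles E \<and> card T = k \<and>
              (\<forall>s\<in>T. \<forall>t\<in>T. s \<noteq> t \<longrightarrow> tri_edges s \<inter> tri_edges t = {}))"

end

theory Submission
  imports Defs "HOL-Real_Asymp.Real_Asymp"
begin

text \<open>
  Take a sparse, triangle-free, highly expanding graph \<open>J\<close> on \<open>N\<close> points (a Cayley graph on
  the cube, of degree \<open>D\<close>) and replace every point by a large clump.  Clumps are complete
  (edges \<open>L\<close>); clumps adjacent in \<open>J\<close> are joined by a quasirandom graph of density \<open>pA\<close>
  (edges \<open>A\<close>), all other pairs of clumps by one of the much smaller density \<open>q = pA D / N\<close>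
  (edges \<open>B\<close>), so that \<open>A\<close> and \<open>B\<close> have about the same size and \<open>L\<close> is a small
  fraction of either.

  Since \<open>J\<close> is triangle-free, a triangle avoiding \<open>L\<close> and the few \<open>B\<close>-edges over points at
  \<open>J\<close>-distance two contains two \<open>B\<close>-edges; giving \<open>B\<close>-edges weight one half and the exceptional
  edges weight one yields a fractional triangle cover of weight about \<open>|G|/4\<close>.

  Let \<open>F\<close> be a triangle-free subgraph.  Vertices of one clump are twins, so the two ends of an
  \<open>F\<close>-edge inside a clump together keep at most one of their two full degrees; matching
  the clumps fractionally by such edges settles the matched part exactly.  On the unmatched part
  (weights \<open>u\<close>, no \<open>L\<close>-edges left) let \<open>a\<close>, \<open>b\<close> be the normalised \<open>A\<close>- and \<open>B\<close>-degrees
  in \<open>F\<close>.  For a \<open>B\<close>-edge \<open>xy\<close> of \<open>F\<close> the \<open>A\<close>-neighbours of \<open>x\<close> and the \<open>B\<close>-neighbours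
  of \<open>y\<close> are disjoint, and quasirandomness turns this into \<open>a x + b y \<le> 1 + \<delta>\<close>.  Hence a
  vertex with \<open>a x + b x > 1 + \<delta>\<close> has larger \<open>b\<close>-degree than all its \<open>B\<close>-neighbours, and
  distributing its excess equally among them shows that the average of \<open>a + b\<close> is at most
  \<open>1 + \<delta>\<close>.  The error is relative to a fixed small multiple of the weight of the unmatched \<open>L\<close>-edges,
  which absorbs it.
\<close>

section \<open>Triangle-free subgraphs of quasirandom clump structures\<close>

text \<open>Adding the edge inequality in both directions gives \<open>ex x + ex y \<le> 0\<close>
  on every \<open>h\<close>-edge, so a vertex of positive excess only has neighbours in deficit. It
  sends its excess to them in proportion to \<open>u\<close>; since its own \<open>b\<close> is the
  larger one, no neighbour receives more than its deficit.\<close>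

lemma weighted_degree_bound:
  fixes u a b :: "'v \<Rightarrow> real" and h :: "'v \<Rightarrow> 'v \<Rightarrow> real"
  assumes fin: "finite V"
    and u: "\<And>x. x \<in> V \<Longrightarrow> 0 \<le> u x"
    and ac: "\<And>x. x \<in> V \<Longrightarrow> a x \<le> c"
    and h01: "\<And>x y. h x y = 0 \<or> h x y = 1"
    and hsym: "\<And>x y. h x y = h y x"
    and b: "\<And>x. b x = (\<Sum>y\<in>V. h x y * u y)"
    and edge: "\<And>x y. \<lbrakk>x \<in> V; y \<in> V; h x y = 1\<rbrakk> \<Longrightarrow> a x + b y \<le> c"
  shows "(\<Sum>x\<in>V. u x * (a x + b x)) \<le> c * (\<Sum>x\<in>V. u x)"
proof -
  define ex where "ex x = a x + b x - c" for x
  define Y where "Y = {x\<in>V. ex x > 0}"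
  have Y: "Y \<subseteq> V" "finite Y" using fin by (auto simp: Y_def)
  have h0: "0 \<le> h x y" for x y using h01[of x y] by auto
  have b0: "0 \<le> b x" for x unfolding b by (intro sum_nonneg mult_nonneg_nonneg h0 u)
  have bge: "u x \<le> b y" if "x \<in> V" "h x y = 1" for x y
  proof -
    have "h y x * u x \<le> (\<Sum>z\<in>V. h y z * u z)"
      by (rule member_le_sum) (use that fin h0 u in auto)
    then show ?thesis using that hsym[of x y] b by simp
  qed
  \<comment> \<open>With \<open>a x \<le> c\<close>, positive excess forces \<open>b x > 0\<close>,
    so the shares below may be divided by \<open>b x\<close>.\<close>
  have bpos: "b x > 0" if "x \<in> Y" for x
    using that ac[of x] by (auto simp: Y_def ex_def)
  have ineq: "h x y * (u x * u y * ex x / b x) \<le> h x y * (u x * u y * (- ex y) / b y)"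
    and notY: "h x y = 1 \<Longrightarrow> y \<notin> Y" if x: "x \<in> Y" and y: "y \<in> V" for x y
  proof -
    have xV: "x \<in> V" using x Y by auto
    show "h x y * (u x * u y * ex x / b x) \<le> h x y * (u x * u y * (- ex y) / b y)"
    proof (cases "h x y = 1 \<and> u x > 0")
      case True
      have 1: "a x + b y \<le> c" using edge[OF xV y] True by auto
      have 2: "a y + b x \<le> c" using edge[OF y xV] True hsym by metis
      have exx: "ex x > 0" using x by (auto simp: Y_def)
      have 3: "ex x \<le> - ex y" using 1 2 by (auto simp: ex_def)
      have 4: "b y \<le> b x" using exx 1 by (auto simp: ex_def)
      have 5: "b y > 0" using bge[OF xV, of y] True by auto
      have "ex x / b x \<le> (- ex y) / b y"
        by (rule frac_le) (use 3 4 5 exx in auto)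
      then have "u x * u y * (ex x / b x) \<le> u x * u y * ((- ex y) / b y)"
        by (intro mult_left_mono mult_nonneg_nonneg u xV y)
      then show ?thesis using True by simp
    next
      case False
      then show ?thesis using h01[of x y] u[OF xV] by auto
    qed
    show "y \<notin> Y" if h1: "h x y = 1"
    proof -
      have 1: "a x + b y \<le> c" using edge[OF xV y] h1 by auto
      have 2: "a y + b x \<le> c" using edge[OF y xV] h1 hsym by metis
      have exx: "ex x > 0" using x by (auto simp: Y_def)
      then show ?thesis using 1 2 by (auto simp: ex_def Y_def)
    qed
  qed
  \<comment> \<open>Each x in \<open>Y\<close> splits \<open>u x * ex x\<close> among its neighbours
    y in shares \<open>u y / b x\<close>, which add up to one by the definition of
    \<open>b\<close>.\<close>
  have "(\<Sum>x\<in>Y. u x * ex x) = (\<Sum>x\<in>Y. \<Sum>y\<in>V. h x y * (u x * u y * ex x / b x))"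
  proof (rule sum.cong[OF refl])
    fix x assume x: "x \<in> Y"
    have "(\<Sum>y\<in>V. h x y * (u x * u y * ex x / b x)) = (\<Sum>y\<in>V. h x y * u y) * (u x * ex x / b x)"
      unfolding sum_distrib_right by (intro sum.cong refl) (simp add: mult_ac)
    also have "\<dots> = u x * ex x" using bpos[OF x] b[of x] by simp
    finally show "u x * ex x = (\<Sum>y\<in>V. h x y * (u x * u y * ex x / b x))" by simp
  qed
  also have "\<dots> \<le> (\<Sum>x\<in>Y. \<Sum>y\<in>V. h x y * (u x * u y * (- ex y) / b y))"
    by (intro sum_mono ineq)
  \<comment> \<open>No \<open>h\<close>-edge runs inside \<open>Y\<close>.\<close>
  also have "\<dots> = (\<Sum>x\<in>Y. \<Sum>y\<in>V-Y. h x y * (u x * u y * (- ex y) / b y))"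
    by (intro sum.cong[OF refl] sum.mono_neutral_right) (use fin notY h01 in auto)
  also have "\<dots> = (\<Sum>y\<in>V-Y. \<Sum>x\<in>Y. h x y * (u x * u y * (- ex y) / b y))"
    by (rule sum.swap)
  also have "\<dots> \<le> (\<Sum>y\<in>V-Y. u y * (- ex y))"
  proof (rule sum_mono)
    fix y assume y: "y \<in> V - Y"
    have e: "(\<Sum>x\<in>Y. h x y * (u x * u y * (- ex y) / b y))
       = (\<Sum>x\<in>Y. h x y * u x) * (u y * (- ex y) / b y)"
      unfolding sum_distrib_right by (intro sum.cong refl) (simp add: mult_ac)
    have le: "(\<Sum>x\<in>Y. h x y * u x) \<le> b y"
    proof -
      have "(\<Sum>x\<in>Y. h x y * u x) \<le> (\<Sum>x\<in>V. h x y * u x)"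
        by (rule sum_mono2) (use fin Y h0 u in auto)
      then show ?thesis using b[of y] hsym by (metis (no_types, lifting) sum.cong)
    qed
    have exy: "- ex y \<ge> 0" using y by (auto simp: Y_def)
    have uy: "0 \<le> u y" using y u by auto
    show "(\<Sum>x\<in>Y. h x y * (u x * u y * (- ex y) / b y)) \<le> u y * (- ex y)"
    proof (cases "b y = 0")
      \<comment> \<open>Division by zero yields 0 here, so such a y receives nothing.\<close>
      case True then show ?thesis using exy uy by (simp add: mult_nonneg_nonpos)
    next
      case False
      then have bp: "b y > 0" using b0[of y] by simp
      have "(\<Sum>x\<in>Y. h x y * u x) * (u y * (- ex y) / b y) \<le> b y * (u y * (- ex y) / b y)"
        by (intro mult_right_mono[OF le] divide_nonneg_pos mult_nonneg_nonneg uy exy bp)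
      then show ?thesis unfolding e using bp by simp
    qed
  qed
  finally have "(\<Sum>x\<in>Y. u x * ex x) + (\<Sum>x\<in>V-Y. u x * ex x) \<le> 0"
    by (simp add: sum_negf)
  then have "(\<Sum>x\<in>V. u x * ex x) \<le> 0"
    using sum.subset_diff[OF Y(1) fin, of "\<lambda>x. u x * ex x"] by simp
  then show ?thesis
    by (simp add: ex_def algebra_simps sum.distrib sum_subtractf sum_distrib_left)
qed

text \<open>A cut-norm condition: \<open>disc V \<eta> (K - p)\<close> says that \<open>K\<close> is quasirandom of density \<open>p\<close>.\<close>

definition disc :: "'v set \<Rightarrow> real \<Rightarrow> ('v \<Rightarrow> 'v \<Rightarrow> real) \<Rightarrow> bool" where
  "disc V \<eta> K \<longleftrightarrow> (\<forall>\<phi> \<psi>. (\<forall>x\<in>V. \<bar>\<phi> x\<bar> \<le> 1) \<longrightarrow> (\<forall>x\<in>V. \<bar>\<psi> x\<bar> \<le> 1) \<longrightarrow>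
     \<bar>\<Sum>x\<in>V. \<Sum>y\<in>V. \<phi> x * \<psi> y * K x y\<bar> \<le> \<eta> * (real (card V))\<^sup>2)"

section \<open>Consequences of the cut-norm condition; edges between clumps\<close>

lemma discD:
  assumes "disc V \<eta> K" "\<And>x. x \<in> V \<Longrightarrow> \<bar>\<phi> x\<bar> \<le> 1" "\<And>x. x \<in> V \<Longrightarrow> \<bar>\<psi> x\<bar> \<le> 1"
  shows "\<bar>\<Sum>x\<in>V. \<Sum>y\<in>V. \<phi> x * \<psi> y * K x y\<bar> \<le> \<eta> * (real (card V))\<^sup>2"
  using assms unfolding disc_def by blast

text \<open>Taking \<open>w\<close> times the sign of the inner sum as the first test function turns
  the cut-norm bound into a bound on the average absolute deviation of the rows.\<close>

lemma disc_abs: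
  assumes "disc V \<eta> K" "\<And>x. x \<in> V \<Longrightarrow> 0 \<le> w x \<and> w x \<le> 1" "\<And>x. x \<in> V \<Longrightarrow> \<bar>\<psi> x\<bar> \<le> 1"
  shows "(\<Sum>x\<in>V. w x * \<bar>\<Sum>y\<in>V. \<psi> y * K x y\<bar>) \<le> \<eta> * (real (card V))\<^sup>2"
proof -
  define s where "s x = sgn (\<Sum>y\<in>V. \<psi> y * K x y)" for x
  have ws: "\<bar>w x * s x\<bar> \<le> 1" if "x \<in> V" for x
    using assms(2)[OF that] by (auto simp: s_def sgn_if abs_mult)
  have "(\<Sum>x\<in>V. \<Sum>y\<in>V. w x * s x * \<psi> y * K x y) \<le> \<eta> * (real (card V))\<^sup>2"
    using discD[OF assms(1), of "\<lambda>x. w x * s x" \<psi>] ws assms(3) by simp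
  moreover have "(\<Sum>y\<in>V. w x * s x * \<psi> y * K x y) = w x * \<bar>\<Sum>y\<in>V. \<psi> y * K x y\<bar>" for x
  proof -
    have "(\<Sum>y\<in>V. w x * s x * \<psi> y * K x y) = w x * (s x * (\<Sum>y\<in>V. \<psi> y * K x y))"
      by (simp add: sum_distrib_left mult.assoc)
    then show ?thesis by (simp add: s_def sgn_mult_self_eq abs_sgn mult.commute)
  qed
  ultimately show ?thesis by simp
qed

lemma disc_upper:
  assumes "disc V \<eta> (\<lambda>x y. B x y - q)" "\<And>x. x \<in> V \<Longrightarrow> \<bar>\<phi> x\<bar> \<le> 1" "\<And>x. x \<in> V \<Longrightarrow> \<bar>\<psi> x\<bar> \<le> 1"
  shows "(\<Sum>x\<in>V. \<Sum>y\<in>V. \<phi> x * \<psi> y * B x y) \<le> q * (\<Sum>x\<in>V. \<phi> x) * (\<Sum>x\<in>V. \<psi> x) + \<eta> * (real (card V))\<^sup>2"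
proof -
  have "(\<Sum>x\<in>V. \<Sum>y\<in>V. \<phi> x * \<psi> y * (B x y - q))
     = (\<Sum>x\<in>V. \<Sum>y\<in>V. \<phi> x * \<psi> y * B x y) - q * (\<Sum>x\<in>V. \<phi> x) * (\<Sum>x\<in>V. \<psi> x)"
    by (simp add: sum_subtractf algebra_simps sum_distrib_left sum_distrib_right sum_product)
  then show ?thesis using discD[OF assms(1), of \<phi> \<psi>] assms(2,3) by simp
qed

text \<open>Counts weighted cherries x - y - x' of \<open>B\<close>-edges whose ends are joined by
  \<open>L\<close>. For fixed x' the edge xy is replaced by its density, afterwards the edge x'y;
  each replacement costs at most \<open>\<eta> * n^3\<close>. The factor \<open>q\<^sup>2\<close>
  gained here later cancels a division by \<open>q\<^sup>2\<close>.\<close>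

lemma disc_sq_degree:
  fixes u :: "'v \<Rightarrow> real"
  assumes fin: "finite V"
    and B: "disc V \<eta> (\<lambda>x y. B x y - q)" and B01: "\<And>x y. 0 \<le> B x y \<and> B x y \<le> 1"
    and Bsym: "\<And>x y. B x y = B y x"
    and u: "\<And>x. x \<in> V \<Longrightarrow> 0 \<le> u x \<and> u x \<le> 1"
    and L01: "\<And>x y. 0 \<le> L x y \<and> L x y \<le> 1"
    and q: "0 \<le> q" "q \<le> 1" and eta: "0 \<le> \<eta>"
  shows "(\<Sum>y\<in>V. u y * (\<Sum>x\<in>V. \<Sum>x'\<in>V. (u x * B y x) * (u x' * B y x') * L x x'))
     \<le> q\<^sup>2 * (\<Sum>x\<in>V. u x) * (\<Sum>x\<in>V. \<Sum>x'\<in>V. u x * u x' * L x x') + 2 * \<eta> * (real (card V))^3"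
proof -
  define n where "n = real (card V)"
  define U where "U = (\<Sum>x\<in>V. u x)"
  have n0: "0 \<le> n" by (simp add: n_def)
  define v where "v x' = (\<Sum>x\<in>V. L x x' * u x)" for x'
  have v: "0 \<le> v x \<and> v x \<le> n" for x
  proof -
    have "v x \<le> (\<Sum>y\<in>V. 1)" unfolding v_def
      by (intro sum_mono) (use u L01 in \<open>simp add: mult_le_one\<close>)
    moreover have "0 \<le> v x" unfolding v_def by (intro sum_nonneg) (use u L01 in simp)
    ultimately show ?thesis by (simp add: n_def)
  qed
  have "(\<Sum>y\<in>V. u y * (\<Sum>x\<in>V. \<Sum>x'\<in>V. (u x * B y x) * (u x' * B y x') * L x x'))
    = (\<Sum>y\<in>V. \<Sum>x\<in>V. \<Sum>x'\<in>V. u x' * ((L x x' * u x) * (u y * B y x') * B x y))"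
    unfolding sum_distrib_left
  proof (intro sum.cong refl)
    fix y x x'
    show "u y * (u x * B y x * (u x' * B y x') * L x x') = u x' * (L x x' * u x * (u y * B y x') * B x y)"
      by (simp add: Bsym[of y x])
  qed
  also have "\<dots> = (\<Sum>x\<in>V. \<Sum>y\<in>V. \<Sum>x'\<in>V. u x' * ((L x x' * u x) * (u y * B y x') * B x y))"
    by (rule sum.swap)
  also have "\<dots> = (\<Sum>x\<in>V. \<Sum>x'\<in>V. \<Sum>y\<in>V. u x' * ((L x x' * u x) * (u y * B y x') * B x y))"
    by (intro sum.cong refl sum.swap)
  also have "\<dots> = (\<Sum>x'\<in>V. \<Sum>x\<in>V. \<Sum>y\<in>V. u x' * ((L x x' * u x) * (u y * B y x') * B x y))"
    by (rule sum.swap)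
  also have "\<dots> = (\<Sum>x'\<in>V. u x' * (\<Sum>x\<in>V. \<Sum>y\<in>V. (L x x' * u x) * (u y * B y x') * B x y))"
    by (simp add: sum_distrib_left)
  also have "\<dots> \<le> (\<Sum>x'\<in>V. u x' * (q * v x' * (\<Sum>y\<in>V. u y * B y x')) + \<eta> * n\<^sup>2)"
  proof (rule sum_mono)
    fix x' assume x': "x' \<in> V"
    have "(\<Sum>x\<in>V. \<Sum>y\<in>V. (L x x' * u x) * (u y * B y x') * B x y)
       \<le> q * v x' * (\<Sum>y\<in>V. u y * B y x') + \<eta> * n\<^sup>2"
      unfolding v_def n_def by (rule disc_upper[OF B]) (use u L01 B01 in \<open>auto simp: mult_le_one\<close>)
    then have "u x' * (\<Sum>x\<in>V. \<Sum>y\<in>V. (L x x' * u x) * (u y * B y x') * B x y)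
       \<le> u x' * (q * v x' * (\<Sum>y\<in>V. u y * B y x') + \<eta> * n\<^sup>2)"
      using u[OF x'] by (intro mult_left_mono) auto
    also have "\<dots> \<le> u x' * (q * v x' * (\<Sum>y\<in>V. u y * B y x')) + \<eta> * n\<^sup>2"
      using u[OF x'] eta mult_right_mono[of "u x'" 1 "\<eta> * n\<^sup>2"] by (simp add: algebra_simps)
    finally show "u x' * (\<Sum>x\<in>V. \<Sum>y\<in>V. (L x x' * u x) * (u y * B y x') * B x y)
       \<le> u x' * (q * v x' * (\<Sum>y\<in>V. u y * B y x')) + \<eta> * n\<^sup>2" .
  qed
  also have "\<dots> = q * (\<Sum>x'\<in>V. \<Sum>y\<in>V. (u x' * v x') * u y * B x' y) + \<eta> * n^3"
  proof -
    have "(\<Sum>x'\<in>V. u x' * (q * v x' * (\<Sum>y\<in>V. u y * B y x')))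
       = q * (\<Sum>x'\<in>V. \<Sum>y\<in>V. (u x' * v x') * u y * B x' y)"
      unfolding sum_distrib_left
    proof (intro sum.cong refl)
      fix x' y
      show "u x' * (q * v x' * (u y * B y x')) = q * (u x' * v x' * u y * B x' y)"
        by (simp add: Bsym[of y x'])
    qed
    then show ?thesis
      by (simp add: sum.distrib n_def power3_eq_cube power2_eq_square)
  qed
  also have "(\<Sum>x'\<in>V. \<Sum>y\<in>V. (u x' * v x') * u y * B x' y) \<le> q * (\<Sum>x\<in>V. u x * v x) * U + \<eta> * n^3"
  proof (cases "n = 0")
    case True
    then have "V = {}" using fin by (simp add: n_def)
    then show ?thesis by (simp add: True)
  next
    case False
    then have np: "n > 0" using n0 by simp
    \<comment> \<open>Division by n brings \<open>u * v\<close> into the range of the test functions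
      of \<open>disc\<close>.\<close>
    have "(\<Sum>x'\<in>V. \<Sum>y\<in>V. (u x' * v x' / n) * u y * B x' y)
       \<le> q * (\<Sum>x\<in>V. u x * v x / n) * U + \<eta> * n\<^sup>2"
      unfolding U_def n_def
    proof (rule disc_upper[OF B])
      fix x assume x: "x \<in> V"
      have "u x * v x \<le> 1 * n" by (intro mult_mono) (use u[OF x] v[of x] in auto)
      then show "\<bar>u x * v x / real (card V)\<bar> \<le> 1" using np u[OF x] v[of x] by (simp add: n_def)
    qed (use u in auto)
    moreover have "(\<Sum>x'\<in>V. \<Sum>y\<in>V. (u x' * v x' / n) * u y * B x' y)
        = (\<Sum>x'\<in>V. \<Sum>y\<in>V. (u x' * v x') * u y * B x' y) / n"
      by (simp add: sum_divide_distrib)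
    moreover have "(\<Sum>x\<in>V. u x * v x / n) = (\<Sum>x\<in>V. u x * v x) / n"
      by (simp add: sum_divide_distrib)
    ultimately show ?thesis using np by (simp add: field_simps power3_eq_cube power2_eq_square)
  qed
  finally have "(\<Sum>y\<in>V. u y * (\<Sum>x\<in>V. \<Sum>x'\<in>V. (u x * B y x) * (u x' * B y x') * L x x'))
     \<le> q * (q * (\<Sum>x\<in>V. u x * v x) * U + \<eta> * n^3) + \<eta> * n^3"
    using q(1) by (simp add: mult_left_mono)
  also have "\<dots> \<le> q\<^sup>2 * U * (\<Sum>x\<in>V. u x * v x) + 2 * \<eta> * n^3"
    using mult_right_mono[of q 1 "\<eta> * n^3"] q eta n0 by (simp add: algebra_simps power2_eq_square)
  also have "(\<Sum>x\<in>V. u x * v x) = (\<Sum>x\<in>V. \<Sum>x'\<in>V. u x * u x' * L x x')"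
    unfolding v_def sum_distrib_left by (subst sum.swap) (simp add: algebra_simps)
  finally show ?thesis by (simp add: U_def n_def)
qed

text \<open>
  The error \<open>\<epsilon>\<close> in the quasirandomness of \<open>A\<close> does not tend to zero with the size of the clumps,
  hence it has to be measured against the quadratic form of \<open>L\<close>.  Vertex sets of total weight
  below \<open>\<theta> |V|\<close> are negligible.
\<close>

lemma cross_edges_bound:
  fixes u :: "'v \<Rightarrow> real" and A B FA FB L :: "'v \<Rightarrow> 'v \<Rightarrow> real"
  assumes fin: "finite V" and ne: "V \<noteq> {}"
    and u: "\<And>x. x \<in> V \<Longrightarrow> 0 \<le> u x \<and> u x \<le> 1"
    and A01: "\<And>x y. 0 \<le> A x y \<and> A x y \<le> 1"
    and B01: "\<And>x y. 0 \<le> B x y \<and> B x y \<le> 1" and Bsym: "\<And>x y. B x y = B y x"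
    and L01: "\<And>x y. 0 \<le> L x y \<and> L x y \<le> 1"
    and FA: "\<And>x y. 0 \<le> FA x y \<and> FA x y \<le> A x y"
    and FB: "\<And>x y. FB x y = 0 \<or> FB x y = 1" "\<And>x y. FB x y \<le> B x y"
    and FBsym: "\<And>x y. FB x y = FB y x"
    and tri: "\<And>x y z. \<lbrakk>x \<in> V; y \<in> V; z \<in> V; FB x y = 1\<rbrakk>
        \<Longrightarrow> FA x z * B y z + A x z * FB y z \<le> A x z * B y z"
    and discB: "disc V \<eta> (\<lambda>x y. B x y - q)"
    and discA: "\<And>\<phi> \<psi> w. (\<And>x. x \<in> V \<Longrightarrow> \<bar>\<phi> x\<bar> \<le> w x \<and> \<bar>\<psi> x\<bar> \<le> w x \<and> w x \<le> 1) \<Longrightarrow>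
        (\<Sum>x\<in>V. \<Sum>y\<in>V. \<phi> x * \<psi> y * (A x y - q))
         \<le> \<eta> * (real (card V))\<^sup>2 + \<epsilon> * (\<Sum>x\<in>V. \<Sum>y\<in>V. w x * w y * L x y)"
    and q: "0 < q" "q \<le> 1" and eta: "0 \<le> \<eta>" and eps: "0 \<le> \<epsilon>" "\<epsilon> \<le> 1"
    and delta: "0 < \<delta>" "\<delta> \<le> 1" and theta: "0 < \<theta>" "\<theta> \<le> 1"
  shows "(\<Sum>x\<in>V. \<Sum>y\<in>V. u x * u y * (FA x y + FB x y))
     \<le> (1 + \<delta>) * q * (\<Sum>x\<in>V. u x)\<^sup>2 + 5 * \<epsilon> / \<delta> * (\<Sum>x\<in>V. \<Sum>y\<in>V. u x * u y * L x y)
       + (15 * \<eta> / (\<delta> * q\<^sup>2 * \<theta>) + 2 * \<theta>) * (real (card V))\<^sup>2"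
proof -
  define n where "n = real (card V)"
  define U where "U = (\<Sum>x\<in>V. u x)"
  define S where "S = (\<Sum>x\<in>V. \<Sum>y\<in>V. u x * u y * L x y)"
  have n: "n \<ge> 1" using fin ne card_gt_0_iff[of V] by (simp add: n_def Suc_le_eq)
  have FB01: "0 \<le> FB x y \<and> FB x y \<le> 1" for x y using FB(1)[of x y] by auto
  have FA1: "FA x y \<le> 1" for x y using FA[of x y] A01[of x y] by auto
  have U0: "0 \<le> U" unfolding U_def by (intro sum_nonneg) (use u in auto)
  have S0: "0 \<le> S" unfolding S_def by (intro sum_nonneg mult_nonneg_nonneg) (use u L01 in auto)
  have Un: "U \<le> n"
    unfolding U_def n_def using sum_mono[of V u "\<lambda>_. 1"] u by auto
  have e0: "0 \<le> 15 * \<eta> / (\<delta> * q\<^sup>2 * \<theta>)" using eta delta q theta by simp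
  show ?thesis
  proof (cases "U < \<theta> * n")
    \<comment> \<open>For small total weight the trivial bound \<open>2 * U\<^sup>2\<close> already
      lies within the \<open>2 * \<theta>\<close> error. In the other case U is a positive
      proportion of n and may be divided by.\<close>
    case True
    have "FA x y + FB x y \<le> 2" for x y using FA1[of x y] FB01[of x y] by simp
    then have "(\<Sum>x\<in>V. \<Sum>y\<in>V. u x * u y * (FA x y + FB x y)) \<le> (\<Sum>x\<in>V. \<Sum>y\<in>V. u x * u y * 2)"
      by (intro sum_mono mult_left_mono mult_nonneg_nonneg) (use u in auto)
    also have "\<dots> = 2 * U\<^sup>2"
      by (simp add: U_def power2_eq_square sum_product sum_distrib_left mult_ac)
    also have "U\<^sup>2 \<le> (\<theta> * n)\<^sup>2" using True U0 by (intro power_mono) auto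
    also have "(\<theta> * n)\<^sup>2 \<le> \<theta> * n\<^sup>2"
    proof -
      have "\<theta> * \<theta> \<le> \<theta> * 1" using theta by (intro mult_left_mono) auto
      from mult_right_mono[OF this, of "n\<^sup>2"] show ?thesis by (simp add: power2_eq_square mult_ac)
    qed
    finally have "(\<Sum>x\<in>V. \<Sum>y\<in>V. u x * u y * (FA x y + FB x y)) \<le> 2 * \<theta> * n\<^sup>2" by simp
    moreover have "0 \<le> (1 + \<delta>) * q * U\<^sup>2" "0 \<le> 5 * \<epsilon> / \<delta> * S"
      using delta q eps S0 by auto
    moreover have "0 \<le> 15 * \<eta> / (\<delta> * q\<^sup>2 * \<theta>) * n\<^sup>2" using mult_nonneg_nonneg[OF e0, of "n\<^sup>2"] by simp
    ultimately show ?thesis unfolding U_def[symmetric] S_def[symmetric] n_def[symmetric]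
      by (simp only: distrib_right)
  next
    case False
    then have Ut: "\<theta> * n \<le> U" by simp
    then have Up: "0 < U" using theta n by (metis less_le_trans mult_pos_pos zero_less_one)
    define a where "a x = (\<Sum>z\<in>V. FA x z * u z)" for x
    define b where "b x = (\<Sum>z\<in>V. FB x z * u z)" for x
    \<comment> \<open>\<open>E1\<close> to \<open>E4\<close> are the errors of replacing
      \<open>B y z\<close> or \<open>A x z\<close> by q in the sums over z that describe
      neighbourhoods.\<close>
    define E1 where "E1 x y = \<bar>\<Sum>z\<in>V. (FA x z * u z) * (B y z - q)\<bar>" for x y
    define E2 where "E2 x y = \<bar>\<Sum>z\<in>V. (FB y z * u z) * (A x z - q)\<bar>" for x y
    define E3 where "E3 x y = \<bar>\<Sum>z\<in>V. (A x z * u z) * (B y z - q)\<bar>" for x y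
    define E4 where "E4 x = \<bar>\<Sum>z\<in>V. u z * (A x z - q)\<bar>" for x
    define E where "E x y = E1 x y + E2 x y + E3 x y + q * E4 x" for x y
    have E0: "0 \<le> E x y" for x y using q by (simp add: E_def E1_def E2_def E3_def E4_def)
    \<comment> \<open>Summed over z, \<open>tri\<close> says that two parts of the common
      neighbourhood of x and y, one cut out by \<open>FA\<close> at x and one by \<open>FB\<close>
      at y, do not overlap. Their weights are about \<open>q * a x\<close> and
      \<open>q * b y\<close>, the whole has weight about \<open>q\<^sup>2 * U\<close>.\<close>
    have typical: "q * a x + q * b y \<le> q\<^sup>2 * U + E x y" if "x \<in> V" "y \<in> V" "FB x y = 1" for x y
    proof -
      have s1: "(\<Sum>z\<in>V. (FA x z * u z) * (B y z - q)) = (\<Sum>z\<in>V. u z * (FA x z * B y z)) - q * a x"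
        by (simp add: a_def sum_distrib_left sum_subtractf algebra_simps)
      have s2: "(\<Sum>z\<in>V. (FB y z * u z) * (A x z - q)) = (\<Sum>z\<in>V. u z * (A x z * FB y z)) - q * b y"
        by (simp add: b_def sum_distrib_left sum_subtractf algebra_simps)
      have s3: "(\<Sum>z\<in>V. (A x z * u z) * (B y z - q)) = (\<Sum>z\<in>V. u z * (A x z * B y z)) - q * (\<Sum>z\<in>V. u z * A x z)"
        by (simp add: sum_distrib_left sum_subtractf algebra_simps)
      have s4: "(\<Sum>z\<in>V. u z * (A x z - q)) = (\<Sum>z\<in>V. u z * A x z) - q * U"
        by (simp add: U_def sum_distrib_left sum_subtractf algebra_simps)
      have "(\<Sum>z\<in>V. u z * (FA x z * B y z)) + (\<Sum>z\<in>V. u z * (A x z * FB y z))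
         = (\<Sum>z\<in>V. u z * (FA x z * B y z + A x z * FB y z))"
        by (simp add: sum.distrib distrib_left)
      also have "\<dots> \<le> (\<Sum>z\<in>V. u z * (A x z * B y z))"
        by (intro sum_mono mult_left_mono tri) (use that u in auto)
      finally have m: "(\<Sum>z\<in>V. u z * (FA x z * B y z)) + (\<Sum>z\<in>V. u z * (A x z * FB y z))
         \<le> (\<Sum>z\<in>V. u z * (A x z * B y z))" .
      have "(\<Sum>z\<in>V. u z * A x z) - q * U \<le> E4 x" unfolding E4_def s4 by simp
      from mult_left_mono[OF this, of q] have "q * (\<Sum>z\<in>V. u z * A x z) - q\<^sup>2 * U \<le> q * E4 x"
        using q by (simp add: algebra_simps power2_eq_square)
      moreover have "- (\<Sum>z\<in>V. (FA x z * u z) * (B y z - q)) \<le> E1 x y"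
        "- (\<Sum>z\<in>V. (FB y z * u z) * (A x z - q)) \<le> E2 x y"
        "(\<Sum>z\<in>V. (A x z * u z) * (B y z - q)) \<le> E3 x y" by (auto simp: E1_def E2_def E3_def)
      ultimately show ?thesis using m unfolding s1 s2 s3 E_def by linarith
    qed
    \<comment> \<open>The counterpart of \<open>disc_abs\<close> for the hypothesis on
      \<open>A\<close>; the additional factor \<open>v\<close> is harmless, as the test function
      stays dominated by \<open>w\<close>.\<close>
    have discA_abs: "(\<Sum>x\<in>V. w x * v x * \<bar>\<Sum>y\<in>V. \<psi> y * (A x y - q)\<bar>)
         \<le> \<eta> * n\<^sup>2 + \<epsilon> * (\<Sum>x\<in>V. \<Sum>y\<in>V. w x * w y * L x y)"
      if "\<And>x. x \<in> V \<Longrightarrow> 0 \<le> w x \<and> w x \<le> 1" "\<And>x. x \<in> V \<Longrightarrow> 0 \<le> v x \<and> v x \<le> 1" "\<And>x. x \<in> V \<Longrightarrow> \<bar>\<psi> x\<bar> \<le> w x"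
      for w v \<psi>
    proof -
      define s where "s x = sgn (\<Sum>y\<in>V. \<psi> y * (A x y - q))" for x
      have "(\<Sum>x\<in>V. \<Sum>y\<in>V. (w x * v x * s x) * \<psi> y * (A x y - q))
        \<le> \<eta> * n\<^sup>2 + \<epsilon> * (\<Sum>x\<in>V. \<Sum>y\<in>V. w x * w y * L x y)"
        unfolding n_def
      proof (rule discA)
        fix x assume x: "x \<in> V"
        have "w x * v x * \<bar>s x\<bar> \<le> w x * 1 * 1"
          by (intro mult_mono) (use that x in \<open>auto simp: s_def sgn_if\<close>)
        then show "\<bar>w x * v x * s x\<bar> \<le> w x \<and> \<bar>\<psi> x\<bar> \<le> w x \<and> w x \<le> 1"
          using that x by (auto simp: abs_mult)
      qed
      moreover have "(\<Sum>y\<in>V. (w x * v x * s x) * \<psi> y * (A x y - q))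
         = w x * v x * \<bar>\<Sum>y\<in>V. \<psi> y * (A x y - q)\<bar>" for x
      proof -
        have "(\<Sum>y\<in>V. (w x * v x * s x) * \<psi> y * (A x y - q)) = w x * v x * (s x * (\<Sum>y\<in>V. \<psi> y * (A x y - q)))"
          by (simp add: sum_distrib_left mult.assoc)
        then show ?thesis by (simp add: s_def abs_sgn mult.commute)
      qed
      ultimately show ?thesis by simp
    qed
    define T where "T X = (\<Sum>x\<in>V. \<Sum>y\<in>V. u x * u y * FB x y * X x y)" for X :: "'v \<Rightarrow> 'v \<Rightarrow> real"
    have w01: "0 \<le> u x * u y * FB x y \<and> u x * u y * FB x y \<le> 1" if "x \<in> V" "y \<in> V" for x y
      using u[OF that(1)] u[OF that(2)] FB01[of x y] by (auto intro!: mult_le_one mult_nonneg_nonneg)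
    have discB_row: "(\<Sum>x\<in>V. \<Sum>y\<in>V. \<bar>\<Sum>z\<in>V. (h x z * u z) * (B y z - q)\<bar>) \<le> \<eta> * n^3"
      if "\<And>x y. 0 \<le> h x y \<and> h x y \<le> (1::real)" for h
    proof -
      have "(\<Sum>y\<in>V. \<bar>\<Sum>z\<in>V. (h x z * u z) * (B y z - q)\<bar>) \<le> \<eta> * n\<^sup>2" for x
      proof -
        have "(\<Sum>y\<in>V. 1 * \<bar>\<Sum>z\<in>V. (h x z * u z) * (B y z - q)\<bar>) \<le> \<eta> * n\<^sup>2"
          unfolding n_def
          by (rule disc_abs[OF discB]) (use u that in \<open>auto simp: abs_mult mult_le_one\<close>)
        then show ?thesis by simp
      qed
      then have "(\<Sum>x\<in>V. \<Sum>y\<in>V. \<bar>\<Sum>z\<in>V. (h x z * u z) * (B y z - q)\<bar>) \<le> (\<Sum>x\<in>V. \<eta> * n\<^sup>2)"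
        by (intro sum_mono)
      then show ?thesis by (simp add: n_def power3_eq_cube power2_eq_square mult_ac)
    qed
    have Tle: "T X \<le> (\<Sum>x\<in>V. \<Sum>y\<in>V. X x y)" if "\<And>x y. 0 \<le> X x y" for X
      unfolding T_def by (intro sum_mono mult_left_le_one_le) (use w01 that in auto)
    have T1: "T E1 \<le> \<eta> * n^3"
      using Tle[of E1] discB_row[of FA] FA FA1 by (auto simp: E1_def)
    have T3: "T E3 \<le> \<eta> * n^3"
      using Tle[of E3] discB_row[of A] A01 by (auto simp: E3_def)
    have expand: "(\<Sum>y\<in>V. u y * (c + \<epsilon> * X y)) = U * c + \<epsilon> * (\<Sum>y\<in>V. u y * X y)" for c X
      by (simp add: U_def distrib_left sum.distrib sum_distrib_left sum_distrib_right mult_ac)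
    \<comment> \<open>For fixed y the test functions are supported on the
      \<open>B\<close>-neighbourhood of y, so \<epsilon> multiplies the \<open>L\<close>-form of
      this neighbourhood only. Summed over y these forms are the cherries of
      \<open>disc_sq_degree\<close>.\<close>
    have T2: "T E2 \<le> 3 * \<eta> * n^3 + \<epsilon> * (q\<^sup>2 * U * S)"
    proof -
      have "T E2 = (\<Sum>y\<in>V. u y * (\<Sum>x\<in>V. (u x * B y x) * FB y x * E2 x y))"
      proof -
        have ee: "u x * u y * FB x y * E2 x y = u y * ((u x * B y x) * FB y x * E2 x y)" for x y
        proof (cases "FB x y = 1")
          case True
          then have "B y x = 1" using FB(2)[of x y] B01[of x y] Bsym[of x y] by linarith
          then show ?thesis using True FBsym by simp
        next
          case False
          then have "FB x y = 0" using FB(1)[of x y] by auto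
          then show ?thesis using FBsym[of x y] by simp
        qed
        show ?thesis unfolding T_def sum_distrib_left by (subst sum.swap) (intro sum.cong refl ee)
      qed
      also have "\<dots> \<le> (\<Sum>y\<in>V. u y * (\<eta> * n\<^sup>2 + \<epsilon> * (\<Sum>x\<in>V. \<Sum>x'\<in>V. (u x * B y x) * (u x' * B y x') * L x x')))"
      proof (intro sum_mono mult_left_mono)
        fix y assume y: "y \<in> V"
        show "(\<Sum>x\<in>V. (u x * B y x) * FB y x * E2 x y) \<le> \<eta> * n\<^sup>2 + \<epsilon> * (\<Sum>x\<in>V. \<Sum>x'\<in>V. (u x * B y x) * (u x' * B y x') * L x x')"
          unfolding E2_def
        proof (rule discA_abs)
          fix x assume x: "x \<in> V"
          show "0 \<le> u x * B y x \<and> u x * B y x \<le> 1" using u[OF x] B01 by (simp add: mult_le_one)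
          have "FB y x * u x \<le> B y x * u x" using u[OF x] FB(2) by (intro mult_right_mono) auto
          then show "\<bar>FB y x * u x\<bar> \<le> u x * B y x" using u[OF x] FB01[of y x] by (simp add: abs_mult mult.commute)
        qed (use FB01 in auto)
      qed (use u in auto)
      also have "\<dots> = U * (\<eta> * n\<^sup>2) + \<epsilon> * (\<Sum>y\<in>V. u y * (\<Sum>x\<in>V. \<Sum>x'\<in>V. (u x * B y x) * (u x' * B y x') * L x x'))"
        by (rule expand)
      also have "\<dots> \<le> n * (\<eta> * n\<^sup>2) + \<epsilon> * (q\<^sup>2 * U * S + 2 * \<eta> * n^3)"
        using disc_sq_degree[OF fin discB B01 Bsym u L01] q eta eps Un
        unfolding U_def S_def n_def by (intro add_mono mult_left_mono mult_right_mono) auto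
      also have "\<dots> \<le> 3 * \<eta> * n^3 + \<epsilon> * (q\<^sup>2 * U * S)"
        using eps eta n mult_right_mono[of \<epsilon> 1 "2 * \<eta> * n^3"] by (simp add: algebra_simps power3_eq_cube power2_eq_square)
      finally show ?thesis .
    qed
    have T4': "(\<Sum>x\<in>V. u x * E4 x) \<le> \<eta> * n\<^sup>2 + \<epsilon> * S"
    proof -
      have "(\<Sum>x\<in>V. u x * 1 * E4 x) \<le> \<eta> * n\<^sup>2 + \<epsilon> * S"
        unfolding E4_def S_def by (rule discA_abs) (use u in auto)
      then show ?thesis by simp
    qed
    have E4n: "0 \<le> E4 x \<and> E4 x \<le> n" for x
    proof -
      have "E4 x \<le> (\<Sum>z\<in>V. \<bar>u z * (A x z - q)\<bar>)" unfolding E4_def by (rule sum_abs)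
      also have "\<dots> \<le> (\<Sum>z\<in>V. 1)"
      proof (rule sum_mono)
        fix z assume "z \<in> V"
        then have "\<bar>u z\<bar> \<le> 1" "\<bar>A x z - q\<bar> \<le> 1" using u A01[of x z] q by (auto simp: abs_le_iff)
        then show "\<bar>u z * (A x z - q)\<bar> \<le> 1" by (simp add: abs_mult mult_le_one)
      qed
      finally show ?thesis by (simp add: n_def E4_def)
    qed
    \<comment> \<open>\<open>FB\<close> is bounded by \<open>B\<close>, and averaging over y
      replaces \<open>B\<close> by q. With the factor q already present this gives
      \<open>q\<^sup>2 * U\<close> once more.\<close>
    have T4: "T (\<lambda>x y. q * E4 x) \<le> 2 * \<eta> * n^3 + \<epsilon> * (q\<^sup>2 * U * S)"
    proof -
      have "T (\<lambda>x y. q * E4 x) \<le> (\<Sum>x\<in>V. \<Sum>y\<in>V. (q * n) * ((u x * (E4 x / n)) * u y * B x y))"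
        unfolding T_def
      proof (intro sum_mono)
        fix x y assume xy: "x \<in> V" "y \<in> V"
        have "u x * u y * q * E4 x * FB x y \<le> u x * u y * q * E4 x * B x y"
          using u xy q E4n FB(2) by (intro mult_left_mono mult_nonneg_nonneg) auto
        then show "u x * u y * FB x y * (q * E4 x) \<le> (q * n) * ((u x * (E4 x / n)) * u y * B x y)"
          using n by (simp add: mult_ac)
      qed
      also have "\<dots> = (q * n) * (\<Sum>x\<in>V. \<Sum>y\<in>V. (u x * (E4 x / n)) * u y * B x y)"
        by (simp add: sum_distrib_left)
      also have "\<dots> \<le> (q * n) * (q * (\<Sum>x\<in>V. u x * (E4 x / n)) * U + \<eta> * n\<^sup>2)"
        unfolding U_def n_def
      proof (intro mult_left_mono disc_upper[OF discB])
        fix x assume x: "x \<in> V"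
        have "E4 x / n \<le> 1" "0 \<le> E4 x / n" using E4n[of x] n by auto
        then show "\<bar>u x * (E4 x / real (card V))\<bar> \<le> 1" using u[OF x]
          unfolding n_def[symmetric] abs_mult by (intro mult_le_one) auto
      qed (use u q in auto)
      also have "(\<Sum>x\<in>V. u x * (E4 x / n)) = (\<Sum>x\<in>V. u x * E4 x) / n"
        by (simp add: sum_divide_distrib)
      also have "(q * n) * (q * ((\<Sum>x\<in>V. u x * E4 x) / n) * U + \<eta> * n\<^sup>2)
         = q\<^sup>2 * U * (\<Sum>x\<in>V. u x * E4 x) + q * (\<eta> * n^3)"
        using n by (simp add: algebra_simps power3_eq_cube power2_eq_square)
      also have "\<dots> \<le> q\<^sup>2 * U * (\<eta> * n\<^sup>2 + \<epsilon> * S) + 1 * (\<eta> * n^3)"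
        using T4' q U0 eta n by (intro add_mono mult_left_mono mult_right_mono) auto
      also have "\<dots> \<le> 2 * \<eta> * n^3 + \<epsilon> * (q\<^sup>2 * U * S)"
      proof -
        have "q\<^sup>2 * U \<le> 1 * n" using q Un U0 by (intro mult_mono) (auto simp: power_le_one)
        from mult_right_mono[OF this, of "\<eta> * n\<^sup>2"] show ?thesis
          using eta by (simp add: algebra_simps power3_eq_cube power2_eq_square)
      qed
      finally show ?thesis .
    qed
    have TE: "T E \<le> 7 * \<eta> * n^3 + 2 * \<epsilon> * (q\<^sup>2 * U * S)"
    proof -
      have "T E = T E1 + T E2 + T E3 + T (\<lambda>x y. q * E4 x)"
        by (simp add: T_def E_def sum.distrib distrib_left)
      then show ?thesis using T1 T2 T3 T4 by linarith
    qed
    \<comment> \<open>Preparation for Markov's inequality: edges with a large error in either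
      direction are dropped, which keeps \<open>h\<close> symmetric. On the others
      \<open>typical\<close> becomes \<open>a x + b y \<le> c\<close>.\<close>
    define bad where "bad x y \<longleftrightarrow> E x y > \<delta> * q\<^sup>2 * U \<or> E y x > \<delta> * q\<^sup>2 * U" for x y
    define h where "h x y = (if bad x y then 0 else FB x y)" for x y
    define c where "c = (1 + \<delta>) * q * U"
    define b' where "b' x = (\<Sum>y\<in>V. h x y * u y)" for x
    have dq: "0 < \<delta> * q\<^sup>2 * U" using delta q Up by simp
    have c0: "0 \<le> c" using delta q U0 by (simp add: c_def)
    have hFB: "0 \<le> h x y \<and> h x y \<le> FB x y" for x y using FB01 by (simp add: h_def)
    \<comment> \<open>Truncating \<open>a\<close> at \<open>c\<close> supplies the pointwise bound
      demanded by \<open>weighted_degree_bound\<close>; \<open>asum\<close> pays for the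
      truncation.\<close>
    have key: "(\<Sum>x\<in>V. u x * (min (a x) c + b' x)) \<le> c * (\<Sum>x\<in>V. u x)"
    proof (rule weighted_degree_bound[OF fin, of u _ c h])
      fix x y assume xy: "x \<in> V" "y \<in> V" "h x y = 1"
      then have "FB x y = 1" "\<not> bad x y" by (auto simp: h_def split: if_splits)
      then have "q * a x + q * b y \<le> q\<^sup>2 * U + \<delta> * q\<^sup>2 * U"
        using typical[OF xy(1,2)] by (auto simp: bad_def)
      then have "q * (a x + b y) \<le> q * c" by (simp add: c_def algebra_simps power2_eq_square)
      then have "a x + b y \<le> c" using q by simp
      moreover have "b' y \<le> b y" unfolding b'_def b_def
        by (intro sum_mono mult_right_mono) (use hFB u in auto)
      ultimately show "min (a x) c + b' y \<le> c" by simp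
    qed (use u FB FBsym in \<open>auto simp: h_def bad_def b'_def\<close>)
    have badsum: "(\<Sum>x\<in>V. \<Sum>y\<in>V. u x * u y * (FB x y - h x y)) \<le> 2 * T E / (\<delta> * q\<^sup>2 * U)"
    proof -
      have "u x * u y * (FB x y - h x y) \<le> (u x * u y * FB x y * E x y + u y * u x * FB y x * E y x) / (\<delta> * q\<^sup>2 * U)"
        if xy: "x \<in> V" "y \<in> V" for x y
      proof (cases "bad x y")
        case True
        then have "\<delta> * q\<^sup>2 * U \<le> E x y + E y x" using E0[of x y] E0[of y x] by (auto simp: bad_def)
        then have "1 \<le> (E x y + E y x) / (\<delta> * q\<^sup>2 * U)" using dq by simp
        then have "u x * u y * FB x y * 1 \<le> u x * u y * FB x y * ((E x y + E y x) / (\<delta> * q\<^sup>2 * U))"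
          using w01[OF xy] by (intro mult_left_mono) auto
        then show ?thesis using True by (simp add: h_def FBsym[of y x] algebra_simps add_divide_distrib)
      next
        case False
        then show ?thesis using w01[OF xy] w01[OF xy(2,1)] E0 dq
          by (auto simp: h_def intro!: divide_nonneg_pos add_nonneg_nonneg mult_nonneg_nonneg)
      qed
      then have "(\<Sum>x\<in>V. \<Sum>y\<in>V. u x * u y * (FB x y - h x y)) \<le>
         (\<Sum>x\<in>V. \<Sum>y\<in>V. (u x * u y * FB x y * E x y + u y * u x * FB y x * E y x) / (\<delta> * q\<^sup>2 * U))"
        by (intro sum_mono)
      also have "\<dots> = (T E + (\<Sum>x\<in>V. \<Sum>y\<in>V. u y * u x * FB y x * E y x)) / (\<delta> * q\<^sup>2 * U)"
        by (simp add: T_def sum_divide_distrib sum.distrib add_divide_distrib)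
      also have "(\<Sum>x\<in>V. \<Sum>y\<in>V. u y * u x * FB y x * E y x) = T E"
        unfolding T_def by (rule sum.swap)
      finally show ?thesis by simp
    qed
    \<comment> \<open>\<open>a x\<close> is at most the weighted \<open>A\<close>-degree of x, which
      exceeds \<open>q * U \<le> c\<close> by at most \<open>E4 x\<close>.\<close>
    have asum: "(\<Sum>x\<in>V. u x * (a x - min (a x) c)) \<le> \<eta> * n\<^sup>2 + \<epsilon> * S"
    proof -
      have "(\<Sum>x\<in>V. u x * (a x - min (a x) c)) \<le> (\<Sum>x\<in>V. u x * E4 x)"
      proof (intro sum_mono mult_left_mono)
        fix x
        have "(\<Sum>z\<in>V. u z * (A x z - q)) = (\<Sum>z\<in>V. u z * A x z) - q * U"
          by (simp add: U_def sum_distrib_left sum_subtractf algebra_simps)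
        then have "(\<Sum>z\<in>V. u z * A x z) - q * U \<le> E4 x" by (simp add: E4_def)
        moreover have "a x \<le> (\<Sum>z\<in>V. u z * A x z)" unfolding a_def
          by (subst mult.commute, intro sum_mono mult_left_mono) (use FA u in auto)
        moreover have "q * U \<le> c" using delta q U0 by (simp add: c_def mult_right_mono)
        ultimately show "a x - min (a x) c \<le> E4 x" using E4n[of x] by (auto simp: min_def)
      qed (use u in auto)
      then show ?thesis using T4' by simp
    qed
    have "(\<Sum>x\<in>V. \<Sum>y\<in>V. u x * u y * (FA x y + FB x y))
       = (\<Sum>x\<in>V. u x * a x) + (\<Sum>x\<in>V. u x * b' x) + (\<Sum>x\<in>V. \<Sum>y\<in>V. u x * u y * (FB x y - h x y))"
      unfolding a_def b'_def sum_distrib_left sum.distrib[symmetric]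
      by (intro sum.cong refl) (simp add: algebra_simps)
    also have "(\<Sum>x\<in>V. u x * a x) = (\<Sum>x\<in>V. u x * min (a x) c) + (\<Sum>x\<in>V. u x * (a x - min (a x) c))"
      by (simp add: sum.distrib[symmetric] algebra_simps)
    finally have split_sum: "(\<Sum>x\<in>V. \<Sum>y\<in>V. u x * u y * (FA x y + FB x y))
       = (\<Sum>x\<in>V. u x * min (a x) c) + (\<Sum>x\<in>V. u x * (a x - min (a x) c)) + (\<Sum>x\<in>V. u x * b' x)
         + (\<Sum>x\<in>V. \<Sum>y\<in>V. u x * u y * (FB x y - h x y))" .
    \<comment> \<open>The coefficients 7 and 2 of \<open>T E\<close> are doubled by
      \<open>badsum\<close>; one more of each kind from \<open>asum\<close> leads to the 15 and 5 of
      the claim.\<close>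
    have "(\<Sum>x\<in>V. \<Sum>y\<in>V. u x * u y * (FA x y + FB x y))
       \<le> c * U + (\<eta> * n\<^sup>2 + \<epsilon> * S) + 2 * (7 * \<eta> * n^3 + 2 * \<epsilon> * (q\<^sup>2 * U * S)) / (\<delta> * q\<^sup>2 * U)"
    proof -
      have "2 * T E / (\<delta> * q\<^sup>2 * U) \<le> 2 * (7 * \<eta> * n^3 + 2 * \<epsilon> * (q\<^sup>2 * U * S)) / (\<delta> * q\<^sup>2 * U)"
        using TE dq by (intro divide_right_mono mult_left_mono) auto
      moreover have "(\<Sum>x\<in>V. u x * min (a x) c) + (\<Sum>x\<in>V. u x * b' x) \<le> c * U"
        using key by (simp add: distrib_left sum.distrib U_def)
      ultimately show ?thesis using split_sum badsum asum by linarith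
    qed
    also have "2 * (7 * \<eta> * n^3 + 2 * \<epsilon> * (q\<^sup>2 * U * S)) / (\<delta> * q\<^sup>2 * U)
        = 14 * \<eta> * n^3 / (\<delta> * q\<^sup>2 * U) + 4 * \<epsilon> / \<delta> * S"
      using Up q delta by (simp add: field_simps)
    also have "14 * \<eta> * n^3 / (\<delta> * q\<^sup>2 * U) \<le> 14 * \<eta> * n^3 / (\<delta> * q\<^sup>2 * (\<theta> * n))"
      using Ut Up q delta theta n eta by (intro divide_left_mono mult_left_mono mult_pos_pos) auto
    also have "14 * \<eta> * n^3 / (\<delta> * q\<^sup>2 * (\<theta> * n)) = 14 * (\<eta> / (\<delta> * q\<^sup>2 * \<theta>)) * n\<^sup>2"
      using n q delta theta by (simp add: field_simps power3_eq_cube power2_eq_square)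
    finally have fin': "(\<Sum>x\<in>V. \<Sum>y\<in>V. u x * u y * (FA x y + FB x y))
      \<le> c * U + (\<eta> * n\<^sup>2 + \<epsilon> * S) + (14 * (\<eta> / (\<delta> * q\<^sup>2 * \<theta>)) * n\<^sup>2 + 4 * \<epsilon> / \<delta> * S)" by simp
    define K where "K = \<eta> / (\<delta> * q\<^sup>2 * \<theta>)"
    define R where "R = \<epsilon> / \<delta>"
    have "\<eta> * 1 \<le> \<eta> * (1 / (\<delta> * q\<^sup>2 * \<theta>))"
    proof (intro mult_left_mono eta)
      have "\<delta> * q\<^sup>2 * \<theta> \<le> 1" using delta q theta by (intro mult_le_one) (auto simp: power_le_one)
      then show "1 \<le> 1 / (\<delta> * q\<^sup>2 * \<theta>)" using delta q theta by simp
    qed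
    then have h1: "\<eta> * n\<^sup>2 \<le> K * n\<^sup>2" unfolding K_def by (intro mult_right_mono) auto
    have h2: "\<epsilon> * S \<le> R * S"
    proof (rule mult_right_mono[OF _ S0])
      have "\<epsilon> * \<delta> \<le> \<epsilon> * 1" using eps delta by (intro mult_left_mono) auto
      then show "\<epsilon> \<le> R" using delta by (simp add: R_def field_simps)
    qed
    have cU: "c * U = (1 + \<delta>) * q * U\<^sup>2" by (simp add: c_def power2_eq_square)
    have h3: "0 \<le> \<theta> * n\<^sup>2" using theta by simp
    have e: "4 * \<epsilon> / \<delta> * S = 4 * (R * S)" "14 * K * n\<^sup>2 = 14 * (K * n\<^sup>2)" by (simp_all add: R_def)
    have e': "5 * \<epsilon> / \<delta> * S = 5 * (R * S)"
      "(15 * \<eta> / (\<delta> * q\<^sup>2 * \<theta>) + 2 * \<theta>) * n\<^sup>2 = 15 * (K * n\<^sup>2) + 2 * (\<theta> * n\<^sup>2)"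
      by (simp_all add: R_def K_def distrib_right)
    show ?thesis
      using fin'[folded K_def, unfolded e cU] h1 h2 h3
      unfolding U_def[symmetric] S_def[symmetric] n_def[symmetric] e' by linarith
  qed
qed

section \<open>Fractional matchings by edges inside clumps\<close>

text \<open>Divided by k, such an \<open>E\<close> is a fractional matching. Maximality puts every
  \<open>F\<close>-edge between two unsaturated vertices into \<open>E\<close>, so these edges
  number at most k per vertex, while a saturated vertex has k partners, enough to use
  quasirandomness on them.\<close>

lemma maximal_bounded_degree_subgraph:
  fixes F :: "'v \<Rightarrow> 'v \<Rightarrow> real" and k :: nat
  assumes fin: "finite V" and Fsym: "\<And>x y. F x y = F y x" and irr: "\<And>x. F x x = 0"
  obtains E :: "'v \<Rightarrow> 'v \<Rightarrow> real" where
    "\<And>x y. E x y = 0 \<or> E x y = 1" "\<And>x y. E x y = E y x" "\<And>x y. E x y = 1 \<Longrightarrow> F x y = 1"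
    "\<And>x. (\<Sum>y\<in>V. E x y) \<le> real k"
    "\<And>x y. \<lbrakk>x \<in> V; y \<in> V; F x y = 1; (\<Sum>z\<in>V. E x z) < real k; (\<Sum>z\<in>V. E y z) < real k\<rbrakk> \<Longrightarrow> E x y = 1"
proof -
  define dg where "dg R x = card {y\<in>V. (x, y) \<in> R}" for R :: "('v \<times> 'v) set" and x
  define \<A> where "\<A> = {R. R \<subseteq> V \<times> V \<and> sym R \<and> (\<forall>(x,y)\<in>R. F x y = 1) \<and> (\<forall>x. dg R x \<le> k)}"
  have "finite \<A>"
    by (rule finite_subset[of _ "Pow (V \<times> V)"]) (use fin in \<open>auto simp: \<A>_def\<close>)
  moreover have "{} \<in> \<A>" by (auto simp: \<A>_def dg_def sym_def)
  ultimately obtain R where R: "R \<in> \<A>" and max: "\<And>R'. R' \<in> \<A> \<Longrightarrow> R \<subseteq> R' \<Longrightarrow> R = R'"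
    by (metis finite_has_maximal empty_iff)
  define E :: "'v \<Rightarrow> 'v \<Rightarrow> real" where "E x y = of_bool ((x, y) \<in> R)" for x y
  have deg: "(\<Sum>y\<in>V. E x y) = real (dg R x)" for x
    using fin by (simp add: E_def dg_def Int_def conj_commute)
  show ?thesis
  proof
    show "E x y = 0 \<or> E x y = 1" "E x y = E y x" for x y
      using R by (auto simp: E_def \<A>_def sym_def)
    show "F x y = 1" if "E x y = 1" for x y
      using that R by (auto simp: E_def \<A>_def)
    show "(\<Sum>y\<in>V. E x y) \<le> real k" for x
      using R unfolding deg by (auto simp: \<A>_def)
    fix x y assume xy: "x \<in> V" "y \<in> V" "F x y = 1"
      and d: "(\<Sum>z\<in>V. E x z) < real k" "(\<Sum>z\<in>V. E y z) < real k"
    have ne: "x \<noteq> y" using xy irr by auto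
    define R' where "R' = insert (x, y) (insert (y, x) R)"
    have "dg R' z \<le> k" for z
    proof -
      have "dg R' z \<le> dg R z + 1" if "z = x \<or> z = y"
      proof -
        obtain w where "{y' \<in> V. (z, y') \<in> R'} \<subseteq> insert w {y' \<in> V. (z, y') \<in> R}"
          using that ne unfolding R'_def by auto
        then have "dg R' z \<le> card (insert w {y' \<in> V. (z, y') \<in> R})"
          unfolding dg_def using fin by (intro card_mono) auto
        also have "\<dots> \<le> dg R z + 1" unfolding dg_def by (simp add: card_insert_le_m1 card_insert_if fin)
        finally show ?thesis .
      qed
      moreover have "dg R' z = dg R z" if "z \<noteq> x" "z \<noteq> y"
        using that by (simp add: dg_def R'_def)
      moreover have "dg R x < k" "dg R y < k" using d unfolding deg by auto
      moreover have "dg R z \<le> k" using R by (auto simp: \<A>_def)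
      ultimately show ?thesis by (cases "z = x \<or> z = y") auto
    qed
    then have "R' \<in> \<A>" using R xy Fsym[of x y] by (auto simp: \<A>_def R'_def sym_def)
    then have "R = R'" using max by (auto simp: R'_def)
    then show "E x y = 1" by (auto simp: E_def R'_def)
  qed
qed

text \<open>The ends x, x' of an \<open>E\<close>-edge have disjoint
  \<open>F\<close>-neighbourhoods, so at most half of the edges from them to their common
  \<open>G\<close>-neighbours lie in \<open>F\<close>. For fixed x the partners x' together sample
  the vertices y with density \<open>W x' y = W x y\<close>, which extends the estimate to all
  neighbours of x. The error \<open>\<eta> * n\<^sup>2\<close> per x competes with k times n, hence
  k will be of order n.\<close>

lemma twin_matching_bound:
  fixes E F G W :: "'v \<Rightarrow> 'v \<Rightarrow> real" and g :: "'v \<Rightarrow> real"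
  assumes fin: "finite V"
    and disc: "disc V \<eta> (\<lambda>x y. G x y - W x y)" and eta: "0 \<le> \<eta>"
    and E01: "\<And>x y. E x y = 0 \<or> E x y = 1" and Esym: "\<And>x y. E x y = E y x"
    and F01: "\<And>x y. F x y = 0 \<or> F x y = 1" and G01: "\<And>x y. G x y = 0 \<or> G x y = 1"
    and FG: "\<And>x y. F x y \<le> G x y"
    and EF: "\<And>x y z. \<lbrakk>E x y = 1; F x z = 1; F y z = 1\<rbrakk> \<Longrightarrow> False"
    and twins: "\<And>x y z. E x y = 1 \<Longrightarrow> W x z = W y z"
    and W: "\<And>x y. q \<le> W x y" and q: "0 < q"
    and deg: "\<And>x. (\<Sum>y\<in>V. E x y) \<le> k" and k: "0 < k"
    and g: "\<And>x. x \<in> V \<Longrightarrow> 0 \<le> g x \<and> g x \<le> 1"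
  shows "2 * (\<Sum>x\<in>V. \<Sum>y\<in>V. (\<Sum>z\<in>V. E x z) * g y * F x y)
    \<le> (\<Sum>x\<in>V. \<Sum>y\<in>V. (\<Sum>z\<in>V. E x z) * g y * W x y) + \<eta> * (real (card V))^3 / q + k * \<eta> * (real (card V))\<^sup>2"
proof -
  define n where "n = real (card V)"
  define e where "e x = (\<Sum>z\<in>V. E x z)" for x
  have E0: "0 \<le> E x y" "E x y \<le> 1" for x y using E01[of x y] by auto
  have e0: "0 \<le> e x" for x unfolding e_def by (intro sum_nonneg E0)
  \<comment> \<open>dividing by \<open>W\<close> compensates the density that replaces \<open>G\<close> below\<close>
  define w where "w x y = g y * (q / W x y)" for x y
  have Wp: "0 < W x y" for x y using W[of x y] q by linarith
  have w01: "0 \<le> w x y \<and> w x y \<le> 1" if "y \<in> V" for x y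
  proof -
    have "0 \<le> q / W x y" "q / W x y \<le> 1" using W[of x y] Wp[of x y] q by auto
    then show ?thesis unfolding w_def using g[OF that]
      by (intro conjI mult_nonneg_nonneg mult_le_one) auto
  qed
  define H where "H x y = 2 * F x y - G x y" for x y
  have H1: "\<bar>H x y\<bar> \<le> 1" for x y using F01[of x y] G01[of x y] FG[of x y] by (auto simp: H_def)
  define s where "s x x' y = E x x' * (w x y * H x y) * G x' y" for x x' y
  \<comment> \<open>Only a y joined to both x and x' contributes, and there at most one of the two
    values of \<open>H\<close> is 1.\<close>
  have s0: "s x x' y + s x' x y \<le> 0" if "y \<in> V" for x x' y
  proof (cases "E x x' = 1")
    case True
    then have Ws: "w x' y = w x y" using twins by (simp add: w_def)
    have "H x y * G x' y + H x' y * G x y \<le> 0"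
      using F01[of x y] G01[of x y] FG[of x y] F01[of x' y] G01[of x' y] FG[of x' y] EF[OF True]
      by (auto simp: H_def)
    then have "w x y * (H x y * G x' y + H x' y * G x y) \<le> 0"
      using w01[OF that] by (intro mult_nonneg_nonpos) auto
    then show ?thesis using True Esym[of x x'] by (simp add: s_def Ws algebra_simps)
  next
    case False
    then show ?thesis using E01[of x x'] Esym[of x x'] by (simp add: s_def)
  qed
  have "(\<Sum>x\<in>V. \<Sum>x'\<in>V. \<Sum>y\<in>V. s x x' y) + (\<Sum>x\<in>V. \<Sum>x'\<in>V. \<Sum>y\<in>V. s x' x y) \<le> 0"
    unfolding sum.distrib[symmetric] by (intro sum_nonpos s0)
  moreover have "(\<Sum>x\<in>V. \<Sum>x'\<in>V. \<Sum>y\<in>V. s x' x y) = (\<Sum>x\<in>V. \<Sum>x'\<in>V. \<Sum>y\<in>V. s x x' y)"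
    by (rule sum.swap)
  ultimately have S0: "(\<Sum>x\<in>V. \<Sum>x'\<in>V. \<Sum>y\<in>V. s x x' y) \<le> 0" by simp
  \<comment> \<open>As x is fixed, \<open>w x y * H x y\<close> depends on y alone and is a
    legitimate test function; the \<open>E\<close>-neighbours of x form the other one.\<close>
  have row: "q * (\<Sum>y\<in>V. e x * g y * H x y) \<le> (\<Sum>x'\<in>V. \<Sum>y\<in>V. s x x' y) + \<eta> * n\<^sup>2" if x: "x \<in> V" for x
  proof -
    have "\<bar>\<Sum>x'\<in>V. \<Sum>y\<in>V. E x x' * (w x y * H x y) * (G x' y - W x' y)\<bar> \<le> \<eta> * n\<^sup>2"
      unfolding n_def
      by (rule discD[OF disc]) (use E0 w01 H1 in \<open>auto simp: abs_mult mult_le_one\<close>)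
    moreover have "(\<Sum>x'\<in>V. \<Sum>y\<in>V. E x x' * (w x y * H x y) * (G x' y - W x' y))
        = (\<Sum>x'\<in>V. \<Sum>y\<in>V. s x x' y) - (\<Sum>x'\<in>V. \<Sum>y\<in>V. E x x' * (w x y * H x y) * W x' y)"
      by (simp add: s_def sum_subtractf right_diff_distrib)
    moreover have "(\<Sum>x'\<in>V. \<Sum>y\<in>V. E x x' * (w x y * H x y) * W x' y) = (\<Sum>x'\<in>V. \<Sum>y\<in>V. E x x' * (q * g y * H x y))"
    proof (intro sum.cong refl)
      fix x' y
      show "E x x' * (w x y * H x y) * W x' y = E x x' * (q * g y * H x y)"
      proof (cases "E x x' = 1")
        case True
        then show ?thesis using twins[of x x' y] Wp[of x y] by (simp add: w_def)
      next
        case False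
        then show ?thesis using E01[of x x'] by auto
      qed
    qed
    moreover have "(\<Sum>x'\<in>V. \<Sum>y\<in>V. E x x' * (q * g y * H x y)) = q * (\<Sum>y\<in>V. e x * g y * H x y)"
      unfolding e_def by (simp add: sum_distrib_left sum_distrib_right mult_ac) (rule sum.swap)
    ultimately show ?thesis by linarith
  qed
  have "(\<Sum>x\<in>V. q * (\<Sum>y\<in>V. e x * g y * H x y)) \<le> (\<Sum>x\<in>V. (\<Sum>x'\<in>V. \<Sum>y\<in>V. s x x' y) + \<eta> * n\<^sup>2)"
    by (intro sum_mono row)
  also have "\<dots> \<le> \<eta> * n^3" using S0
    by (simp add: sum.distrib n_def power3_eq_cube power2_eq_square)
  finally have "q * (\<Sum>x\<in>V. \<Sum>y\<in>V. e x * g y * H x y) \<le> \<eta> * n^3" by (simp add: sum_distrib_left)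
  then have h1: "(\<Sum>x\<in>V. \<Sum>y\<in>V. e x * g y * H x y) \<le> \<eta> * n^3 / q" using q by (simp add: field_simps)
  \<comment> \<open>Dividing by k makes \<open>e\<close> a test function; this turns the
    \<open>G\<close> contained in \<open>H\<close> into \<open>W\<close>.\<close>
  have "\<bar>\<Sum>x\<in>V. \<Sum>y\<in>V. (e x / k) * g y * (G x y - W x y)\<bar> \<le> \<eta> * n\<^sup>2"
    unfolding n_def
    by (rule discD[OF disc]) (use e0 deg k g in \<open>auto simp: e_def[symmetric]\<close>)
  moreover have "(\<Sum>x\<in>V. \<Sum>y\<in>V. (e x / k) * g y * (G x y - W x y))
      = (\<Sum>x\<in>V. \<Sum>y\<in>V. e x * g y * (G x y - W x y)) / k"
    by (simp add: sum_divide_distrib)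
  ultimately have "(\<Sum>x\<in>V. \<Sum>y\<in>V. e x * g y * (G x y - W x y)) / k \<le> \<eta> * n\<^sup>2" by linarith
  then have "(\<Sum>x\<in>V. \<Sum>y\<in>V. e x * g y * (G x y - W x y)) \<le> k * \<eta> * n\<^sup>2"
    using k by (simp add: field_simps)
  moreover have "(\<Sum>x\<in>V. \<Sum>y\<in>V. e x * g y * H x y) + (\<Sum>x\<in>V. \<Sum>y\<in>V. e x * g y * (G x y - W x y))
     = 2 * (\<Sum>x\<in>V. \<Sum>y\<in>V. e x * g y * F x y) - (\<Sum>x\<in>V. \<Sum>y\<in>V. e x * g y * W x y)"
    unfolding sum_distrib_left sum.distrib[symmetric] sum_subtractf[symmetric]
    by (intro sum.cong refl) (simp add: H_def algebra_simps)
  ultimately show ?thesis using h1 unfolding e_def n_def by linarith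
qed

text \<open>\<open>f\<close> is the matched fraction of a vertex and \<open>u\<close> the remainder.
  Pairs with a matched end are settled by \<open>twin_matching_bound\<close>. Among unmatched
  weights almost no \<open>L\<close>-edges of \<open>F\<close> survive, so
  \<open>cross_edges_bound\<close> suffices; \<open>psd\<close> absorbs its error, because
  \<open>W\<close> still counts the \<open>L\<close>-pairs.\<close>

lemma triangle_free_bound:
  fixes A B F G L W :: "'v \<Rightarrow> 'v \<Rightarrow> real" and k :: nat
  assumes fin: "finite V" and ne: "V \<noteq> {}"
    and F01: "\<And>x y. F x y = 0 \<or> F x y = 1" and Fsym: "\<And>x y. F x y = F y x"
    and trifree: "\<And>x y z. \<lbrakk>F x y = 1; F x z = 1; F y z = 1\<rbrakk> \<Longrightarrow> False"
    and G01: "\<And>x y. G x y = 0 \<or> G x y = 1" and FG: "\<And>x y. F x y \<le> G x y" and irr: "\<And>x. G x x = 0"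
    and A01: "\<And>x y. A x y = 0 \<or> A x y = 1"
    and B01: "\<And>x y. B x y = 0 \<or> B x y = 1" and Bsym: "\<And>x y. B x y = B y x"
    and L01: "\<And>x y. L x y = 0 \<or> L x y = 1" and Lsym: "\<And>x y. L x y = L y x"
    and cover: "\<And>x y. L x y = 0 \<Longrightarrow> G x y \<le> A x y + B x y"
    and twins: "\<And>x y z. L x y = 1 \<Longrightarrow> W x z = W y z"
    and Wq: "\<And>x y. q \<le> W x y" and Wsym: "\<And>x y. W x y = W y x"
    and discG: "disc V \<eta> (\<lambda>x y. G x y - W x y)"
    and discB: "disc V \<eta> (\<lambda>x y. B x y - q)"
    and discA: "\<And>\<phi> \<psi> w. (\<And>x. x \<in> V \<Longrightarrow> \<bar>\<phi> x\<bar> \<le> w x \<and> \<bar>\<psi> x\<bar> \<le> w x \<and> w x \<le> 1) \<Longrightarrow>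
        (\<Sum>x\<in>V. \<Sum>y\<in>V. \<phi> x * \<psi> y * (A x y - q))
         \<le> \<eta> * (real (card V))\<^sup>2 + \<epsilon> * (\<Sum>x\<in>V. \<Sum>y\<in>V. w x * w y * L x y)"
    and psd: "\<And>u. (\<And>x. x \<in> V \<Longrightarrow> 0 \<le> u x \<and> u x \<le> 1) \<Longrightarrow>
        (1 + \<delta>) * q * (\<Sum>x\<in>V. u x)\<^sup>2 + 5 * \<epsilon> / \<delta> * (\<Sum>x\<in>V. \<Sum>y\<in>V. u x * u y * L x y)
         \<le> (\<Sum>x\<in>V. \<Sum>y\<in>V. u x * u y * W x y) / 2 + \<eta> * (real (card V))\<^sup>2"
    and q: "0 < q" "q \<le> 1" and eta: "0 \<le> \<eta>" and eps: "0 \<le> \<epsilon>" "\<epsilon> \<le> 1"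
    and delta: "0 < \<delta>" "\<delta> \<le> 1" and theta: "0 < \<theta>" "\<theta> \<le> 1" and k: "0 < k"
  shows "(\<Sum>x\<in>V. \<Sum>y\<in>V. F x y) \<le> (\<Sum>x\<in>V. \<Sum>y\<in>V. W x y) / 2
     + (\<eta> * real (card V) / (q * k) + 2 * \<eta> + real k / real (card V)
         + 15 * \<eta> / (\<delta> * q\<^sup>2 * \<theta>) + 2 * \<theta>) * (real (card V))\<^sup>2"
proof -
  define n where "n = real (card V)"
  have n: "n \<ge> 1" using fin ne card_gt_0_iff[of V] by (simp add: n_def Suc_le_eq)
  have Firr: "F x x = 0" for x using FG[of x x] F01[of x x] irr[of x] by auto
  have F0: "0 \<le> F x y" for x y using F01[of x y] by auto
  obtain E :: "'v \<Rightarrow> 'v \<Rightarrow> real" where E: "\<And>x y. E x y = 0 \<or> E x y = 1" "\<And>x y. E x y = E y x" "\<And>x y. E x y = 1 \<Longrightarrow> F x y * L x y = 1"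
    "\<And>x. (\<Sum>y\<in>V. E x y) \<le> real k"
    "\<And>x y. \<lbrakk>x \<in> V; y \<in> V; F x y * L x y = 1; (\<Sum>z\<in>V. E x z) < real k; (\<Sum>z\<in>V. E y z) < real k\<rbrakk> \<Longrightarrow> E x y = 1"
    by (rule maximal_bounded_degree_subgraph[OF fin, of "\<lambda>x y. F x y * L x y" k])
      (use Fsym Lsym Firr in auto)
  have EFL: "F x y = 1 \<and> L x y = 1" if "E x y = 1" for x y
    using E(3)[OF that] F01[of x y] L01[of x y] by auto
  define f where "f x = (\<Sum>y\<in>V. E x y) / k" for x
  define u where "u x = 1 - f x" for x
  have E0: "0 \<le> E x y" for x y using E(1)[of x y] by auto
  have f01: "0 \<le> f x \<and> f x \<le> 1" for x
    using E(4)[of x] k by (auto simp: f_def E0 intro!: sum_nonneg divide_nonneg_pos)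
  have u01: "0 \<le> u x \<and> u x \<le> 1" for x using f01[of x] by (simp add: u_def)
  have matched: "(\<Sum>x\<in>V. \<Sum>y\<in>V. f x * g y * F x y) \<le> (\<Sum>x\<in>V. \<Sum>y\<in>V. f x * g y * W x y) / 2
      + (\<eta> * n / (2 * q * k) + \<eta> / 2) * n\<^sup>2" if g: "\<And>x. x \<in> V \<Longrightarrow> 0 \<le> g x \<and> g x \<le> 1" for g
  proof -
    have "2 * (\<Sum>x\<in>V. \<Sum>y\<in>V. (\<Sum>z\<in>V. E x z) * g y * F x y)
       \<le> (\<Sum>x\<in>V. \<Sum>y\<in>V. (\<Sum>z\<in>V. E x z) * g y * W x y) + \<eta> * n^3 / q + real k * \<eta> * n\<^sup>2"
      unfolding n_def
      by (rule twin_matching_bound[OF fin discG eta E(1,2) F01 G01 FG _ _ Wq q(1) E(4) _ g])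
        (use EFL twins trifree k in \<open>blast | simp\<close>)+
    then have "2 * (\<Sum>x\<in>V. \<Sum>y\<in>V. (\<Sum>z\<in>V. E x z) * g y * F x y) / k
       \<le> ((\<Sum>x\<in>V. \<Sum>y\<in>V. (\<Sum>z\<in>V. E x z) * g y * W x y) + \<eta> * n^3 / q + real k * \<eta> * n\<^sup>2) / k"
      by (rule divide_right_mono) simp
    moreover have "(\<Sum>x\<in>V. \<Sum>y\<in>V. f x * g y * X x y) = (\<Sum>x\<in>V. \<Sum>y\<in>V. (\<Sum>z\<in>V. E x z) * g y * X x y) / k" for X :: "'v \<Rightarrow> 'v \<Rightarrow> real"
      by (simp add: f_def sum_divide_distrib[symmetric])
    moreover have "(\<eta> * n^3 / q + real k * \<eta> * n\<^sup>2) / k = 2 * ((\<eta> * n / (2 * q * k) + \<eta> / 2) * n\<^sup>2)"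
      using q k by (simp add: field_simps power3_eq_cube power2_eq_square)
    ultimately show ?thesis by (simp add: add_divide_distrib)
  qed
  have m1: "(\<Sum>x\<in>V. \<Sum>y\<in>V. f x * F x y) \<le> (\<Sum>x\<in>V. \<Sum>y\<in>V. f x * W x y) / 2
      + (\<eta> * n / (2 * q * k) + \<eta> / 2) * n\<^sup>2" using matched[of "\<lambda>_. 1"] by simp
  \<comment> \<open>By symmetry of \<open>F\<close> and \<open>W\<close> this is
    \<open>matched\<close> with \<open>g = u\<close>.\<close>
  have m2: "(\<Sum>x\<in>V. \<Sum>y\<in>V. u x * f y * F x y) \<le> (\<Sum>x\<in>V. \<Sum>y\<in>V. u x * f y * W x y) / 2
      + (\<eta> * n / (2 * q * k) + \<eta> / 2) * n\<^sup>2"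
  proof -
    have "(\<Sum>x\<in>V. \<Sum>y\<in>V. u x * f y * X x y) = (\<Sum>x\<in>V. \<Sum>y\<in>V. f x * u y * X x y)"
      if "\<And>x y. X x y = X y x" for X :: "'v \<Rightarrow> 'v \<Rightarrow> real"
    proof (subst sum.swap, intro sum.cong refl)
      fix x y show "u y * f x * X y x = f x * u y * X x y" by (simp add: that[of y x])
    qed
    note eq = this[OF Fsym] this[OF Wsym]
    show ?thesis unfolding eq by (rule matched) (rule u01)
  qed
  have m3: "(\<Sum>x\<in>V. \<Sum>y\<in>V. u x * u y * F x y) \<le> (\<Sum>x\<in>V. \<Sum>y\<in>V. u x * u y * W x y) / 2
     + (\<eta> + real k / n + 15 * \<eta> / (\<delta> * q\<^sup>2 * \<theta>) + 2 * \<theta>) * n\<^sup>2"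
  proof -
    \<comment> \<open>An \<open>L\<close>-edge of \<open>F\<close> with \<open>u\<close> positive at
      both ends belongs to \<open>E\<close>, so all of them together cost at most k per
      vertex.\<close>
    have "u x * u y * F x y \<le> E x y + u x * u y * (F x y * A x y + F x y * B x y)" if xy: "x \<in> V" "y \<in> V" for x y
    proof (cases "L x y = 1")
      case True
      have "u x * u y * F x y \<le> E x y"
      proof (cases "F x y = 1 \<and> u x > 0 \<and> u y > 0")
        case True
        then have "(\<Sum>z\<in>V. E x z) < real k" "(\<Sum>z\<in>V. E y z) < real k"
          using k by (simp_all add: u_def f_def field_simps)
        then have "E x y = 1" using E(5)[OF xy] True \<open>L x y = 1\<close> by simp
        then show ?thesis using True u01[of x] u01[of y] by (simp add: mult_le_one)
      next
        case False
        then have "u x * u y * F x y = 0" using F01[of x y] u01[of x] u01[of y] by force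
        then show ?thesis using E0[of x y] by linarith
      qed
      moreover have "0 \<le> u x * u y * (F x y * A x y + F x y * B x y)"
      proof -
        have "0 \<le> A x y" "0 \<le> B x y" using A01[of x y] B01[of x y] by auto
        then show ?thesis
          by (intro mult_nonneg_nonneg add_nonneg_nonneg F0) (use u01 in auto)
      qed
      ultimately show ?thesis by linarith
    next
      case False
      then have "F x y * 1 \<le> F x y * (A x y + B x y)"
        using cover[of x y] L01[of x y] FG[of x y] F01[of x y] by auto
      then have "u x * u y * (F x y * 1) \<le> u x * u y * (F x y * (A x y + B x y))"
        by (rule mult_left_mono) (use u01 in simp)
      then show ?thesis using E0[of x y] by (simp add: distrib_left)
    qed
    then have "(\<Sum>x\<in>V. \<Sum>y\<in>V. u x * u y * F x y)
       \<le> (\<Sum>x\<in>V. \<Sum>y\<in>V. E x y + u x * u y * (F x y * A x y + F x y * B x y))"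
      by (intro sum_mono)
    also have "\<dots> = (\<Sum>x\<in>V. \<Sum>y\<in>V. E x y) + (\<Sum>x\<in>V. \<Sum>y\<in>V. u x * u y * (F x y * A x y + F x y * B x y))"
      by (simp add: sum.distrib)
    also have "(\<Sum>x\<in>V. \<Sum>y\<in>V. E x y) \<le> (\<Sum>x\<in>V. real k)" by (intro sum_mono E(4))
    also have "(\<Sum>x\<in>V. real k) = real k / n * n\<^sup>2" using n by (simp add: n_def power2_eq_square)
    also have "(\<Sum>x\<in>V. \<Sum>y\<in>V. u x * u y * (F x y * A x y + F x y * B x y))
       \<le> (1 + \<delta>) * q * (\<Sum>x\<in>V. u x)\<^sup>2 + 5 * \<epsilon> / \<delta> * (\<Sum>x\<in>V. \<Sum>y\<in>V. u x * u y * L x y)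
       + (15 * \<eta> / (\<delta> * q\<^sup>2 * \<theta>) + 2 * \<theta>) * n\<^sup>2"
      unfolding n_def
    proof (rule cross_edges_bound[OF fin ne, of u A B L])
      show "0 \<le> u x \<and> u x \<le> 1" for x by (rule u01)
      show "0 \<le> A x y \<and> A x y \<le> 1" "0 \<le> B x y \<and> B x y \<le> 1" "0 \<le> L x y \<and> L x y \<le> 1" for x y
        using A01[of x y] B01[of x y] L01[of x y] by auto
      show "0 \<le> F x y * A x y \<and> F x y * A x y \<le> A x y" "F x y * B x y = 0 \<or> F x y * B x y = 1" "F x y * B x y \<le> B x y" for x y
        using F01[of x y] A01[of x y] B01[of x y] by auto
      show "F x y * B x y = F y x * B y x" for x y using Fsym Bsym by simp
      show "F x z * A x z * B y z + A x z * (F y z * B y z) \<le> A x z * B y z" if "F x y * B x y = 1" for x y z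
      proof -
        have "F x y = 1" using that F01[of x y] by auto
        then have "\<not> (F x z = 1 \<and> F y z = 1)" using trifree by blast
        then show ?thesis using F01[of x z] F01[of y z] A01[of x z] B01[of y z] by auto
      qed
    qed (use Bsym discB discA q eta eps delta theta in auto)
    also have "(1 + \<delta>) * q * (\<Sum>x\<in>V. u x)\<^sup>2 + 5 * \<epsilon> / \<delta> * (\<Sum>x\<in>V. \<Sum>y\<in>V. u x * u y * L x y)
         \<le> (\<Sum>x\<in>V. \<Sum>y\<in>V. u x * u y * W x y) / 2 + \<eta> * n\<^sup>2"
      unfolding n_def by (rule psd) (rule u01)
    finally show ?thesis by (simp add: algebra_simps)
  qed
  \<comment> \<open>\<open>1 = f x + u x * f y + u x * u y\<close>.\<close>
  have split: "(\<Sum>x\<in>V. \<Sum>y\<in>V. X x y) = (\<Sum>x\<in>V. \<Sum>y\<in>V. f x * X x y) + (\<Sum>x\<in>V. \<Sum>y\<in>V. u x * f y * X x y)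
      + (\<Sum>x\<in>V. \<Sum>y\<in>V. u x * u y * X x y)" for X
    unfolding sum.distrib[symmetric] by (intro sum.cong refl) (simp add: u_def algebra_simps)
  have "(\<eta> * n / (q * k) + 2 * \<eta> + real k / n + 15 * \<eta> / (\<delta> * q\<^sup>2 * \<theta>) + 2 * \<theta>) * n\<^sup>2
    = 2 * ((\<eta> * n / (2 * q * k) + \<eta> / 2) * n\<^sup>2) + (\<eta> + real k / n + 15 * \<eta> / (\<delta> * q\<^sup>2 * \<theta>) + 2 * \<theta>) * n\<^sup>2"
    using q k by (simp add: algebra_simps add_divide_distrib)
  then show ?thesis using m1 m2 m3 split[of F] split[of W] unfolding n_def by linarith
qed

section \<open>Sparse triangle-free Cayley expanders on the cube\<close>

text \<open>Subsets of \<open>{..<k}\<close> stand for the vectors of F_2^k, \<open>sdiff\<close>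
  for addition and \<open>chi U\<close> for the characters of this group.\<close>

definition cube :: "nat \<Rightarrow> nat set set" where "cube k = Pow {..<k}"

definition sdiff :: "nat set \<Rightarrow> nat set \<Rightarrow> nat set" where "sdiff X Y = (X - Y) \<union> (Y - X)"

definition chi :: "nat set \<Rightarrow> nat set \<Rightarrow> real" where "chi U X = (- 1) ^ card (U \<inter> X)"

lemma finite_cube [simp]: "finite (cube k)" by (simp add: cube_def)

lemma card_cube [simp]: "card (cube k) = 2 ^ k" by (simp add: cube_def card_Pow)

lemma empty_in_cube [simp]: "{} \<in> cube k" by (simp add: cube_def)

lemma cubeD: "X \<in> cube k \<Longrightarrow> finite X" by (auto simp: cube_def intro: finite_subset)

lemma sdiff_in_cube [simp]: "X \<in> cube k \<Longrightarrow> Y \<in> cube k \<Longrightarrow> sdiff X Y \<in> cube k"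
  by (auto simp: cube_def sdiff_def)

lemma sdiff_commute: "sdiff X Y = sdiff Y X" by (auto simp: sdiff_def)

lemma sdiff_self [simp]: "sdiff X X = {}" by (auto simp: sdiff_def)

lemma sdiff_empty [simp]: "sdiff X {} = X" "sdiff {} X = X" by (auto simp: sdiff_def)

lemma sdiff_cancel [simp]: "sdiff X (sdiff X Y) = Y" "sdiff (sdiff X Y) Y = X" by (auto simp: sdiff_def)

lemma sdiff_eq_empty [simp]: "sdiff X Y = {} \<longleftrightarrow> X = Y" by (auto simp: sdiff_def)

lemma chi_commute: "chi U X = chi X U" by (simp add: chi_def Int_commute)

lemma chi_cases: "chi U X = 1 \<or> chi U X = - 1"
  by (simp add: chi_def) (meson minus_one_power_iff)

lemma chi_empty [simp]: "chi {} X = 1" "chi X {} = 1" by (auto simp: chi_def)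

lemma chi_sdiff: assumes "finite U" shows "chi U (sdiff X Y) = chi U X * chi U Y"
proof -
  have p: "chi U X = (\<Prod>i\<in>U. if i \<in> X then - 1 else 1)" for X
  proof -
    have "(\<Prod>i\<in>U. if i \<in> X then - 1 else (1::real)) = (\<Prod>i\<in>U \<inter> X. - 1)"
      using prod.inter_restrict[OF assms, of "\<lambda>_. - 1 :: real" X] by simp
    then show ?thesis by (simp add: chi_def)
  qed
  show ?thesis unfolding p prod.distrib[symmetric]
    by (intro prod.cong refl) (auto simp: sdiff_def)
qed

lemma sum_sdiff_shift:
  assumes "s \<in> cube k" shows "(\<Sum>X\<in>cube k. f (sdiff X s)) = (\<Sum>X\<in>cube k. f X)"
  by (rule sum.reindex_bij_witness[of _ "\<lambda>X. sdiff X s" "\<lambda>X. sdiff X s"]) (use assms in auto)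

text \<open>Translation by \<open>{i}\<close> with i in \<open>U\<close> flips the sign of every
  term.\<close>

lemma sum_chi:
  assumes "U \<in> cube k" shows "(\<Sum>X\<in>cube k. chi U X) = (if U = {} then 2 ^ k else 0)"
proof (cases "U = {}")
  case False
  then obtain i where i: "i \<in> U" by auto
  have ik: "{i} \<in> cube k" using i assms by (auto simp: cube_def)
  have "(\<Sum>X\<in>cube k. chi U X) = (\<Sum>X\<in>cube k. chi U (sdiff X {i}))"
    by (rule sum_sdiff_shift[OF ik, symmetric])
  also have "\<dots> = (\<Sum>X\<in>cube k. - chi U X)"
    using i by (intro sum.cong refl) (simp add: chi_sdiff[OF cubeD[OF assms]] chi_def[of U "{i}"])
  finally show ?thesis using False by (simp add: sum_negf)
qed simp

text \<open>After expanding and summing over U first, orthogonality of characters leaves only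
  \<open>Y = sdiff X s\<close>.\<close>

lemma fourier_convolution:
  assumes s: "s \<in> cube k"
  shows "(\<Sum>U\<in>cube k. (\<Sum>X\<in>cube k. f X * chi U X) * (\<Sum>X\<in>cube k. g X * chi U X) * chi U s)
     = 2 ^ k * (\<Sum>X\<in>cube k. f X * g (sdiff X s))"
proof -
  have "(\<Sum>U\<in>cube k. (\<Sum>X\<in>cube k. f X * chi U X) * (\<Sum>X\<in>cube k. g X * chi U X) * chi U s)
      = (\<Sum>U\<in>cube k. \<Sum>X\<in>cube k. \<Sum>Y\<in>cube k. f X * g Y * chi U (sdiff Y (sdiff X s)))"
    unfolding sum_product unfolding sum_distrib_right
    by (intro sum.cong refl) (simp add: chi_sdiff cubeD mult_ac)
  also have "\<dots> = (\<Sum>X\<in>cube k. \<Sum>U\<in>cube k. \<Sum>Y\<in>cube k. f X * g Y * chi U (sdiff Y (sdiff X s)))"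
    by (rule sum.swap)
  also have "\<dots> = (\<Sum>X\<in>cube k. \<Sum>Y\<in>cube k. \<Sum>U\<in>cube k. f X * g Y * chi U (sdiff Y (sdiff X s)))"
    by (intro sum.cong refl sum.swap)
  also have "\<dots> = (\<Sum>X\<in>cube k. \<Sum>Y\<in>cube k. if Y = sdiff X s then f X * g Y * 2 ^ k else 0)"
  proof (intro sum.cong refl)
    fix X Y assume "X \<in> cube k" "Y \<in> cube k"
    then have "(\<Sum>U\<in>cube k. chi (sdiff Y (sdiff X s)) U) = (if Y = sdiff X s then 2 ^ k else 0)"
      using sum_chi[of "sdiff Y (sdiff X s)" k] s by simp
    then show "(\<Sum>U\<in>cube k. f X * g Y * chi U (sdiff Y (sdiff X s))) = (if Y = sdiff X s then f X * g Y * 2 ^ k else 0)"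
      by (simp add: sum_distrib_left[symmetric] chi_commute[of _ "sdiff Y (sdiff X s)"])
  qed
  also have "\<dots> = (\<Sum>X\<in>cube k. f X * g (sdiff X s) * 2 ^ k)"
    using s by (intro sum.cong refl) (simp add: sum.delta)
  finally show ?thesis by (simp add: sum_distrib_left mult_ac)
qed

lemma parseval:
  "(\<Sum>U\<in>cube k. (\<Sum>X\<in>cube k. f X * chi U X)\<^sup>2) = 2 ^ k * (\<Sum>X\<in>cube k. (f X)\<^sup>2)"
  using fourier_convolution[of "{}" k f f] by (simp add: power2_eq_square)

text \<open>Lindsey's lemma for the Sylvester-Hadamard matrix: Cauchy-Schwarz in U, then
  Parseval.\<close>

lemma lindsey:
  assumes "\<And>X. X \<in> cube k \<Longrightarrow> \<bar>\<phi> X\<bar> \<le> 1" "\<And>X. X \<in> cube k \<Longrightarrow> \<bar>\<psi> X\<bar> \<le> 1"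
  shows "(\<Sum>U\<in>cube k. \<Sum>X\<in>cube k. \<phi> U * \<psi> X * chi U X)\<^sup>2 \<le> (2 ^ k) ^ 3"
proof -
  have sq: "(\<Sum>X\<in>cube k. (h X)\<^sup>2) \<le> 2 ^ k" if "\<And>X. X \<in> cube k \<Longrightarrow> \<bar>h X\<bar> \<le> 1" for h :: "nat set \<Rightarrow> real"
  proof -
    have "(\<Sum>X\<in>cube k. (h X)\<^sup>2) \<le> (\<Sum>X\<in>cube k. 1)"
      by (intro sum_mono) (use that in \<open>simp add: abs_square_le_1\<close>)
    then show ?thesis by simp
  qed
  have "(\<Sum>U\<in>cube k. \<Sum>X\<in>cube k. \<phi> U * \<psi> X * chi U X)\<^sup>2 = (\<Sum>U\<in>cube k. \<phi> U * (\<Sum>X\<in>cube k. \<psi> X * chi U X))\<^sup>2"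
    by (simp add: sum_distrib_left mult_ac)
  also have "\<dots> \<le> (\<Sum>U\<in>cube k. (\<phi> U)\<^sup>2) * (\<Sum>U\<in>cube k. (\<Sum>X\<in>cube k. \<psi> X * chi U X)\<^sup>2)"
    by (rule Cauchy_Schwarz_ineq_sum)
  also have "\<dots> \<le> 2 ^ k * (2 ^ k * 2 ^ k)"
    unfolding parseval using assms by (intro mult_mono sq mult_left_mono) (auto intro!: mult_nonneg_nonneg sum_nonneg)
  finally show ?thesis by (simp add: power3_eq_cube mult_ac)
qed

section \<open>Sum-free sets of small bias and expander mixing\<close>

lemma cosh_bound:
  fixes t :: real assumes "0 \<le> t" "t \<le> 1" shows "(exp t + exp (- t)) / 2 \<le> 1 + t\<^sup>2"
proof -
  have "exp (- t) \<le> 1 / (1 + t)"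
    using exp_ge_add_one_self[of t] assms by (simp add: exp_minus field_simps)
  also have "\<dots> \<le> 1 - t + t\<^sup>2"
    using assms by (simp add: field_simps power2_eq_square)
  finally show ?thesis using exp_bound[of t] assms by simp
qed

text \<open>Method of conditional expectations with exponential moments of the nontrivial character
  sums as potential. A uniformly random new element multiplies the potential by cosh t on average;
  excluding the elements that would spoil sum-freeness costs a further factor
  \<open>1 + 1 / D\<close>. Some admissible element does no worse than the average.\<close>

lemma greedy_small_bias_set:
  fixes t :: real and D :: nat
  assumes t: "0 \<le> t" "t \<le> 1" and D: "2 \<le> D" and N: "real (2 ^ k) \<ge> 2 * (real D)^2 * real D" and d: "d \<le> D"
  shows "\<exists>S. S \<subseteq> cube k \<and> card S = d \<and> {} \<notin> S \<and> (\<forall>x\<in>S. \<forall>y\<in>S. sdiff x y \<notin> S) \<and>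
     (\<Sum>U\<in>cube k - {{}}. exp (t * (\<Sum>s\<in>S. chi U s)) + exp (- t * (\<Sum>s\<in>S. chi U s)))
       \<le> 2 * 2 ^ k * ((1 + t\<^sup>2) * (1 + 1 / D)) ^ d"
  using d
proof (induction d)
  case 0
  show ?case
  proof (intro exI[of _ "{}"] conjI)
    have "(\<Sum>U\<in>cube k - {{}}. exp (t * (\<Sum>s\<in>{}. chi U s)) + exp (- t * (\<Sum>s\<in>{}. chi U s))) = 2 * (real (card (cube k - {{}})))"
      by simp
    also have "\<dots> \<le> 2 * 2 ^ k" by (simp add: card_Diff_singleton_if)
    finally show "(\<Sum>U\<in>cube k - {{}}. exp (t * (\<Sum>s\<in>{}. chi U s)) + exp (- t * (\<Sum>s\<in>{}. chi U s)))
       \<le> 2 * 2 ^ k * ((1 + t\<^sup>2) * (1 + 1 / D)) ^ 0" by simp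
  qed auto
next
  case (Suc d)
  then obtain S where S: "S \<subseteq> cube k" "card S = d" "{} \<notin> S" "\<And>x y. x \<in> S \<Longrightarrow> y \<in> S \<Longrightarrow> sdiff x y \<notin> S"
    and pot: "(\<Sum>U\<in>cube k - {{}}. exp (t * (\<Sum>s\<in>S. chi U s)) + exp (- t * (\<Sum>s\<in>S. chi U s)))
       \<le> 2 * 2 ^ k * ((1 + t\<^sup>2) * (1 + 1 / D)) ^ d" by auto
  have fS: "finite S" using S(1) finite_subset finite_cube by blast
  define \<Phi> where "\<Phi> S = (\<Sum>U\<in>cube k - {{}}. exp (t * (\<Sum>s\<in>S. chi U s)) + exp (- t * (\<Sum>s\<in>S. chi U s)))" for S
  \<comment> \<open>Forbidden choices: zero, old elements, sums of two old elements. Anything else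
    keeps the set sum-free.\<close>
  define Fb where "Fb = insert {} (S \<union> (\<lambda>(x,y). sdiff x y) ` (S \<times> S))"
  have FbV: "Fb \<subseteq> cube k" using S(1) by (auto simp: Fb_def intro!: sdiff_in_cube)
  have cFb: "card Fb \<le> D\<^sup>2"
  proof -
    have "card Fb \<le> Suc (card (S \<union> (\<lambda>(x,y). sdiff x y) ` (S \<times> S)))"
      unfolding Fb_def by (simp add: card_insert_if fS)
    also have "\<dots> \<le> Suc (card S + card ((\<lambda>(x,y). sdiff x y) ` (S \<times> S)))" using card_Un_le by simp
    also have "\<dots> \<le> Suc (d + d * d)"
      using card_image_le[of "S \<times> S" "\<lambda>(x,y). sdiff x y"] fS S(2) by (simp add: card_cartesian_product)
    also have "\<dots> \<le> D\<^sup>2"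
    proof -
      have "Suc d * Suc d \<le> D * D" using Suc.prems by (intro mult_le_mono) auto
      then show ?thesis by (simp add: power2_eq_square)
    qed
    finally show ?thesis .
  qed
  define N' where "N' = real (card (cube k - Fb))"
  have N'eq: "N' = 2 ^ k - real (card Fb)"
    unfolding N'_def using FbV card_mono[OF finite_cube FbV] by (simp add: card_Diff_subset finite_subset of_nat_diff)
  \<comment> \<open>The average runs over \<open>cube k - Fb\<close>, orthogonality of characters
    over the whole cube; this compares the two sizes.\<close>
  have N'ge: "2 ^ k \<le> N' * (1 + 1 / D)"
  proof -
    have c: "real (card Fb) \<le> (real D)\<^sup>2" using cFb by (metis of_nat_le_iff of_nat_power)
    have "(real D)\<^sup>2 * (1 + 1 / D) = (real D)\<^sup>2 + D" using D by (simp add: field_simps power2_eq_square)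
    also have "\<dots> \<le> 2 * (real D)\<^sup>2" using D by (simp add: power2_eq_square)
    also have "\<dots> \<le> 2 ^ k / D" using N D by (simp add: field_simps)
    finally have "real (card Fb) * (1 + 1 / D) \<le> 2 ^ k / D"
      using mult_right_mono[OF c, of "1 + 1 / D"] by simp
    then show ?thesis unfolding N'eq by (simp add: algebra_simps)
  qed
  have "N' > 0"
  proof (rule ccontr)
    assume "\<not> N' > 0"
    then have "N' * (1 + 1 / D) \<le> 0" by (intro mult_nonpos_nonneg) auto
    then show False using N'ge zero_less_power[of "2::real" k] by linarith
  qed
  have "(\<Sum>s\<in>cube k - Fb. \<Phi> (insert s S)) = (\<Sum>s\<in>cube k - Fb. (\<Sum>U\<in>cube k - {{}}. exp (t * (\<Sum>s\<in>S. chi U s)) * exp (t * chi U s)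
       + exp (- t * (\<Sum>s\<in>S. chi U s)) * exp (- t * chi U s)))"
    unfolding \<Phi>_def
    by (intro sum.cong refl) (auto simp: Fb_def fS exp_add distrib_left algebra_simps exp_diff exp_minus divide_inverse)
  also have "\<dots> \<le> (\<Sum>s\<in>cube k. (\<Sum>U\<in>cube k - {{}}. exp (t * (\<Sum>s\<in>S. chi U s)) * exp (t * chi U s)
       + exp (- t * (\<Sum>s\<in>S. chi U s)) * exp (- t * chi U s)))"
    by (rule sum_mono2) (auto intro!: sum_nonneg)
  also have "\<dots> = (\<Sum>U\<in>cube k - {{}}. exp (t * (\<Sum>s\<in>S. chi U s)) * (\<Sum>s\<in>cube k. exp (t * chi U s))
       + exp (- t * (\<Sum>s\<in>S. chi U s)) * (\<Sum>s\<in>cube k. exp (- t * chi U s)))"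
    by (subst sum.swap) (simp add: sum.distrib sum_distrib_left)
  also have "\<dots> = (\<Sum>U\<in>cube k - {{}}. (exp (t * (\<Sum>s\<in>S. chi U s)) + exp (- t * (\<Sum>s\<in>S. chi U s))) * (2 ^ k * ((exp t + exp (- t)) / 2)))"
  proof (intro sum.cong refl)
    fix U assume U: "U \<in> cube k - {{}}"
    \<comment> \<open>As \<open>chi U s\<close> is 1 or -1, the exponential is affine in it, and the
      linear part sums to zero for nonempty U.\<close>
    have e: "exp (r * chi U s) = (exp r + exp (- r)) / 2 + (exp r - exp (- r)) / 2 * chi U s" for r s
      using chi_cases[of U s] by (auto simp: field_simps)
    have "(\<Sum>s\<in>cube k. exp (r * chi U s)) = 2 ^ k * ((exp r + exp (- r)) / 2)" for r
      unfolding e sum.distrib sum_distrib_left[symmetric] using sum_chi[of U k] U by simp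
    from this[of t] this[of "- t"]
    have p: "(\<Sum>s\<in>cube k. exp (t * chi U s)) = 2 ^ k * ((exp t + exp (- t)) / 2)"
      "(\<Sum>s\<in>cube k. exp (- t * chi U s)) = 2 ^ k * ((exp t + exp (- t)) / 2)" by (simp_all add: add.commute)
    show "exp (t * (\<Sum>s\<in>S. chi U s)) * (\<Sum>s\<in>cube k. exp (t * chi U s))
       + exp (- t * (\<Sum>s\<in>S. chi U s)) * (\<Sum>s\<in>cube k. exp (- t * chi U s))
       = (exp (t * (\<Sum>s\<in>S. chi U s)) + exp (- t * (\<Sum>s\<in>S. chi U s))) * (2 ^ k * ((exp t + exp (- t)) / 2))"
      unfolding p by (simp only: distrib_right)
  qed
  also have "\<dots> = \<Phi> S * (2 ^ k * ((exp t + exp (- t)) / 2))"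
    by (simp add: \<Phi>_def sum_distrib_right)
  also have "\<dots> \<le> \<Phi> S * ((N' * (1 + 1 / D)) * (1 + t\<^sup>2))"
    using N'ge cosh_bound[OF t] \<open>N' > 0\<close> by (intro mult_left_mono mult_mono) (auto simp: \<Phi>_def add_nonneg_nonneg intro!: sum_nonneg)
  finally have tot: "(\<Sum>s\<in>cube k - Fb. \<Phi> (insert s S)) \<le> N' * (\<Phi> S * ((1 + t\<^sup>2) * (1 + 1 / D)))"
    by (simp add: mult_ac)
  have "\<exists>s\<in>cube k - Fb. \<Phi> (insert s S) \<le> \<Phi> S * ((1 + t\<^sup>2) * (1 + 1 / D))"
  proof (rule ccontr)
    assume "\<not> ?thesis"
    then have "(\<Sum>s\<in>cube k - Fb. \<Phi> S * ((1 + t\<^sup>2) * (1 + 1 / D))) < (\<Sum>s\<in>cube k - Fb. \<Phi> (insert s S))"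
    proof (intro sum_strict_mono)
      show "cube k - Fb \<noteq> {}" using \<open>N' > 0\<close> by (metis N'_def card.empty less_irrefl of_nat_0)
    qed (auto simp: not_le)
    then show False using tot by (simp add: N'_def)
  qed
  then obtain s where s: "s \<in> cube k" "s \<notin> Fb" "\<Phi> (insert s S) \<le> \<Phi> S * ((1 + t\<^sup>2) * (1 + 1 / D))" by auto
  show ?case
  proof (intro exI[of _ "insert s S"] conjI)
    show "insert s S \<subseteq> cube k" using s S by auto
    have sS: "s \<notin> S" "s \<noteq> {}" using s(2) by (auto simp: Fb_def)
    show "card (insert s S) = Suc d" using sS S(2) fS by simp
    show "{} \<notin> insert s S" using sS S(3) by auto
    have n1: "s \<noteq> sdiff x y" if "x \<in> S" "y \<in> S" for x y using s(2) that by (auto simp: Fb_def)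
    show "\<forall>x\<in>insert s S. \<forall>y\<in>insert s S. sdiff x y \<notin> insert s S"
    proof (intro ballI notI)
      fix x y assume xy: "x \<in> insert s S" "y \<in> insert s S" "sdiff x y \<in> insert s S"
      have a: "\<not> (sdiff s y \<in> insert s S)" if "y \<in> S" for y
      proof
        assume "sdiff s y \<in> insert s S"
        then consider "sdiff s y = s" | "sdiff s y \<in> S" by auto
        then show False
        proof cases
          case 1
          then have "sdiff s (sdiff s y) = {}" by simp
          then have "y = {}" by (metis sdiff_cancel(1))
          then show False using that S(3) by auto
        next
          case 2
          have "s = sdiff (sdiff s y) y" by simp
          then show False using n1[OF 2 that] by simp
        qed
      qed
      show False
      proof (cases "x = s"; cases "y = s")
        assume "x = s" "y = s" then show False using xy sS S(3) by auto
      next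
        assume "x = s" "y \<noteq> s" then show False using xy a by auto
      next
        assume "x \<noteq> s" "y = s" then show False using xy a[of x] sdiff_commute[of x s] by auto
      next
        assume "x \<noteq> s" "y \<noteq> s" then show False using xy n1[of x y] S(4)[of x y] by auto
      qed
    qed
    have "\<Phi> (insert s S) \<le> 2 * 2 ^ k * ((1 + t\<^sup>2) * (1 + 1 / D)) ^ d * ((1 + t\<^sup>2) * (1 + 1 / D))"
      using s(3) mult_right_mono[OF pot[folded \<Phi>_def], of "(1 + t\<^sup>2) * (1 + 1 / D)"] by (simp add: add_nonneg_nonneg)
    then show "(\<Sum>U\<in>cube k - {{}}. exp (t * (\<Sum>s\<in>insert s S. chi U s)) + exp (- t * (\<Sum>s\<in>insert s S. chi U s)))
       \<le> 2 * 2 ^ k * ((1 + t\<^sup>2) * (1 + 1 / D)) ^ Suc d" by (simp add: \<Phi>_def mult_ac)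
  qed
qed

text \<open>A single term of the potential bounds each character sum c: with D = 2^l elements in a
  cube of size D^4 one gets \<open>t * \<bar>c\<bar> \<le> 4 * l + 2 + t\<^sup>2 * D\<close>. For
  \<open>t = \<epsilon> / 2\<close>, \<open>big\<close> bounds the right side by
  \<open>2 * t\<^sup>2 * D = t * \<epsilon> * D\<close>.\<close>

lemma small_bias_set:
  fixes \<epsilon> :: real
  assumes eps: "0 < \<epsilon>" "\<epsilon> \<le> 1" and l: "1 \<le> l" and big: "4 * real l + 3 \<le> \<epsilon>\<^sup>2 * 2 ^ l / 4"
  obtains S where "S \<subseteq> cube (4 * l)" "card S = 2 ^ l" "{} \<notin> S" "\<And>x y. x \<in> S \<Longrightarrow> y \<in> S \<Longrightarrow> sdiff x y \<notin> S"
    "\<And>U. U \<in> cube (4 * l) \<Longrightarrow> U \<noteq> {} \<Longrightarrow> \<bar>\<Sum>s\<in>S. chi U s\<bar> \<le> \<epsilon> * 2 ^ l"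
proof -
  define D :: nat where "D = 2 ^ l"
  define t where "t = \<epsilon> / 2"
  have D2: "2 \<le> D" using l self_le_power[of 2 l] by (simp add: D_def)
  have N: "real (2 ^ (4 * l)) \<ge> 2 * (real D)\<^sup>2 * real D"
  proof -
    have "real (2 ^ (4 * l)) = real D * ((real D)\<^sup>2 * real D)"
      by (simp add: D_def power_mult[symmetric] power_add[symmetric] power2_eq_square mult_ac)
    moreover have "2 * ((real D)\<^sup>2 * real D) \<le> real D * ((real D)\<^sup>2 * real D)"
      using D2 by (intro mult_right_mono) auto
    ultimately show ?thesis by simp
  qed
  obtain S where S: "S \<subseteq> cube (4 * l)" "card S = D" "{} \<notin> S" "\<And>x y. x \<in> S \<Longrightarrow> y \<in> S \<Longrightarrow> sdiff x y \<notin> S"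
    and pot: "(\<Sum>U\<in>cube (4 * l) - {{}}. exp (t * (\<Sum>s\<in>S. chi U s)) + exp (- t * (\<Sum>s\<in>S. chi U s)))
       \<le> 2 * 2 ^ (4 * l) * ((1 + t\<^sup>2) * (1 + 1 / D)) ^ D"
    using greedy_small_bias_set[of t D "4 * l" D] eps D2 N by (auto simp: t_def)
  show ?thesis
  proof
    show "\<bar>\<Sum>s\<in>S. chi U s\<bar> \<le> \<epsilon> * 2 ^ l" if U: "U \<in> cube (4 * l)" "U \<noteq> {}" for U
    proof -
      define c where "c = (\<Sum>s\<in>S. chi U s)"
      have "exp (t * \<bar>c\<bar>) \<le> exp (t * c) + exp (- t * c)"
        by (cases "c \<ge> 0") (auto simp: abs_if)
      also have "\<dots> \<le> (\<Sum>U\<in>cube (4 * l) - {{}}. exp (t * (\<Sum>s\<in>S. chi U s)) + exp (- t * (\<Sum>s\<in>S. chi U s)))"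
        unfolding c_def by (rule member_le_sum) (use U in \<open>auto intro: add_nonneg_nonneg\<close>)
      also note pot
      also have "2 * 2 ^ (4 * l) * ((1 + t\<^sup>2) * (1 + 1 / D)) ^ D \<le> exp (4 * real l + 1) * (exp (t\<^sup>2) * exp (1 / D)) ^ D"
      proof (intro mult_mono power_mono)
        have "(2::real) \<le> exp 1" using exp_ge_add_one_self[of 1] by simp
        then have "(2::real) ^ (4 * l + 1) \<le> exp 1 ^ (4 * l + 1)" by (rule power_mono) simp
        also have "\<dots> = exp (4 * real l + 1)" by (simp add: exp_of_nat_mult[symmetric] exp_add[symmetric])
        finally show "2 * 2 ^ (4 * l) \<le> exp (4 * real l + 1)" by simp
      qed (auto simp: exp_ge_add_one_self intro!: mult_mono)
      also have "(exp (t\<^sup>2) * exp (1 / D)) ^ D = exp (t\<^sup>2 * D + 1)"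
        using D2 by (simp add: exp_add[symmetric] exp_of_nat_mult[symmetric] field_simps)
      also have "exp (4 * real l + 1) * exp (t\<^sup>2 * D + 1) = exp (4 * real l + 2 + t\<^sup>2 * D)"
        by (simp add: exp_add[symmetric])
      finally have "t * \<bar>c\<bar> \<le> 4 * real l + 2 + t\<^sup>2 * D" by simp
      also have "\<dots> \<le> 2 * t\<^sup>2 * D" using big by (simp add: t_def D_def power2_eq_square)
      also have "\<dots> = t * (\<epsilon> * 2 ^ l)" by (simp add: t_def D_def power2_eq_square)
      finally show ?thesis using eps by (simp add: t_def c_def)
    qed
  qed (use S in \<open>auto simp: D_def\<close>)
qed

text \<open>Expander mixing: the eigenvalues of the Cayley graph are the character sums over
  \<open>S\<close>; the trivial one is the density term, the others are at most c. The
  arithmetic-geometric mean inequality produces sums of squares, the shape later compared with the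
  form of \<open>L\<close>.\<close>

lemma cayley_mixing:
  assumes S: "S \<subseteq> cube k" and c0: "0 \<le> c" and bias: "\<And>U. U \<in> cube k \<Longrightarrow> U \<noteq> {} \<Longrightarrow> \<bar>\<Sum>s\<in>S. chi U s\<bar> \<le> c"
  shows "\<bar>\<Sum>X\<in>cube k. \<Sum>Y\<in>cube k. f X * g Y * (of_bool (sdiff X Y \<in> S) - real (card S) / 2 ^ k)\<bar>
     \<le> c * ((\<Sum>X\<in>cube k. (f X)\<^sup>2) + (\<Sum>X\<in>cube k. (g X)\<^sup>2)) / 2"
proof -
  define h where "h f U = (\<Sum>X\<in>cube k. f X * chi U X)" for f U
  have fS: "finite S" using S finite_subset finite_cube by blast
  have "(\<Sum>X\<in>cube k. \<Sum>Y\<in>cube k. f X * g Y * of_bool (sdiff X Y \<in> S)) = (\<Sum>X\<in>cube k. \<Sum>s\<in>S. f X * g (sdiff X s))"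
  proof (rule sum.cong[OF refl])
    fix X assume X: "X \<in> cube k"
    have "(\<Sum>Y\<in>cube k. f X * g Y * of_bool (sdiff X Y \<in> S)) = (\<Sum>Y\<in>{Y\<in>cube k. sdiff X Y \<in> S}. f X * g Y)"
      by (simp add: of_bool_def if_distrib sum.If_cases Int_def cong: if_cong)
    also have "\<dots> = (\<Sum>s\<in>S. f X * g (sdiff X s))"
      by (rule sum.reindex_bij_witness[of _ "\<lambda>s. sdiff X s" "\<lambda>Y. sdiff X Y"]) (use X S in auto)
    finally show "(\<Sum>Y\<in>cube k. f X * g Y * of_bool (sdiff X Y \<in> S)) = (\<Sum>s\<in>S. f X * g (sdiff X s))" .
  qed
  also have "\<dots> = (\<Sum>s\<in>S. \<Sum>X\<in>cube k. f X * g (sdiff X s))" by (rule sum.swap)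
  also have "\<dots> = (\<Sum>s\<in>S. (\<Sum>U\<in>cube k. h f U * h g U * chi U s) / 2 ^ k)"
    using fourier_convolution[of _ k f g] S by (intro sum.cong refl) (auto simp: h_def)
  also have "\<dots> = (\<Sum>U\<in>cube k. h f U * h g U * (\<Sum>s\<in>S. chi U s)) / 2 ^ k"
    by (simp add: sum_divide_distrib[symmetric] sum_distrib_left) (subst sum.swap, simp)
  also have "(\<Sum>U\<in>cube k. h f U * h g U * (\<Sum>s\<in>S. chi U s))
     = h f {} * h g {} * real (card S) + (\<Sum>U\<in>cube k - {{}}. h f U * h g U * (\<Sum>s\<in>S. chi U s))"
    by (subst sum.remove[of _ "{}"]) auto
  finally have main: "(\<Sum>X\<in>cube k. \<Sum>Y\<in>cube k. f X * g Y * of_bool (sdiff X Y \<in> S))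
     = (h f {} * h g {} * real (card S) + (\<Sum>U\<in>cube k - {{}}. h f U * h g U * (\<Sum>s\<in>S. chi U s))) / 2 ^ k" .
  have e: "(\<Sum>X\<in>cube k. \<Sum>Y\<in>cube k. f X * g Y * (of_bool (sdiff X Y \<in> S) - real (card S) / 2 ^ k))
     = (\<Sum>U\<in>cube k - {{}}. h f U * h g U * (\<Sum>s\<in>S. chi U s)) / 2 ^ k"
  proof -
    have "(\<Sum>X\<in>cube k. \<Sum>Y\<in>cube k. f X * g Y * (real (card S) / 2 ^ k)) = h f {} * h g {} * (real (card S) / 2 ^ k)"
      unfolding h_def sum_product unfolding sum_distrib_right by simp
    then show ?thesis
      unfolding right_diff_distrib sum_subtractf main by (simp add: add_divide_distrib)
  qed
  have termwise: "\<bar>h f U * h g U * (\<Sum>s\<in>S. chi U s)\<bar> \<le> c * (((h f U)\<^sup>2 + (h g U)\<^sup>2) / 2)"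
    if "U \<in> cube k - {{}}" for U
  proof -
    have b: "\<bar>\<Sum>s\<in>S. chi U s\<bar> \<le> c" using bias that by auto
    have "\<bar>h f U\<bar> * \<bar>h g U\<bar> \<le> ((h f U)\<^sup>2 + (h g U)\<^sup>2) / 2"
      using sum_squares_bound[of "\<bar>h f U\<bar>" "\<bar>h g U\<bar>"] by simp
    from mult_mono[OF b this c0] show ?thesis by (simp add: abs_mult mult_ac)
  qed
  have "\<bar>\<Sum>U\<in>cube k - {{}}. h f U * h g U * (\<Sum>s\<in>S. chi U s)\<bar>
     \<le> (\<Sum>U\<in>cube k - {{}}. \<bar>h f U * h g U * (\<Sum>s\<in>S. chi U s)\<bar>)" by (rule sum_abs)
  also have "\<dots> \<le> (\<Sum>U\<in>cube k - {{}}. c * (((h f U)\<^sup>2 + (h g U)\<^sup>2) / 2))"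
    by (intro sum_mono termwise)
  also have "\<dots> = c * (\<Sum>U\<in>cube k - {{}}. (h f U)\<^sup>2 + (h g U)\<^sup>2) / 2"
    by (simp add: sum_distrib_left sum_divide_distrib)
  finally have b1: "\<bar>\<Sum>U\<in>cube k - {{}}. h f U * h g U * (\<Sum>s\<in>S. chi U s)\<bar>
     \<le> c * (\<Sum>U\<in>cube k - {{}}. (h f U)\<^sup>2 + (h g U)\<^sup>2) / 2" .
  have "(\<Sum>U\<in>cube k - {{}}. (h f U)\<^sup>2 + (h g U)\<^sup>2) \<le> (\<Sum>U\<in>cube k. (h f U)\<^sup>2 + (h g U)\<^sup>2)"
    by (rule sum_mono2) auto
  also have "\<dots> = 2 ^ k * ((\<Sum>X\<in>cube k. (f X)\<^sup>2) + (\<Sum>X\<in>cube k. (g X)\<^sup>2))"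
    by (simp add: sum.distrib parseval h_def distrib_left)
  finally have "c * (\<Sum>U\<in>cube k - {{}}. (h f U)\<^sup>2 + (h g U)\<^sup>2) / 2
    \<le> c * (2 ^ k * ((\<Sum>X\<in>cube k. (f X)\<^sup>2) + (\<Sum>X\<in>cube k. (g X)\<^sup>2))) / 2"
    using c0 by (intro divide_right_mono mult_left_mono) auto
  with b1 show ?thesis unfolding e by (simp add: abs_divide field_simps)
qed

section \<open>Quasirandom relations\<close>

lemma disc_reindex:
  assumes h: "bij_betw h V V'" and d: "disc V' \<eta> K"
  shows "disc V \<eta> (\<lambda>x y. K (h x) (h y))"
  unfolding disc_def
proof (intro allI impI)
  fix \<phi> \<psi> :: "'a \<Rightarrow> real" assume a: "\<forall>x\<in>V. \<bar>\<phi> x\<bar> \<le> 1" "\<forall>x\<in>V. \<bar>\<psi> x\<bar> \<le> 1"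
  define g where "g = inv_into V h"
  have g: "g (h x) = x" if "x \<in> V" for x
    using that h by (simp add: g_def bij_betw_inv_into_left)
  have gV: "g y \<in> V" if "y \<in> V'" for y
    using that h by (metis bij_betw_inv_into bij_betwE g_def)
  have "(\<Sum>x\<in>V. \<Sum>y\<in>V. \<phi> x * \<psi> y * K (h x) (h y)) = (\<Sum>x\<in>V. \<Sum>y\<in>V. \<phi> (g (h x)) * \<psi> (g (h y)) * K (h x) (h y))"
    using g by (intro sum.cong refl) auto
  also have "\<dots> = (\<Sum>x\<in>V. \<Sum>y\<in>V'. \<phi> (g (h x)) * \<psi> (g y) * K (h x) y)"
    by (intro sum.cong refl) (rule sum.reindex_bij_betw[OF h])
  also have "\<dots> = (\<Sum>x\<in>V'. \<Sum>y\<in>V'. \<phi> (g x) * \<psi> (g y) * K x y)"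
    by (rule sum.reindex_bij_betw[OF h])
  finally show "\<bar>\<Sum>x\<in>V. \<Sum>y\<in>V. \<phi> x * \<psi> y * K (h x) (h y)\<bar> \<le> \<eta> * (real (card V))\<^sup>2"
    using discD[OF d, of "\<lambda>x. \<phi> (g x)" "\<lambda>x. \<psi> (g x)"] a gV bij_betw_same_card[OF h] by simp
qed

text \<open>With both first coordinates fixed, the inner sum is an instance of
  \<open>disc T\<close>, so a bounded factor in the first coordinates is free. In this way the
  pattern of clump adjacencies is imposed on a quasirandom kernel.\<close>

lemma disc_product:
  assumes fin: "finite \<Omega>" "finite T" and k: "\<And>a b. \<bar>\<kappa> a b\<bar> \<le> 1" and d: "disc T \<eta> K"
  shows "disc (\<Omega> \<times> T) \<eta> (\<lambda>x y. \<kappa> (fst x) (fst y) * K (snd x) (snd y))"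
  unfolding disc_def
proof (intro allI impI)
  fix \<phi> \<psi> :: "'a \<times> 'b \<Rightarrow> real" assume a: "\<forall>x\<in>\<Omega> \<times> T. \<bar>\<phi> x\<bar> \<le> 1" "\<forall>x\<in>\<Omega> \<times> T. \<bar>\<psi> x\<bar> \<le> 1"
  define s where "s a b = (\<Sum>t\<in>T. \<Sum>t'\<in>T. \<phi> (a, t) * \<psi> (b, t') * K t t')" for a b
  have sb: "\<bar>s a b\<bar> \<le> \<eta> * (real (card T))\<^sup>2" if "a \<in> \<Omega>" "b \<in> \<Omega>" for a b
    unfolding s_def by (rule discD[OF d]) (use a that in auto)
  have "(\<Sum>x\<in>\<Omega> \<times> T. \<Sum>y\<in>\<Omega> \<times> T. \<phi> x * \<psi> y * (\<kappa> (fst x) (fst y) * K (snd x) (snd y)))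
     = (\<Sum>a\<in>\<Omega>. \<Sum>t\<in>T. \<Sum>b\<in>\<Omega>. \<Sum>t'\<in>T. \<phi> (a, t) * \<psi> (b, t') * (\<kappa> a b * K t t'))"
    by (simp add: sum.cartesian_product' split_def)
  also have "\<dots> = (\<Sum>a\<in>\<Omega>. \<Sum>b\<in>\<Omega>. \<Sum>t\<in>T. \<Sum>t'\<in>T. \<phi> (a, t) * \<psi> (b, t') * (\<kappa> a b * K t t'))"
    by (rule sum.cong[OF refl]) (rule sum.swap)
  also have "\<dots> = (\<Sum>a\<in>\<Omega>. \<Sum>b\<in>\<Omega>. \<kappa> a b * s a b)"
    by (simp add: s_def sum_distrib_left mult_ac)
  finally have e: "(\<Sum>x\<in>\<Omega> \<times> T. \<Sum>y\<in>\<Omega> \<times> T. \<phi> x * \<psi> y * (\<kappa> (fst x) (fst y) * K (snd x) (snd y)))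
    = (\<Sum>a\<in>\<Omega>. \<Sum>b\<in>\<Omega>. \<kappa> a b * s a b)" .
  have "\<bar>\<Sum>a\<in>\<Omega>. \<Sum>b\<in>\<Omega>. \<kappa> a b * s a b\<bar> \<le> (\<Sum>a\<in>\<Omega>. \<Sum>b\<in>\<Omega>. \<bar>\<kappa> a b * s a b\<bar>)"
    by (rule order_trans[OF sum_abs]) (intro sum_mono sum_abs)
  also have "\<dots> \<le> (\<Sum>a\<in>\<Omega>. \<Sum>b\<in>\<Omega>. \<eta> * (real (card T))\<^sup>2)"
  proof (intro sum_mono)
    fix a b assume "a \<in> \<Omega>" "b \<in> \<Omega>"
    have "\<bar>\<kappa> a b\<bar> * \<bar>s a b\<bar> \<le> \<bar>s a b\<bar>" using k[of a b] by (simp add: mult_left_le_one_le)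
    then show "\<bar>\<kappa> a b * s a b\<bar> \<le> \<eta> * (real (card T))\<^sup>2"
      using sb[of a b] \<open>a \<in> \<Omega>\<close> \<open>b \<in> \<Omega>\<close> by (simp add: abs_mult)
  qed
  also have "\<dots> = \<eta> * (real (card (\<Omega> \<times> T)))\<^sup>2"
    by (simp add: card_cartesian_product power2_eq_square mult_ac)
  finally show "\<bar>\<Sum>x\<in>\<Omega> \<times> T. \<Sum>y\<in>\<Omega> \<times> T. \<phi> x * \<psi> y * (\<kappa> (fst x) (fst y) * K (snd x) (snd y))\<bar>
     \<le> \<eta> * (real (card (\<Omega> \<times> T)))\<^sup>2" unfolding e .
qed

lemma disc_product':
  assumes fin: "finite \<Omega>" "finite T" and k: "\<And>a b. \<bar>\<kappa> a b\<bar> \<le> 1" and d: "disc T \<eta> K"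
  shows "disc (T \<times> \<Omega>) \<eta> (\<lambda>x y. \<kappa> (snd x) (snd y) * K (fst x) (fst y))"
proof -
  have "bij_betw prod.swap (T \<times> \<Omega>) (\<Omega> \<times> T)" by (auto simp: bij_betw_def)
  from disc_reindex[OF this disc_product[OF assms]] show ?thesis by simp
qed

lemma disc_add:
  assumes "disc V \<eta>1 K1" "disc V \<eta>2 K2"
  shows "disc V (\<eta>1 + \<eta>2) (\<lambda>x y. K1 x y + K2 x y)"
  unfolding disc_def
proof (intro allI impI)
  fix \<phi> \<psi> :: "'a \<Rightarrow> real" assume a: "\<forall>x\<in>V. \<bar>\<phi> x\<bar> \<le> 1" "\<forall>x\<in>V. \<bar>\<psi> x\<bar> \<le> 1"
  show "\<bar>\<Sum>x\<in>V. \<Sum>y\<in>V. \<phi> x * \<psi> y * (K1 x y + K2 x y)\<bar> \<le> (\<eta>1 + \<eta>2) * (real (card V))\<^sup>2"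
    using discD[OF assms(1), of \<phi> \<psi>] discD[OF assms(2), of \<phi> \<psi>] a
    by (simp add: distrib_left distrib_right sum.distrib)
qed

lemma disc_cong:
  assumes "disc V \<eta> K" "\<And>x y. x \<in> V \<Longrightarrow> y \<in> V \<Longrightarrow> K x y = K' x y"
  shows "disc V \<eta> K'"
  using assms unfolding disc_def by (simp cong: sum.cong)

lemma disc_mono:
  assumes "disc V \<eta> K" "\<eta> \<le> \<eta>'"
  shows "disc V \<eta>' K"
  unfolding disc_def
proof (intro allI impI)
  fix \<phi> \<psi> :: "'a \<Rightarrow> real" assume a: "\<forall>x\<in>V. \<bar>\<phi> x\<bar> \<le> 1" "\<forall>x\<in>V. \<bar>\<psi> x\<bar> \<le> 1"
  have "\<eta> * (real (card V))\<^sup>2 \<le> \<eta>' * (real (card V))\<^sup>2" by (intro mult_right_mono assms) simp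
  then show "\<bar>\<Sum>x\<in>V. \<Sum>y\<in>V. \<phi> x * \<psi> y * K x y\<bar> \<le> \<eta>' * (real (card V))\<^sup>2"
    using discD[OF assms(1), of \<phi> \<psi>] a by simp
qed

section \<open>Explicit quasirandom relations\<close>

text \<open>Parity of intersections is the Hadamard matrix \<open>chi\<close>; on N = 2^k points
  Lindsey's bound N^(3/2) is at most \<open>\<eta> * N\<^sup>2\<close> as soon as
  \<open>\<eta>\<^sup>2 * N \<ge> 1\<close>.\<close>

lemma hadamard_quasirandom:
  assumes eta: "0 < \<eta>"
  shows "\<exists>(T :: nat set) R. finite T \<and> m0 \<le> card T \<and> (\<forall>x y. R x y = R y x) \<and>
     disc T \<eta> (\<lambda>x y. of_bool (R x y) - 1 / 2)"
proof -
  obtain k0 where k0: "1 / \<eta>\<^sup>2 < 2 ^ k0" using real_arch_pow[of 2 "1 / \<eta>\<^sup>2"] by auto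
  define k where "k = max k0 m0"
  have "(2::real) ^ k0 \<le> 2 ^ k" by (simp add: k_def)
  then have "1 / \<eta>\<^sup>2 \<le> 2 ^ k" using k0 by linarith
  then have k: "1 \<le> \<eta>\<^sup>2 * 2 ^ k" using eta by (simp add: field_simps)
  have mk: "m0 \<le> 2 ^ k"
    by (metis k_def less_exp less_imp_le_nat max.cobounded2 order_trans)
  have disc0: "disc (cube k) \<eta> (\<lambda>X Y. of_bool (even (card (X \<inter> Y))) - 1 / 2)"
    unfolding disc_def
  proof (intro allI impI)
    fix \<phi> \<psi> :: "nat set \<Rightarrow> real" assume a: "\<forall>x\<in>cube k. \<bar>\<phi> x\<bar> \<le> 1" "\<forall>x\<in>cube k. \<bar>\<psi> x\<bar> \<le> 1"
    define s where "s = (\<Sum>U\<in>cube k. \<Sum>X\<in>cube k. \<phi> U * \<psi> X * chi U X)"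
    have "s\<^sup>2 \<le> (2 ^ k) ^ 3" unfolding s_def by (rule lindsey) (use a in auto)
    also have "(2 ^ k) ^ 3 \<le> (\<eta>\<^sup>2 * 2 ^ k) * (2 ^ k) ^ 3"
      using mult_right_mono[OF k, of "(2 ^ k) ^ 3"] by simp
    also have "\<dots> = (\<eta> * (2 ^ k)\<^sup>2)\<^sup>2" by (simp add: power2_eq_square power3_eq_cube)
    finally have "\<bar>s\<bar> \<le> \<eta> * (2 ^ k)\<^sup>2" using eta abs_le_square_iff[of s "\<eta> * (2 ^ k)\<^sup>2"] by simp
    moreover have c: "(of_bool (even (card (X \<inter> Y))) - 1 / 2) = chi X Y / 2" for X Y
      by (simp add: chi_def)
    moreover have "(\<Sum>x\<in>cube k. \<Sum>y\<in>cube k. \<phi> x * \<psi> y * (chi x y / 2)) = s / 2"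
      by (simp add: s_def sum_divide_distrib)
    ultimately show "\<bar>\<Sum>x\<in>cube k. \<Sum>y\<in>cube k. \<phi> x * \<psi> y * (of_bool (even (card (x \<inter> y))) - 1 / 2)\<bar> \<le> \<eta> * (real (card (cube k)))\<^sup>2"
      unfolding c by simp
  qed
  \<comment> \<open>Encoding sets by numbers lets the induction over densities stay within one
    type.\<close>
  define T where "T = set_encode ` cube k"
  have inj: "inj_on set_encode (cube k)"
    by (rule inj_on_subset[OF inj_on_set_encode]) (auto dest: cubeD)
  have bij: "bij_betw set_decode T (cube k)"
    unfolding T_def by (rule bij_betwI[of _ _ _ set_encode]) (auto simp: set_encode_inverse[OF cubeD])
  show ?thesis
  proof (intro exI conjI)
    show "finite T" by (simp add: T_def)
    show "m0 \<le> card T" using mk by (simp add: T_def card_image[OF inj])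
    show "disc T \<eta> (\<lambda>x y. of_bool (even (card (set_decode x \<inter> set_decode y))) - 1 / 2)"
      by (rule disc_reindex[OF bij disc0])
  qed (simp add: Int_commute)
qed

text \<open>Telescoping: \<open>R1 * R2 - p1 * p2 = R1 * (R2 - p2) + p2 * (R1 - p1)\<close>.\<close>

lemma quasirandom_product:
  fixes T1 :: "'a set" and T2 :: "'b set"
  assumes "finite T1" "finite T2" "disc T1 \<eta>1 (\<lambda>x y. of_bool (R1 x y) - p1)" "disc T2 \<eta>2 (\<lambda>x y. of_bool (R2 x y) - p2)"
    and p: "\<bar>p2\<bar> \<le> 1"
  shows "disc (T1 \<times> T2) (\<eta>2 + \<eta>1) (\<lambda>x y. of_bool (R1 (fst x) (fst y) \<and> R2 (snd x) (snd y)) - p1 * p2)"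
proof -
  have a: "disc (T1 \<times> T2) \<eta>2 (\<lambda>x y. of_bool (R1 (fst x) (fst y)) * (of_bool (R2 (snd x) (snd y)) - p2))"
    by (rule disc_product) (use assms in auto)
  have b: "disc (T1 \<times> T2) \<eta>1 (\<lambda>x y. p2 * (of_bool (R1 (fst x) (fst y)) - p1))"
    by (rule disc_product'[where \<kappa> = "\<lambda>_ _. p2"]) (use assms in auto)
  show ?thesis
    by (rule disc_cong[OF disc_add[OF a b]]) (auto simp: algebra_simps)
qed

lemma quasirandom_relation:
  assumes eta: "0 < \<eta>"
  shows "\<exists>(T :: nat set) R. finite T \<and> m0 \<le> card T \<and> (\<forall>x y. R x y = R y x) \<and>
     disc T \<eta> (\<lambda>x y. of_bool (R x y) - (1 / 2) ^ r)"
  using eta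
proof (induction r arbitrary: \<eta>)
  case 0
  show ?case
    by (rule exI[of _ "{..<m0}"], rule exI[of _ "\<lambda>_ _. True"]) (use 0 in \<open>simp add: disc_def\<close>)
next
  case (Suc r)
  obtain T1 :: "nat set" and R1 where 1: "finite T1" "1 \<le> card T1" "\<forall>x y. R1 x y = R1 y x"
     "disc T1 (\<eta> / 2) (\<lambda>x y. of_bool (R1 x y) - 1 / 2)"
    using hadamard_quasirandom[of "\<eta> / 2" 1] Suc.prems by auto
  obtain T2 :: "nat set" and R2 where 2: "finite T2" "m0 \<le> card T2" "\<forall>x y. R2 x y = R2 y x"
     "disc T2 (\<eta> / 2) (\<lambda>x y. of_bool (R2 x y) - (1 / 2) ^ r)"
    using Suc.IH[of "\<eta> / 2"] Suc.prems by auto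
  have d: "disc (T1 \<times> T2) \<eta> (\<lambda>x y. of_bool (R1 (fst x) (fst y) \<and> R2 (snd x) (snd y)) - 1 / 2 * (1 / 2) ^ r)"
    using quasirandom_product[OF 1(1) 2(1) 1(4) 2(4)] by (simp add: power_le_one)
  define T where "T = prod_encode ` (T1 \<times> T2)"
  define R where "R x y \<longleftrightarrow> R1 (fst (prod_decode x)) (fst (prod_decode y)) \<and> R2 (snd (prod_decode x)) (snd (prod_decode y))" for x y
  have bij: "bij_betw prod_decode T (T1 \<times> T2)"
    unfolding T_def by (rule bij_betwI[of _ _ _ prod_encode]) auto
  show ?case
  proof (intro exI conjI)
    show "finite T" using 1 2 by (simp add: T_def)
    have "card T = card T1 * card T2" using bij_betw_same_card[OF bij] by (simp add: card_cartesian_product)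
    moreover have "1 * m0 \<le> card T1 * card T2" by (rule mult_le_mono) (use 1 2 in auto)
    ultimately show "m0 \<le> card T" by simp
    show "\<forall>x y. R x y = R y x" using 1(3) 2(3) unfolding R_def by blast
    show "disc T \<eta> (\<lambda>x y. of_bool (R x y) - (1 / 2) ^ Suc r)"
      using disc_reindex[OF bij d] by (simp add: R_def)
  qed
qed

section \<open>The clump graph\<close>

text \<open>
  \<open>RB\<close> is taken inside \<open>RA\<close> so that the relation \<open>B\<close> below is quasirandom of density \<open>q\<close> on all
  pairs of vertices, and not only on pairs of clumps that are not joined by \<open>A\<close>.
\<close>

locale clump_graph =
  fixes k D n :: nat and S :: "nat set set" and cl :: "nat \<Rightarrow> nat set"
    and RA RB :: "nat \<Rightarrow> nat \<Rightarrow> bool" and e pA q \<eta> :: real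
  assumes S: "S \<subseteq> cube k" "card S = D" "{} \<notin> S" "\<And>x y. x \<in> S \<Longrightarrow> y \<in> S \<Longrightarrow> sdiff x y \<notin> S"
    and bias: "\<And>U. U \<in> cube k \<Longrightarrow> U \<noteq> {} \<Longrightarrow> \<bar>\<Sum>s\<in>S. chi U s\<bar> \<le> e * D"
    and cl: "\<And>x. x < n \<Longrightarrow> cl x \<in> cube k"
    and size: "\<And>\<omega>. \<omega> \<in> cube k \<Longrightarrow> real (card {x\<in>{..<n}. cl x = \<omega>}) * 2 ^ k = n"
    and Rsym: "\<And>x y. RA x y = RA y x" "\<And>x y. RB x y = RB y x" and RBA: "\<And>x y. RB x y \<Longrightarrow> RA x y"
    and discA: "\<And>\<kappa>. (\<And>a b. \<bar>\<kappa> a b\<bar> \<le> 1) \<Longrightarrow> disc {..<n} \<eta> (\<lambda>x y. \<kappa> (cl x) (cl y) * (of_bool (RA x y) - pA))"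
    and discB: "\<And>\<kappa>. (\<And>a b. \<bar>\<kappa> a b\<bar> \<le> 1) \<Longrightarrow> disc {..<n} \<eta> (\<lambda>x y. \<kappa> (cl x) (cl y) * (of_bool (RB x y) - q))"
    and n: "1 \<le> \<eta> * n" and eta: "0 < \<eta>" "\<eta> \<le> 1"
    and q: "0 < q" "q \<le> pA" "pA \<le> 1" and dens: "q * 2 ^ k = pA * D"
    and Q: "1 \<le> pA * D" "0 \<le> e" "e * (pA * D)\<^sup>2 \<le> 1 / 320" "q * (1 + real D) \<le> 1 / 4"
begin

section \<open>Densities and clump masses\<close>

definition J :: "nat set \<Rightarrow> nat set \<Rightarrow> bool" where "J a b \<longleftrightarrow> sdiff a b \<in> S"

definition adj :: "nat \<Rightarrow> nat \<Rightarrow> bool" where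
  "adj x y \<longleftrightarrow> cl x = cl y \<or> (if J (cl x) (cl y) then RA x y else RB x y)"

definition E :: "nat set set" where "E = {{x, y} | x y. x < n \<and> y < n \<and> x \<noteq> y \<and> adj x y}"

text \<open>The density profile of the graph. It keeps the value 1 on the diagonal, so that members
  of a clump have identical rows; the missing loops are charged to \<eta> in
  \<open>disc_G\<close>.\<close>

definition W :: "nat \<Rightarrow> nat \<Rightarrow> real" where
  "W x y = (if cl x = cl y then 1 else if J (cl x) (cl y) then pA else q)"

definition L :: "nat \<Rightarrow> nat \<Rightarrow> real" where "L x y = of_bool (cl x = cl y)"

definition A :: "nat \<Rightarrow> nat \<Rightarrow> real" where "A x y = of_bool (J (cl x) (cl y) \<and> RA x y)"

definition B :: "nat \<Rightarrow> nat \<Rightarrow> real" where "B x y = of_bool (RB x y)"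

text \<open>Forms whose kernel depends on the clumps only become forms in these clump masses, where
  the spectrum of \<open>J\<close> can be used.\<close>

definition M :: "(nat \<Rightarrow> real) \<Rightarrow> nat set \<Rightarrow> real" where "M \<phi> a = (\<Sum>x\<in>{x\<in>{..<n}. cl x = a}. \<phi> x)"

lemma n_pos: "0 < n" using n by (cases n) auto

lemma J_sym: "J a b = J b a" by (simp add: J_def sdiff_commute)

lemma J_irrefl: "\<not> J a a" using S(3) by (simp add: J_def)

text \<open>The third side of a triangle would be a sum of two elements of the sum-free set
  \<open>S\<close>.\<close>

lemma J_triangle_free: assumes "J a b" "J b c" shows "\<not> J a c"
proof -
  have "sdiff a c = sdiff (sdiff a b) (sdiff b c)" by (auto simp: sdiff_def)
  then show ?thesis using S(4) assms by (simp add: J_def)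
qed

lemma adj_sym: "adj x y = adj y x"
  unfolding adj_def using Rsym J_sym by metis

lemma E_iff: "{x, y} \<in> E \<longleftrightarrow> x < n \<and> y < n \<and> x \<noteq> y \<and> adj x y"
  unfolding E_def using adj_sym by (auto simp: doubleton_eq_iff)

lemma graph_on_E: "graph_on n E"
  unfolding graph_on_def E_def by auto

lemma finite_E: "finite E"
  by (rule finite_subset[of _ "Pow {..<n}"]) (auto simp: E_def)

lemma sum_M: "(\<Sum>a\<in>cube k. M \<phi> a) = (\<Sum>x<n. \<phi> x)"
  unfolding M_def by (rule sum.group) (use cl in auto)

lemma clump_sum:
  "(\<Sum>x<n. \<Sum>y<n. \<phi> x * \<psi> y * \<kappa> (cl x) (cl y)) = (\<Sum>a\<in>cube k. \<Sum>b\<in>cube k. M \<phi> a * M \<psi> b * \<kappa> a b)"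
proof -
  have g: "(\<Sum>x<n. f x) = (\<Sum>a\<in>cube k. \<Sum>x\<in>{x\<in>{..<n}. cl x = a}. f x)" for f :: "nat \<Rightarrow> real"
    by (rule sum.group[symmetric]) (use cl in auto)
  have "(\<Sum>x<n. \<Sum>y<n. \<phi> x * \<psi> y * \<kappa> (cl x) (cl y))
     = (\<Sum>a\<in>cube k. \<Sum>x\<in>{x\<in>{..<n}. cl x = a}. \<Sum>b\<in>cube k. \<Sum>y\<in>{y\<in>{..<n}. cl y = b}. \<phi> x * \<psi> y * \<kappa> a b)"
    unfolding g by (intro sum.cong refl) auto
  also have "\<dots> = (\<Sum>a\<in>cube k. \<Sum>b\<in>cube k. \<Sum>x\<in>{x\<in>{..<n}. cl x = a}. \<Sum>y\<in>{y\<in>{..<n}. cl y = b}. \<phi> x * \<psi> y * \<kappa> a b)"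
    by (rule sum.cong[OF refl], rule sum.swap)
  also have "\<dots> = (\<Sum>a\<in>cube k. \<Sum>b\<in>cube k. M \<phi> a * M \<psi> b * \<kappa> a b)"
    unfolding M_def sum_product by (simp add: sum_distrib_right)
  finally show ?thesis .
qed

text \<open>Identifies the sum of squares in the mixing error of \<open>J\<close> with the weight of
  the \<open>L\<close>-pairs.\<close>

lemma clump_sq: "(\<Sum>x<n. \<Sum>y<n. \<phi> x * \<phi> y * L x y) = (\<Sum>a\<in>cube k. (M \<phi> a)\<^sup>2)"
proof -
  have "(\<Sum>x<n. \<Sum>y<n. \<phi> x * \<phi> y * L x y) = (\<Sum>a\<in>cube k. \<Sum>b\<in>cube k. M \<phi> a * M \<phi> b * of_bool (a = b))"
    unfolding L_def by (rule clump_sum[where \<kappa> = "\<lambda>a b. of_bool (a = b)"])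
  then show ?thesis by (simp add: of_bool_def if_distrib power2_eq_square cong: if_cong)
qed

lemma J_mixing:
  "\<bar>\<Sum>a\<in>cube k. \<Sum>b\<in>cube k. f a * g b * (of_bool (J a b) - D / 2 ^ k)\<bar>
    \<le> e * D * ((\<Sum>a\<in>cube k. (f a)\<^sup>2) + (\<Sum>a\<in>cube k. (g a)\<^sup>2)) / 2"
  using cayley_mixing[OF S(1) _ bias, of f g] Q S(2) by (simp add: J_def)

text \<open>Two errors: \<open>RA\<close> over adjacent clumps contributes \<eta>, the expander
  \<open>J\<close> its eigenvalue bound times the sum of squared clump masses. The latter does not
  shrink with n, but masses of functions dominated by \<open>w\<close> are dominated by those of
  \<open>w\<close>, which gives the \<open>L\<close>-form.\<close>

lemma disc_A:
  assumes w: "\<And>x. x \<in> {..<n} \<Longrightarrow> \<bar>\<phi> x\<bar> \<le> w x \<and> \<bar>\<psi> x\<bar> \<le> w x \<and> w x \<le> 1"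
  shows "(\<Sum>x<n. \<Sum>y<n. \<phi> x * \<psi> y * (A x y - q)) \<le> \<eta> * (real n)\<^sup>2 + e * (pA * D) * (\<Sum>x<n. \<Sum>y<n. w x * w y * L x y)"
proof -
  have "disc {..<n} \<eta> (\<lambda>x y. of_bool (J (cl x) (cl y)) * (of_bool (RA x y) - pA))"
    by (rule discA[of "\<lambda>a b. of_bool (J a b)"]) simp
  from discD[OF this, of \<phi> \<psi>]
  have 1: "(\<Sum>x<n. \<Sum>y<n. \<phi> x * \<psi> y * (of_bool (J (cl x) (cl y)) * (of_bool (RA x y) - pA))) \<le> \<eta> * (real n)\<^sup>2"
    using w by force
  \<comment> \<open>The calibration \<open>dens\<close>: density pA on the \<open>D / 2 ^ k\<close>
    share of pairs over \<open>J\<close> averages to q.\<close>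
  have qe: "q = pA * (D / 2 ^ k)" using dens by (simp add: field_simps)
  have "(\<Sum>x<n. \<Sum>y<n. \<phi> x * \<psi> y * (pA * of_bool (J (cl x) (cl y)) - q))
     = (\<Sum>a\<in>cube k. \<Sum>b\<in>cube k. M \<phi> a * M \<psi> b * (pA * of_bool (J a b) - q))"
    by (rule clump_sum[where \<kappa> = "\<lambda>a b. pA * of_bool (J a b) - q"])
  also have "\<dots> = pA * (\<Sum>a\<in>cube k. \<Sum>b\<in>cube k. M \<phi> a * M \<psi> b * (of_bool (J a b) - D / 2 ^ k))"
    unfolding sum_distrib_left
    by (intro sum.cong refl) (simp add: qe algebra_simps)
  also have "\<dots> \<le> pA * (e * D * ((\<Sum>a\<in>cube k. (M \<phi> a)\<^sup>2) + (\<Sum>a\<in>cube k. (M \<psi> a)\<^sup>2)) / 2)"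
    using q J_mixing[of "M \<phi>" "M \<psi>"] by (intro mult_left_mono) auto
  also have "\<dots> \<le> pA * (e * D * ((\<Sum>a\<in>cube k. (M w a)\<^sup>2) + (\<Sum>a\<in>cube k. (M w a)\<^sup>2)) / 2)"
  proof -
    have m: "(M f a)\<^sup>2 \<le> (M w a)\<^sup>2" if "\<And>x. x < n \<Longrightarrow> \<bar>f x\<bar> \<le> w x" for f a
    proof -
      have "\<bar>M f a\<bar> \<le> (\<Sum>x\<in>{x\<in>{..<n}. cl x = a}. \<bar>f x\<bar>)" unfolding M_def by (rule sum_abs)
      also have "\<dots> \<le> M w a" unfolding M_def by (intro sum_mono) (use that in auto)
      finally show ?thesis by (simp add: abs_le_square_iff[symmetric])
    qed
    show ?thesis
      by (intro mult_left_mono divide_right_mono add_mono sum_mono m) (use w q Q in auto)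
  qed
  finally have 2: "(\<Sum>x<n. \<Sum>y<n. \<phi> x * \<psi> y * (pA * of_bool (J (cl x) (cl y)) - q))
     \<le> e * (pA * D) * (\<Sum>x<n. \<Sum>y<n. w x * w y * L x y)"
    by (subst clump_sq) (simp add: mult_ac)
  have "(\<Sum>x<n. \<Sum>y<n. \<phi> x * \<psi> y * (A x y - q))
     = (\<Sum>x<n. \<Sum>y<n. \<phi> x * \<psi> y * (of_bool (J (cl x) (cl y)) * (of_bool (RA x y) - pA)))
      + (\<Sum>x<n. \<Sum>y<n. \<phi> x * \<psi> y * (pA * of_bool (J (cl x) (cl y)) - q))"
    unfolding sum.distrib[symmetric] by (intro sum.cong refl) (auto simp: A_def algebra_simps)
  with 1 2 show ?thesis by linarith
qed

lemma disc_B: "disc {..<n} \<eta> (\<lambda>x y. B x y - q)"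
  using discB[of "\<lambda>_ _. 1"] by (simp add: B_def)

text \<open>Three errors: the absent loops, which \<open>1 \<le> \<eta> * n\<close> makes
  affordable, the pairs over \<open>J\<close>, and the other pairs of distinct clumps.\<close>

lemma disc_G: "disc {..<n} (3 * \<eta>) (\<lambda>x y. of_bool ({x, y} \<in> E) - W x y)"
proof -
  have 1: "disc {..<n} \<eta> (\<lambda>x y. - of_bool (x = y))"
    unfolding disc_def
  proof (intro allI impI)
    fix \<phi> \<psi> :: "nat \<Rightarrow> real" assume a: "\<forall>x\<in>{..<n}. \<bar>\<phi> x\<bar> \<le> 1" "\<forall>x\<in>{..<n}. \<bar>\<psi> x\<bar> \<le> 1"
    have "(\<Sum>x<n. \<Sum>y<n. \<phi> x * \<psi> y * - of_bool (x = y)) = (\<Sum>x<n. - (\<phi> x * \<psi> x))"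
      by (intro sum.cong refl) (simp add: of_bool_def if_distrib cong: if_cong)
    also have "\<bar>\<dots>\<bar> \<le> (\<Sum>x<n. \<bar>- (\<phi> x * \<psi> x)\<bar>)" by (rule sum_abs)
    also have "\<dots> \<le> (\<Sum>x<n. 1)" by (intro sum_mono) (use a in \<open>auto simp: abs_mult mult_le_one\<close>)
    also have "\<dots> \<le> \<eta> * (real n)\<^sup>2" using mult_right_mono[OF n, of "real n"] by (simp add: power2_eq_square)
    finally show "\<bar>\<Sum>x<n. \<Sum>y<n. \<phi> x * \<psi> y * - of_bool (x = y)\<bar> \<le> \<eta> * (real (card {..<n}))\<^sup>2" by simp
  qed
  have 2: "disc {..<n} \<eta> (\<lambda>x y. of_bool (J (cl x) (cl y)) * (of_bool (RA x y) - pA))"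
    by (rule discA[of "\<lambda>a b. of_bool (J a b)"]) simp
  have 3: "disc {..<n} \<eta> (\<lambda>x y. of_bool (\<not> J (cl x) (cl y) \<and> cl x \<noteq> cl y) * (of_bool (RB x y) - q))"
    by (rule discB[of "\<lambda>a b. of_bool (\<not> J a b \<and> a \<noteq> b)"]) simp
  have "disc {..<n} (\<eta> + (\<eta> + \<eta>)) (\<lambda>x y. of_bool ({x, y} \<in> E) - W x y)"
    by (rule disc_cong[OF disc_add[OF 1 disc_add[OF 2 3]]])
      (auto simp: E_iff adj_def W_def J_irrefl)
  then show ?thesis by (rule disc_mono) simp
qed

section \<open>The quadratic form of the density profile\<close>

text \<open>By mixing, the form of \<open>W\<close> is at least
  \<open>2 * q * U\<^sup>2 + T / 2\<close>, T being the \<open>L\<close>-form; half of it is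
  \<open>q * U\<^sup>2 + T / 4\<close>. One T/8 pays for the surplus of
  \<open>q * U\<^sup>2\<close>, as \<open>U\<^sup>2 \<le> 2 ^ k * T\<close> by Cauchy-Schwarz and
  \<open>q * 2 ^ k = Q\<close>. The other pays for the \<open>L\<close>-term, whose coefficient is
  \<open>40 * e * Q\<^sup>2 \<le> 40 / 320\<close>.\<close>

lemma W_lower:
  assumes u: "\<And>x. x \<in> {..<n} \<Longrightarrow> 0 \<le> u x \<and> u x \<le> 1"
  shows "(1 + 1 / (8 * (pA * D))) * q * (\<Sum>x<n. u x)\<^sup>2 + 5 * (e * (pA * D)) / (1 / (8 * (pA * D))) * (\<Sum>x<n. \<Sum>y<n. u x * u y * L x y)
         \<le> (\<Sum>x<n. \<Sum>y<n. u x * u y * W x y) / 2"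
proof -
  define Q where "Q = pA * D"
  define U where "U = (\<Sum>x<n. u x)"
  define T where "T = (\<Sum>x<n. \<Sum>y<n. u x * u y * L x y)"
  define JS where "JS = (\<Sum>a\<in>cube k. \<Sum>b\<in>cube k. M u a * M u b * of_bool (J a b))"
  have Tsq: "T = (\<Sum>a\<in>cube k. (M u a)\<^sup>2)" by (simp add: T_def clump_sq)
  have T0: "0 \<le> T" unfolding Tsq by (intro sum_nonneg) simp
  have U2: "U\<^sup>2 \<le> 2 ^ k * T"
    using Cauchy_Schwarz_ineq_sum[of "\<lambda>_. 1" "M u" "cube k"] by (simp add: sum_M U_def Tsq)
  have "(\<Sum>a\<in>cube k. \<Sum>b\<in>cube k. M u a * M u b * (of_bool (J a b) - D / 2 ^ k)) = JS - D / 2 ^ k * U\<^sup>2"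
    by (simp add: JS_def right_diff_distrib sum_subtractf U_def sum_M[symmetric] power2_eq_square sum_product sum_distrib_left mult_ac)
  then have J1: "D / 2 ^ k * U\<^sup>2 - e * D * T \<le> JS"
    using J_mixing[of "M u" "M u"] by (simp add: Tsq)
  have "(\<Sum>x<n. \<Sum>y<n. u x * u y * W x y)
     = (\<Sum>a\<in>cube k. \<Sum>b\<in>cube k. M u a * M u b * ((pA - q) * of_bool (J a b) + q + (1 - q) * of_bool (a = b)))"
  proof -
    have "W x y = (pA - q) * of_bool (J (cl x) (cl y)) + q + (1 - q) * of_bool (cl x = cl y)" for x y
      by (auto simp: W_def J_irrefl)
    then show ?thesis
      using clump_sum[of u u "\<lambda>a b. (pA - q) * of_bool (J a b) + q + (1 - q) * of_bool (a = b)"] by simp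
  qed
  also have "\<dots> = (\<Sum>a\<in>cube k. \<Sum>b\<in>cube k. (pA - q) * (M u a * M u b * of_bool (J a b)) + q * (M u a * M u b) + (1 - q) * (M u a * M u b * of_bool (a = b)))"
    by (intro sum.cong refl) (simp add: algebra_simps)
  also have "\<dots> = (pA - q) * JS + q * U\<^sup>2 + (1 - q) * (\<Sum>a\<in>cube k. \<Sum>b\<in>cube k. M u a * M u b * of_bool (a = b))"
    by (simp add: sum.distrib JS_def sum_distrib_left[symmetric] U_def sum_M[symmetric] power2_eq_square sum_product)
  also have "(\<Sum>a\<in>cube k. \<Sum>b\<in>cube k. M u a * M u b * of_bool (a = b)) = T"
    by (simp add: Tsq of_bool_def if_distrib power2_eq_square cong: if_cong)
  finally have WS: "(\<Sum>x<n. \<Sum>y<n. u x * u y * W x y) = (pA - q) * JS + q * U\<^sup>2 + (1 - q) * T" .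
  have "(pA - q) * (D / 2 ^ k * U\<^sup>2 - e * D * T) \<le> (pA - q) * JS"
    using J1 q by (intro mult_left_mono) auto
  moreover have "(pA - q) * (D / 2 ^ k * U\<^sup>2 - e * D * T) = pA * D / 2 ^ k * U\<^sup>2 - q * D * (U\<^sup>2 / 2 ^ k) - (pA - q) * e * D * T"
    by (simp add: algebra_simps diff_divide_distrib)
  moreover have "pA * D / 2 ^ k = q" using dens by (simp add: field_simps)
  moreover have "q * D * (U\<^sup>2 / 2 ^ k) \<le> q * D * T"
    using U2 q by (intro mult_left_mono) (auto simp: field_simps)
  moreover have "(pA - q) * e * D * T \<le> pA * e * D * T"
    using q Q T0 by (intro mult_right_mono) auto
  ultimately have lower: "2 * q * U\<^sup>2 + (1 - q * (1 + real D) - e * Q) * T \<le> (\<Sum>x<n. \<Sum>y<n. u x * u y * W x y)"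
    unfolding WS by (simp add: Q_def algebra_simps)
  have Q1: "1 \<le> Q" using Q by (simp add: Q_def)
  have eQ2: "e * Q * Q \<le> 1 / 320" using Q by (simp add: Q_def power2_eq_square mult_ac)
  have eQ: "e * Q \<le> 1 / 320"
  proof -
    have "e * Q * 1 \<le> e * Q * Q" using Q1 Q by (intro mult_left_mono) auto
    then show ?thesis using eQ2 by simp
  qed
  have "1 / (8 * Q) * q * U\<^sup>2 \<le> T / 8"
  proof -
    have "1 / (8 * Q) * q * U\<^sup>2 \<le> 1 / (8 * Q) * q * (2 ^ k * T)"
      using U2 q Q1 by (intro mult_left_mono) auto
    also have "\<dots> = 1 / (8 * Q) * (q * 2 ^ k) * T" by simp
    also have "\<dots> = T / 8" using Q1 unfolding dens Q_def[symmetric] by simp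
    finally show ?thesis .
  qed
  moreover have "5 * (e * Q) / (1 / (8 * Q)) * T \<le> T / 8"
  proof -
    have "5 * (e * Q) / (1 / (8 * Q)) = 40 * (e * Q * Q)" using Q1 by simp
    also have "\<dots> \<le> 1 / 8" using eQ2 by simp
    finally show ?thesis using mult_right_mono[OF _ T0] by fastforce
  qed
  moreover have "T / 2 \<le> (1 - q * (1 + real D) - e * Q) * T"
  proof -
    have "1 / 2 \<le> 1 - q * (1 + real D) - e * Q" using Q(4) eQ by linarith
    from mult_right_mono[OF this T0] show ?thesis by simp
  qed
  moreover have "(1 + 1 / (8 * Q)) * q * U\<^sup>2 = q * U\<^sup>2 + 1 / (8 * Q) * q * U\<^sup>2" by (simp add: algebra_simps)
  ultimately show ?thesis using lower unfolding Q_def[symmetric] U_def[symmetric] T_def[symmetric] by linarith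
qed

lemma sum_W_ge: "2 * q * (real n)\<^sup>2 \<le> (\<Sum>x<n. \<Sum>y<n. W x y)"
proof -
  have "0 \<le> 1 / (8 * (pA * D)) * q * (real n)\<^sup>2" using q Q by simp
  moreover have "0 \<le> 5 * (e * (pA * D)) / (1 / (8 * (pA * D))) * (\<Sum>x<n. \<Sum>y<n. L x y)"
    using q Q by (intro mult_nonneg_nonneg sum_nonneg) (auto simp: L_def)
  moreover have "(1 + 1 / (8 * (pA * D))) * q * (real n)\<^sup>2 + 5 * (e * (pA * D)) / (1 / (8 * (pA * D))) * (\<Sum>x<n. \<Sum>y<n. L x y)
         \<le> (\<Sum>x<n. \<Sum>y<n. W x y) / 2" using W_lower[of "\<lambda>_. 1"] by simp
  moreover have "(1 + 1 / (8 * (pA * D))) * q * (real n)\<^sup>2 = q * (real n)\<^sup>2 + 1 / (8 * (pA * D)) * q * (real n)\<^sup>2"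
    by (simp add: distrib_right)
  ultimately show ?thesis by linarith
qed

lemma triangle_free_sum_bound:
  assumes F: "F \<subseteq> E" and tf: "\<And>x y z. {x, y} \<in> F \<Longrightarrow> {x, z} \<in> F \<Longrightarrow> {y, z} \<in> F \<Longrightarrow> False"
    and theta: "0 < \<theta>" "\<theta> \<le> 1" and K: "0 < (K::nat)"
  shows "(\<Sum>x<n. \<Sum>y<n. of_bool ({x, y} \<in> F) :: real) \<le> (\<Sum>x<n. \<Sum>y<n. W x y) / 2
     + (3 * \<eta> * real n / (q * K) + 2 * (3 * \<eta>) + real K / real n
         + 15 * (3 * \<eta>) / (1 / (8 * (pA * D)) * q\<^sup>2 * \<theta>) + 2 * \<theta>) * (real n)\<^sup>2"
proof -
  have Q1: "1 \<le> pA * D" using Q by simp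
  have eQ: "e * (pA * D) \<le> 1"
  proof -
    have "e * (pA * D) * 1 \<le> e * (pA * D) * (pA * D)" using Q by (intro mult_left_mono) auto
    then show ?thesis using Q(3) by (simp add: power2_eq_square mult_ac)
  qed
  have "(\<Sum>x\<in>{..<n}. \<Sum>y\<in>{..<n}. of_bool ({x, y} \<in> F) :: real) \<le> (\<Sum>x\<in>{..<n}. \<Sum>y\<in>{..<n}. W x y) / 2
     + (3 * \<eta> * real (card {..<n}) / (q * K) + 2 * (3 * \<eta>) + real K / real (card {..<n})
         + 15 * (3 * \<eta>) / (1 / (8 * (pA * D)) * q\<^sup>2 * \<theta>) + 2 * \<theta>) * (real (card {..<n}))\<^sup>2"
  \<comment> \<open>\<delta> and \<epsilon> are the values prepared in \<open>W_lower\<close>;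
    \<open>3 * \<eta>\<close>, the error of \<open>disc_G\<close>, serves as common error.\<close>
  proof (rule triangle_free_bound[where A = A and B = B and L = L and \<epsilon> = "e * (pA * D)" and G = "\<lambda>x y. of_bool ({x, y} \<in> E)"])
    show "{..<n} \<noteq> {}" using n_pos by auto
    show "of_bool ({x, x} \<in> E) = (0 :: real)" for x using E_iff[of x x] by simp
    show "of_bool ({x, y} \<in> F) \<le> (of_bool ({x, y} \<in> E) :: real)" for x y using F by auto
    show "disc {..<n} (3 * \<eta>) (\<lambda>x y. B x y - q)" by (rule disc_mono[OF disc_B]) (use eta in simp)
    show "(\<Sum>x<n. \<Sum>y<n. \<phi> x * \<psi> y * (A x y - q)) \<le> 3 * \<eta> * (real (card {..<n}))\<^sup>2 + e * (pA * D) * (\<Sum>x<n. \<Sum>y<n. w x * w y * L x y)"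
      if "\<And>x. x \<in> {..<n} \<Longrightarrow> \<bar>\<phi> x\<bar> \<le> w x \<and> \<bar>\<psi> x\<bar> \<le> w x \<and> w x \<le> 1" for \<phi> \<psi> w
    proof -
      have "\<eta> * (real n)\<^sup>2 \<le> 3 * \<eta> * (real n)\<^sup>2" using eta by simp
      then show ?thesis using disc_A[of \<phi> w \<psi>, OF that] unfolding card_lessThan by linarith
    qed
    show "(1 + 1 / (8 * (pA * D))) * q * (\<Sum>x<n. u x)\<^sup>2 + 5 * (e * (pA * D)) / (1 / (8 * (pA * D))) * (\<Sum>x<n. \<Sum>y<n. u x * u y * L x y)
         \<le> (\<Sum>x<n. \<Sum>y<n. u x * u y * W x y) / 2 + 3 * \<eta> * (real (card {..<n}))\<^sup>2"
      if "\<And>x. x \<in> {..<n} \<Longrightarrow> 0 \<le> u x \<and> u x \<le> 1" for u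
    proof -
      have "0 \<le> 3 * \<eta> * (real (card {..<n}))\<^sup>2" using eta by simp
      then show ?thesis using W_lower[of u, OF that] by linarith
    qed
    show "of_bool ({x, y} \<in> F) = (of_bool ({y, x} \<in> F) :: real)" for x y by (simp add: insert_commute)
    show "of_bool ({x, y} \<in> E) \<le> A x y + B x y" if "L x y = 0" for x y
      using that RBA by (auto simp: E_iff adj_def A_def B_def L_def)
    show "W x z = W y z" if "L x y = 1" for x y z using that by (simp add: L_def W_def)
    show "W x y = W y x" for x y using J_sym by (auto simp: W_def)
    show "1 / (8 * (pA * D)) \<le> 1" "0 < 1 / (8 * (pA * D))" using Q1 by auto
    show "disc {..<n} (3 * \<eta>) (\<lambda>x y. of_bool ({x, y} \<in> E) - W x y)" by (rule disc_G)
  qed (use tf q Q eQ theta K eta in \<open>auto simp: E_iff A_def B_def L_def W_def Rsym\<close>)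
  then show ?thesis by simp
qed

text \<open>Edges are read as ordered pairs through \<open>Min\<close> and \<open>Max\<close>; the
  double sum meets each edge in both orders, hence the factor 2.\<close>

lemma sum_edges:
  fixes f :: "nat \<Rightarrow> nat \<Rightarrow> real"
  assumes F: "F \<subseteq> E" and sym: "\<And>x y. f x y = f y x"
  shows "2 * (\<Sum>e\<in>F. f (Min e) (Max e)) = (\<Sum>x<n. \<Sum>y<n. of_bool ({x, y} \<in> F) * f x y)"
proof -
  define P where "P = {p\<in>{..<n} \<times> {..<n}. fst p < snd p \<and> {fst p, snd p} \<in> F}"
  define P' where "P' = {p\<in>{..<n} \<times> {..<n}. snd p < fst p \<and> {fst p, snd p} \<in> F}"
  have ex: "\<exists>x y. e = {x, y} \<and> x < y \<and> x < n \<and> y < n" if e: "e \<in> F" for e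
  proof -
    obtain x y where "e = {x, y}" "x < n" "y < n" "x \<noteq> y" using e F by (auto simp: E_def)
    then show ?thesis by (metis insert_commute nat_neq_iff)
  qed
  have nl: "x \<noteq> y" if "{x, y} \<in> F" for x y using that F E_iff by blast
  have "(\<Sum>e\<in>F. f (Min e) (Max e)) = (\<Sum>p\<in>P. f (fst p) (snd p))"
  proof (rule sum.reindex_bij_witness[where i = "\<lambda>p. {fst p, snd p}" and j = "\<lambda>e. (Min e, Max e)"])
    fix e assume "e \<in> F"
    with ex obtain x y where xy: "e = {x, y}" "x < y" "x < n" "y < n" by blast
    then show "{fst (Min e, Max e), snd (Min e, Max e)} = e" "(Min e, Max e) \<in> P"
      "f (fst (Min e, Max e)) (snd (Min e, Max e)) = f (Min e) (Max e)"
      using \<open>e \<in> F\<close> by (auto simp: P_def)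
  next
    fix p assume "p \<in> P"
    then show "(Min {fst p, snd p}, Max {fst p, snd p}) = p" "{fst p, snd p} \<in> F"
      by (auto simp: P_def)
  qed
  moreover have "(\<Sum>p\<in>P'. f (fst p) (snd p)) = (\<Sum>p\<in>P. f (fst p) (snd p))"
    by (rule sum.reindex_bij_witness[where i = prod.swap and j = prod.swap])
      (auto simp: P_def P'_def insert_commute sym)
  moreover have "(\<Sum>x<n. \<Sum>y<n. of_bool ({x, y} \<in> F) * f x y) = (\<Sum>p\<in>P \<union> P'. f (fst p) (snd p))"
  proof -
    have "(\<Sum>x<n. \<Sum>y<n. of_bool ({x, y} \<in> F) * f x y) = (\<Sum>p\<in>{..<n} \<times> {..<n}. of_bool ({fst p, snd p} \<in> F) * f (fst p) (snd p))"
      by (simp only: sum.cartesian_product split_def)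
    also have "\<dots> = (\<Sum>p\<in>P \<union> P'. f (fst p) (snd p))"
      by (rule sum.mono_neutral_cong_right) (use nl in \<open>auto simp: P_def P'_def neq_iff\<close>)
    finally show ?thesis .
  qed
  moreover have "(\<Sum>p\<in>P \<union> P'. f (fst p) (snd p)) = (\<Sum>p\<in>P. f (fst p) (snd p)) + (\<Sum>p\<in>P'. f (fst p) (snd p))"
    by (rule sum.union_disjoint) (auto simp: P_def P'_def)
  ultimately show ?thesis by simp
qed

lemma card_edges:
  assumes "F \<subseteq> E" shows "2 * real (card F) = (\<Sum>x<n. \<Sum>y<n. of_bool ({x, y} \<in> F))"
  using sum_edges[OF assms, of "\<lambda>_ _. 1"] by simp

lemma sum_W_card: "\<bar>2 * real (card E) - (\<Sum>x<n. \<Sum>y<n. W x y)\<bar> \<le> 3 * \<eta> * (real n)\<^sup>2"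
  using discD[OF disc_G, of "\<lambda>_. 1" "\<lambda>_. 1"] card_edges[of E] by (simp add: sum_subtractf)

lemma card_E_ge: "(2 * q - 3 * \<eta>) * (real n)\<^sup>2 \<le> 2 * real (card E)"
  using sum_W_card sum_W_ge by (simp add: left_diff_distrib)

text \<open>\<open>C\<close> marks the pairs of clumps at \<open>J\<close>-distance two.\<close>

definition C :: "nat set \<Rightarrow> nat set \<Rightarrow> bool" where
  "C a b \<longleftrightarrow> a \<noteq> b \<and> \<not> J a b \<and> (\<exists>c. J a c \<and> J c b)"

section \<open>A fractional triangle cover bounding the packing number\<close>

text \<open>Pairs at \<open>J\<close>-distance two receive 3/2, a full unit on top of the half, so
  that the total splits into three separate estimates.\<close>

definition wt :: "nat set \<Rightarrow> nat set \<Rightarrow> real" where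
  "wt a b = of_bool (a = b) + of_bool (C a b) + of_bool (a \<noteq> b \<and> \<not> J a b) / 2"

lemma wt_sym: "wt a b = wt b a"
proof -
  have "C a b = C b a" for a b unfolding C_def using J_sym by metis
  then show ?thesis using J_sym[of a b] by (auto simp: wt_def)
qed

lemma wt_nonneg: "0 \<le> wt a b" by (simp add: wt_def)

text \<open>Two equal clumps already give weight one. Otherwise \<open>J\<close> contains at most
  two of the three pairs: if two, the third is at distance two; if fewer, two pairs give a half
  each.\<close>

lemma wt_triangle: "1 \<le> wt a b + wt b c + wt a c"
proof (cases "a = b \<or> b = c \<or> a = c")
  case True
  then have "1 \<le> wt a b \<or> 1 \<le> wt b c \<or> 1 \<le> wt a c" by (auto simp: wt_def)
  then show ?thesis using wt_nonneg[of a b] wt_nonneg[of b c] wt_nonneg[of a c] by linarith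
next
  case False
  have half: "1 / 2 \<le> wt x y" if "x \<noteq> y" "\<not> J x y" for x y using that by (simp add: wt_def)
  have one: "1 \<le> wt x y" if "x \<noteq> y" "\<not> J x y" "J x z" "J z y" for x y z
    using that by (auto simp: wt_def C_def)
  note nn = wt_nonneg[of a b] wt_nonneg[of b c] wt_nonneg[of a c]
  consider "\<not> J a b" "\<not> J b c" | "\<not> J a b" "\<not> J a c" | "\<not> J b c" "\<not> J a c"
    | "J a b" "J b c" "\<not> J a c" | "J a b" "J a c" "\<not> J b c" | "J b c" "J a c" "\<not> J a b"
    using J_triangle_free by blast
  then show ?thesis
  proof cases
    case 1
    then have "1 / 2 \<le> wt a b" "1 / 2 \<le> wt b c" using False J_sym half one by metis+
    then show ?thesis using nn by linarith
  next
    case 2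
    then have "1 / 2 \<le> wt a b" "1 / 2 \<le> wt a c" using False J_sym half one by metis+
    then show ?thesis using nn by linarith
  next
    case 3
    then have "1 / 2 \<le> wt b c" "1 / 2 \<le> wt a c" using False J_sym half one by metis+
    then show ?thesis using nn by linarith
  next
    case 4
    then have "1 \<le> wt a c" using False J_sym half one by metis+
    then show ?thesis using nn by linarith
  next
    case 5
    then have "1 \<le> wt b c" using False J_sym half one by metis+
    then show ?thesis using nn by linarith
  next
    case 6
    then have "1 \<le> wt a b" using False J_sym half one by metis+
    then show ?thesis using nn by linarith
  qed
qed

lemma M_one: "a \<in> cube k \<Longrightarrow> M (\<lambda>_. 1) a = n / 2 ^ k"
  using size[of a] by (simp add: M_def field_simps)

text \<open>Clumps make up a \<open>1 / 2 ^ k\<close> share of all pairs; a clump has at most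
  \<open>D\<^sup>2\<close> clumps at distance two, reached by adding two elements of
  \<open>S\<close>; the remaining term is half the density q of \<open>B\<close>.\<close>

lemma sum_wt_le:
  "(\<Sum>x<n. \<Sum>y<n. of_bool ({x, y} \<in> E) * wt (cl x) (cl y))
    \<le> (1 / 2 ^ k + q * D\<^sup>2 / 2 ^ k + q / 2 + 3 / 2 * \<eta>) * (real n)\<^sup>2"
proof -
  have "(\<Sum>x<n. \<Sum>y<n. of_bool ({x, y} \<in> E) * wt (cl x) (cl y))
     \<le> (\<Sum>x<n. \<Sum>y<n. L x y + of_bool (C (cl x) (cl y)) * B x y + B x y / 2)"
    by (intro sum_mono) (auto simp: E_iff adj_def wt_def L_def B_def C_def)
  also have "\<dots> = (\<Sum>x<n. \<Sum>y<n. L x y) + (\<Sum>x<n. \<Sum>y<n. of_bool (C (cl x) (cl y)) * B x y) + (\<Sum>x<n. \<Sum>y<n. B x y) / 2"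
    by (simp add: sum.distrib sum_divide_distrib)
  also have "(\<Sum>x<n. \<Sum>y<n. L x y) = (real n)\<^sup>2 / 2 ^ k"
  proof -
    have "(\<Sum>x<n. \<Sum>y<n. L x y) = (\<Sum>a\<in>cube k. (M (\<lambda>_. 1) a)\<^sup>2)" using clump_sq[of "\<lambda>_. 1"] by simp
    also have "\<dots> = (\<Sum>a\<in>cube k. (n / 2 ^ k)\<^sup>2)" by (intro sum.cong refl) (simp add: M_one)
    finally show ?thesis by (simp add: power2_eq_square)
  qed
  also have "(\<Sum>x<n. \<Sum>y<n. of_bool (C (cl x) (cl y)) * B x y) \<le> q * D\<^sup>2 / 2 ^ k * (real n)\<^sup>2 + \<eta> * (real n)\<^sup>2"
  proof -
    have "disc {..<n} \<eta> (\<lambda>x y. of_bool (C (cl x) (cl y)) * (B x y - q))"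
      unfolding B_def by (rule discB[of "\<lambda>a b. of_bool (C a b)"]) simp
    from discD[OF this, of "\<lambda>_. 1" "\<lambda>_. 1"]
    have "(\<Sum>x<n. \<Sum>y<n. of_bool (C (cl x) (cl y)) * B x y) \<le> q * (\<Sum>x<n. \<Sum>y<n. of_bool (C (cl x) (cl y))) + \<eta> * (real n)\<^sup>2"
      by (simp add: right_diff_distrib sum_subtractf sum_distrib_left mult.commute)
    also have "(\<Sum>x<n. \<Sum>y<n. of_bool (C (cl x) (cl y)) :: real) = (\<Sum>a\<in>cube k. \<Sum>b\<in>cube k. (n / 2 ^ k)\<^sup>2 * of_bool (C a b))"
      using clump_sum[of "\<lambda>_. 1" "\<lambda>_. 1" "\<lambda>a b. of_bool (C a b)"] by (simp add: M_one power2_eq_square)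
    also have "\<dots> \<le> (\<Sum>a\<in>cube k. (n / 2 ^ k)\<^sup>2 * (real D)\<^sup>2)"
    proof (rule sum_mono)
      fix a
      have "{b\<in>cube k. C a b} \<subseteq> (\<lambda>(s, s'). sdiff a (sdiff s s')) ` (S \<times> S)"
      proof
        fix b assume "b \<in> {b\<in>cube k. C a b}"
        then obtain c where c: "sdiff a c \<in> S" "sdiff c b \<in> S" by (auto simp: C_def J_def)
        have "b = sdiff a (sdiff (sdiff a c) (sdiff c b))" by (auto simp: sdiff_def)
        then show "b \<in> (\<lambda>(s, s'). sdiff a (sdiff s s')) ` (S \<times> S)" using c by force
      qed
      moreover have fS: "finite S" using S(1) finite_subset finite_cube by blast
      ultimately have "card {b\<in>cube k. C a b} \<le> card (S \<times> S)" by (meson finite_SigmaI surj_card_le)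
      then have c1: "real (card {b\<in>cube k. C a b}) \<le> (real D)\<^sup>2"
        using S(2) by (simp add: card_cartesian_product power2_eq_square flip: of_nat_mult)
      have c2: "(\<Sum>b\<in>cube k. (n / 2 ^ k)\<^sup>2 * of_bool (C a b)) = (n / 2 ^ k)\<^sup>2 * real (card {b\<in>cube k. C a b})"
        by (simp add: sum_distrib_left[symmetric] Int_def)
      show "(\<Sum>b\<in>cube k. (n / 2 ^ k)\<^sup>2 * of_bool (C a b)) \<le> (n / 2 ^ k)\<^sup>2 * (real D)\<^sup>2"
        unfolding c2 by (rule mult_left_mono[OF c1]) simp
    qed
    also have "\<dots> = (real D)\<^sup>2 / 2 ^ k * (real n)\<^sup>2" by (simp add: power2_eq_square)
    finally show ?thesis using q by (simp add: mult_left_mono)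
  qed
  also have "(\<Sum>x<n. \<Sum>y<n. B x y) \<le> q * (real n)\<^sup>2 + \<eta> * (real n)\<^sup>2"
    using disc_upper[OF disc_B, of "\<lambda>_. 1" "\<lambda>_. 1"] by (simp add: power2_eq_square)
  finally show ?thesis by (simp add: algebra_simps add_divide_distrib)
qed

text \<open>Weak duality: edge-disjoint triangles each collect weight at least one from the cover.
  The factor 2 stems from ordered pairs.\<close>

lemma packing_bound:
  assumes T: "T \<subseteq> triangles E" and disj: "\<forall>s\<in>T. \<forall>t\<in>T. s \<noteq> t \<longrightarrow> tri_edges s \<inter> tri_edges t = {}"
  shows "2 * real (card T) \<le> (\<Sum>x<n. \<Sum>y<n. of_bool ({x, y} \<in> E) * wt (cl x) (cl y))"
proof -
  define f where "f e = wt (cl (Min e)) (cl (Max e))" for e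
  have f: "f {x, y} = wt (cl x) (cl y)" for x y
    by (cases "x \<le> y") (auto simp: f_def min_def max_def wt_sym)
  have te: "tri_edges t \<subseteq> E \<and> 1 \<le> (\<Sum>e\<in>tri_edges t. f e) \<and> finite (tri_edges t)" if t: "t \<in> T" for t
  proof -
    obtain a b c where abc: "t = {a, b, c}" "a \<noteq> b" "b \<noteq> c" "a \<noteq> c" "{a, b} \<in> E" "{b, c} \<in> E" "{a, c} \<in> E"
      using t T by (auto simp: triangles_def)
    have eq: "tri_edges t = {{a, b}, {b, c}, {a, c}}"
    proof -
      have "e \<in> {{a, b}, {b, c}, {a, c}}" if "e \<subseteq> {a, b, c}" "card e = 2" for e
      proof -
        obtain x y where "e = {x, y}" "x \<noteq> y" using \<open>card e = 2\<close> by (auto simp: card_2_iff)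
        then show ?thesis using that(1) by (auto simp: insert_commute)
      qed
      moreover have "card {a, b} = 2" "card {b, c} = 2" "card {a, c} = 2" using abc by auto
      ultimately show ?thesis unfolding tri_edges_def abc(1) by auto
    qed
    have "(\<Sum>e\<in>tri_edges t. f e) = f {a, b} + f {b, c} + f {a, c}"
      unfolding eq using abc by (simp add: doubleton_eq_iff)
    then show ?thesis using wt_triangle[of "cl a" "cl b" "cl c"] abc unfolding eq f by auto
  qed
  have finT: "finite T"
  proof (rule finite_subset)
    show "T \<subseteq> Pow {..<n}" using T unfolding triangles_def by (auto simp: E_iff)
  qed simp
  have "real (card T) = (\<Sum>t\<in>T. 1)" by simp
  also have "\<dots> \<le> (\<Sum>t\<in>T. \<Sum>e\<in>tri_edges t. f e)" by (intro sum_mono) (use te in auto)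
  also have "\<dots> = (\<Sum>e\<in>(\<Union>t\<in>T. tri_edges t). f e)"
    by (rule sum.UNION_disjoint[symmetric]) (use finT te disj in auto)
  also have "\<dots> \<le> (\<Sum>e\<in>E. f e)"
    by (rule sum_mono2) (use finite_E te wt_nonneg in \<open>auto simp: f_def\<close>)
  finally have "2 * real (card T) \<le> 2 * (\<Sum>e\<in>E. f e)" by simp
  also have "\<dots> = (\<Sum>x<n. \<Sum>y<n. of_bool ({x, y} \<in> E) * wt (cl x) (cl y))"
    unfolding f_def by (rule sum_edges) (auto simp: wt_sym)
  finally show ?thesis .
qed

lemma nu3_le: "2 * real (nu3 E) \<le> (1 / 2 ^ k + q * D\<^sup>2 / 2 ^ k + q / 2 + 3 / 2 * \<eta>) * (real n)\<^sup>2"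
proof -
  let ?P = "\<lambda>m. \<exists>T. T \<subseteq> triangles E \<and> card T = m \<and> (\<forall>s\<in>T. \<forall>t\<in>T. s \<noteq> t \<longrightarrow> tri_edges s \<inter> tri_edges t = {})"
  have fin: "finite (triangles E)"
    by (rule finite_subset[of _ "Pow {..<n}"]) (auto simp: triangles_def E_iff)
  have "?P (GREATEST m. ?P m)"
  \<comment> \<open>\<open>GREATEST\<close> is attained: the empty packing qualifies, and packings
    are no larger than the finite set of triangles.\<close>
  proof (rule GreatestI_nat[where k = 0 and b = "card (triangles E)"])
    show "?P 0" by (rule exI[of _ "{}"]) simp
    show "m \<le> card (triangles E)" if "?P m" for m using that card_mono[OF fin] by auto
  qed
  then obtain T where "T \<subseteq> triangles E" "card T = nu3 E" "\<forall>s\<in>T. \<forall>t\<in>T. s \<noteq> t \<longrightarrow> tri_edges s \<inter> tri_edges t = {}"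
    unfolding nu3_def by blast
  then show ?thesis using packing_bound[of T] sum_wt_le by simp
qed

section \<open>The covering number\<close>

text \<open>Deleting an optimal cover leaves a triangle-free graph, which keeps at most about half
  of the edges.\<close>

lemma tau3_ge:
  assumes theta: "0 < \<theta>" "\<theta> \<le> 1" and K: "0 < (K::nat)"
  shows "real (card E) / 2 - (3 * \<eta> * real n / (q * K) + 8 * \<eta> + real K / real n
         + 15 * (3 * \<eta>) / (1 / (8 * (pA * D)) * q\<^sup>2 * \<theta>) + 2 * \<theta>) * (real n)\<^sup>2 \<le> real (tau3 E)"
proof -
  let ?P = "\<lambda>m. \<exists>F. F \<subseteq> E \<and> card F = m \<and> (\<forall>t\<in>triangles E. F \<inter> tri_edges t \<noteq> {})"
  \<comment> \<open>\<open>E\<close> itself meets every triangle, so \<open>LEAST\<close> is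
    attained.\<close>
  have "?P (card E)"
  proof (rule exI[of _ E], intro conjI ballI)
    fix t assume "t \<in> triangles E"
    then obtain a b c where "t = {a, b, c}" "a \<noteq> b" "{a, b} \<in> E" by (auto simp: triangles_def)
    then have "{a, b} \<in> E \<inter> tri_edges t" by (auto simp: tri_edges_def)
    then show "E \<inter> tri_edges t \<noteq> {}" by auto
  qed auto
  then have "?P (LEAST m. ?P m)" by (rule LeastI)
  then obtain F where F: "F \<subseteq> E" "card F = tau3 E" "\<forall>t\<in>triangles E. F \<inter> tri_edges t \<noteq> {}"
    unfolding tau3_def by blast
  define H where "H = E - F"
  have HE: "H \<subseteq> E" by (auto simp: H_def)
  have tf: False if h: "{x, y} \<in> H" "{x, z} \<in> H" "{y, z} \<in> H" for x y z
  proof -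
    have hE: "{x, y} \<in> E" "{x, z} \<in> E" "{y, z} \<in> E" using h by (auto simp: H_def)
    then have ne: "x \<noteq> y" "x \<noteq> z" "y \<noteq> z" using E_iff by blast+
    then have t: "{x, y, z} \<in> triangles E" using hE unfolding triangles_def by blast
    have "tri_edges {x, y, z} \<subseteq> H"
    proof
      fix e assume "e \<in> tri_edges {x, y, z}"
      then obtain a b where "e = {a, b}" "a \<noteq> b" "{a, b} \<subseteq> {x, y, z}" by (auto simp: tri_edges_def card_2_iff)
      then show "e \<in> H" using h by (auto simp: insert_commute)
    qed
    then show False using F(3) t by (auto simp: H_def)
  qed
  define R where "R = 3 * \<eta> * real n / (q * K) + 2 * (3 * \<eta>) + real K / real n
         + 15 * (3 * \<eta>) / (1 / (8 * (pA * D)) * q\<^sup>2 * \<theta>) + 2 * \<theta>"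
  have R0: "0 \<le> R" unfolding R_def using eta q Q theta by (intro add_nonneg_nonneg) auto
  have "2 * real (card H) \<le> (\<Sum>x<n. \<Sum>y<n. W x y) / 2 + R * (real n)\<^sup>2"
    using triangle_free_sum_bound[OF HE _ theta K] tf card_edges[OF HE] by (auto simp: R_def)
  moreover have "(\<Sum>x<n. \<Sum>y<n. W x y) \<le> 2 * real (card E) + 3 * \<eta> * (real n)\<^sup>2"
    using sum_W_card by linarith
  moreover have "real (card H) = real (card E) - real (tau3 E)"
  proof -
    have "card E = card H + card F" unfolding H_def
      using F(1) finite_E card_Diff_subset[of F E] card_mono[of E F] finite_subset by fastforce
    then show ?thesis using F(2) by simp
  qed
  moreover have "0 \<le> R * (real n)\<^sup>2" "0 \<le> \<eta> * (real n)\<^sup>2" using R0 eta by auto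
  \<comment> \<open>\<open>R\<close> contains \<open>6 * \<eta>\<close>; a further
    \<open>2 * \<eta>\<close> covers the passage from \<open>W\<close> to \<open>card E\<close>,
    which makes the 8 of the claim.\<close>
  ultimately have "real (card E) / 2 - (R * (real n)\<^sup>2 + 2 * (\<eta> * (real n)\<^sup>2)) \<le> real (tau3 E)" by simp
  then show ?thesis by (simp add: R_def algebra_simps)
qed

end

section \<open>Choice of parameters\<close>

text \<open>Vertices are triples from the cube, \<open>T1\<close> and \<open>T2\<close>;
  \<open>RA\<close> reads the second coordinate, \<open>RB\<close> also the third. With D = 2^l and
  2^(4l) clumps, \<open>pA * D\<close> and \<open>q * 2 ^ (4 * l)\<close> both equal 2^s, and
  \<open>e\<close> is chosen to meet the 1/320 condition.\<close>

lemma clump_graph_exists: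
  fixes l s :: nat and \<eta> :: real
  assumes s: "s \<le> l" and l: "2 \<le> l" and eta: "0 < \<eta>" "\<eta> \<le> 1"
    and e: "e = 1 / (320 * (2 ^ s)\<^sup>2)" and big: "4 * real l + 3 \<le> e\<^sup>2 * 2 ^ l / 4"
  shows "\<exists>n\<ge>n0. \<exists>S cl RA RB. clump_graph (4 * l) (2 ^ l) n S cl RA RB e ((1 / 2) ^ (l - s)) ((1 / 2) ^ (l - s + 3 * l)) \<eta>"
proof -
  define pA :: real where "pA = (1 / 2) ^ (l - s)"
  define q :: real where "q = (1 / 2) ^ (l - s + 3 * l)"
  have e01: "0 < e" "e \<le> 1"
  proof -
    have "(1::real) \<le> (2 ^ s)\<^sup>2" by (intro one_le_power) simp_all
    moreover have "0 < 1 / (320 * x) \<and> 1 / (320 * x) \<le> 1" if "1 \<le> x" for x :: real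
      using that by simp
    ultimately show "0 < e" "e \<le> 1" unfolding e by blast+
  qed
  obtain S where S: "S \<subseteq> cube (4 * l)" "card S = 2 ^ l" "{} \<notin> S" "\<And>x y. x \<in> S \<Longrightarrow> y \<in> S \<Longrightarrow> sdiff x y \<notin> S"
    "\<And>U. U \<in> cube (4 * l) \<Longrightarrow> U \<noteq> {} \<Longrightarrow> \<bar>\<Sum>s\<in>S. chi U s\<bar> \<le> e * 2 ^ l"
    using small_bias_set[of e l] e01 l big by (metis One_nat_def Suc_1 Suc_leD)
  \<comment> \<open>Large enough for \<open>n \<ge> n0\<close> as well as
    \<open>1 \<le> \<eta> * n\<close>.\<close>
  define m0 where "m0 = Suc (max n0 (nat \<lceil>1 / \<eta>\<rceil>))"
  obtain T1 :: "nat set" and R1 where 1: "finite T1" "1 \<le> card T1" "\<forall>x y. R1 x y = R1 y x"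
     "disc T1 (\<eta> / 2) (\<lambda>x y. of_bool (R1 x y) - (1 / 2) ^ (l - s))"
    using quasirandom_relation[of "\<eta> / 2" 1 "l - s"] eta by auto
  obtain T2 :: "nat set" and R2 where 2: "finite T2" "m0 \<le> card T2" "\<forall>x y. R2 x y = R2 y x"
     "disc T2 (\<eta> / 2) (\<lambda>x y. of_bool (R2 x y) - (1 / 2) ^ (3 * l))"
    using quasirandom_relation[of "\<eta> / 2" m0 "3 * l"] eta by auto
  define T where "T = T1 \<times> T2"
  define V where "V = cube (4 * l) \<times> T"
  define n where "n = card V"
  have fT: "finite T" "finite V" using 1 2 by (auto simp: T_def V_def)
  have nT: "n = 2 ^ (4 * l) * card T" by (simp add: n_def V_def card_cartesian_product)
  have "1 * (1 * m0) \<le> n"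
    unfolding nT T_def card_cartesian_product by (intro mult_le_mono) (use 1 2 in auto)
  then have nm: "m0 \<le> n" by simp
  have n0: "n0 \<le> n" using nm by (simp add: m0_def)
  have "1 / \<eta> \<le> n"
  proof -
    have "1 / \<eta> \<le> real (nat \<lceil>1 / \<eta>\<rceil>)" by (rule real_nat_ceiling_ge)
    also have "\<dots> \<le> n" unfolding of_nat_le_iff
      using max.cobounded2[of "nat \<lceil>1 / \<eta>\<rceil>" n0] nm unfolding m0_def by linarith
    finally show ?thesis .
  qed
  then have n1: "1 \<le> \<eta> * n" using eta by (simp add: field_simps)
  obtain h where h: "bij_betw h {..<n} V"
    using ex_bij_betw_nat_finite[OF fT(2)] by (auto simp: n_def atLeast0LessThan)
  define cl where "cl x = fst (h x)" for x
  define RA where "RA x y \<longleftrightarrow> R1 (fst (snd (h x))) (fst (snd (h y)))" for x y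
  define RB where "RB x y \<longleftrightarrow> RA x y \<and> R2 (snd (snd (h x))) (snd (snd (h y)))" for x y
  have dA: "disc T \<eta> (\<lambda>x y. of_bool (R1 (fst x) (fst y)) - pA)"
    using disc_mono[OF disc_product'[OF 2(1) 1(1) _ 1(4), of "\<lambda>_ _. 1"], of \<eta>] eta by (simp add: T_def pA_def)
  have dB: "disc T \<eta> (\<lambda>x y. of_bool (R1 (fst x) (fst y) \<and> R2 (snd x) (snd y)) - q)"
    using quasirandom_product[OF 1(1) 2(1) 1(4) 2(4)] by (simp add: T_def q_def power_add power_le_one)
  have lift: "disc {..<n} \<eta> (\<lambda>x y. \<kappa> (cl x) (cl y) * K (snd (h x)) (snd (h y)))"
    if "\<And>a b. \<bar>\<kappa> a b\<bar> \<le> 1" "disc T \<eta> K" for \<kappa> K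
    unfolding cl_def using disc_reindex[OF h[unfolded V_def] disc_product[OF finite_cube fT(1) that]] .
  have "clump_graph (4 * l) (2 ^ l) n S cl RA RB e pA q \<eta>"
  proof
    show "x < n \<Longrightarrow> cl x \<in> cube (4 * l)" for x
      using bij_betwE[OF h] by (auto simp: cl_def V_def mem_Times_iff)
    show "real (card {x\<in>{..<n}. cl x = \<omega>}) * 2 ^ (4 * l) = n" if "\<omega> \<in> cube (4 * l)" for \<omega>
    proof -
      have bb: "bij_betw h {x\<in>{..<n}. cl x = \<omega>} {v\<in>V. fst v = \<omega>}"
        using h unfolding bij_betw_def cl_def by (auto simp: inj_on_def)
      have Vw: "{v\<in>V. fst v = \<omega>} = {\<omega>} \<times> T" using that by (auto simp: V_def)
      have "card {x\<in>{..<n}. cl x = \<omega>} = card T"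
        using bij_betw_same_card[OF bb] unfolding Vw by (simp add: card_cartesian_product)
      then show ?thesis by (simp add: nT)
    qed
    show "RA x y = RA y x" "RB x y = RB y x" "RB x y \<Longrightarrow> RA x y" for x y
      using 1(3) 2(3) unfolding RA_def RB_def by blast+
    show "disc {..<n} \<eta> (\<lambda>x y. \<kappa> (cl x) (cl y) * (of_bool (RA x y) - pA))"
      if "\<And>a b. \<bar>\<kappa> a b\<bar> \<le> 1" for \<kappa>
      using lift[OF that dA] by (simp add: RA_def)
    show "disc {..<n} \<eta> (\<lambda>x y. \<kappa> (cl x) (cl y) * (of_bool (RB x y) - q))"
      if "\<And>a b. \<bar>\<kappa> a b\<bar> \<le> 1" for \<kappa>
      using lift[OF that dB] by (simp add: RB_def RA_def)
    have pD: "pA * real (2 ^ l) = 2 ^ s"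
      using s by (simp add: pA_def power_one_over power_diff)
    have ll: "4 * l = (l - s + 3 * l) + s" using s by simp
    have qN: "q * 2 ^ (4 * l) = 2 ^ s"
      unfolding ll power_add[of 2 _ s] by (simp add: q_def power_one_over)
    show "q * 2 ^ (4 * l) = pA * real (2 ^ l)" using pD qN by simp
    show "0 < q" by (simp add: q_def)
    show "q \<le> pA" unfolding q_def pA_def by (intro power_decreasing) auto
    show "pA \<le> 1" by (simp add: pA_def power_le_one)
    show "1 \<le> pA * real (2 ^ l)" unfolding pD by simp
    show "e * (pA * real (2 ^ l))\<^sup>2 \<le> 1 / 320" unfolding pD by (simp add: e)
    show "q * (1 + real (2 ^ l)) \<le> 1 / 4"
    proof -
      have "q \<le> (1 / 2) ^ (3 * l)" unfolding q_def by (intro power_decreasing) auto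
      then have "q * (1 + real (2 ^ l)) \<le> (1 / 2) ^ (3 * l) * (2 * 2 ^ l)"
        by (intro mult_mono) (auto simp: q_def)
      also have "\<dots> = 2 * (1 / 2) ^ (2 * l)"
        by (simp add: power_one_over power_mult[symmetric] power_add[symmetric] field_simps)
      also have "\<dots> \<le> 2 * (1 / 2) ^ 4" using l by (intro mult_left_mono power_decreasing) auto
      finally show ?thesis by (simp add: power_one_over)
    qed
  qed (use S n1 eta e01 in auto)
  then show ?thesis using n0 unfolding pA_def q_def by blast
qed

text \<open>The order of choices matters: \<alpha> determines s, then l and with it the density q.
  Only afterwards come \<zeta>, \<theta>, \<eta> and the clump sizes, so \<beta> does not depend on
  \<zeta>.\<close>

lemma dense_tuza_graphs:
  fixes \<alpha> :: real
  assumes "\<alpha> > 0"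
  obtains \<beta> :: real where "\<beta> > 0"
    "\<And>\<zeta> n0. 0 < \<zeta> \<Longrightarrow> \<zeta> \<le> 1 \<Longrightarrow> \<exists>n\<ge>n0. \<exists>E. n > 0 \<and> graph_on n E \<and> real (card E) \<ge> \<beta> * (real n)\<^sup>2
       \<and> real (nu3 E) < (1 + \<alpha>) * real (card E) / 4 \<and> real (tau3 E) \<ge> real (card E) / 2 - \<zeta> * (real n)\<^sup>2"
proof -
  \<comment> \<open>With \<open>Q = 2 ^ s\<close> and \<open>q = Q / N\<close>, this makes the share
    \<open>1 / N\<close> of the clumps small against \<open>\<alpha> * q\<close>.\<close>
  obtain s where s: "4 / \<alpha> < 2 ^ s" using real_arch_pow[of 2 "4 / \<alpha>"] by auto
  define e :: real where "e = 1 / (320 * (2 ^ s)\<^sup>2)"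
  have e0: "0 < e" by (simp add: e_def)
  have "eventually (\<lambda>l. 4 * real l + 3 \<le> e\<^sup>2 * 2 ^ l / 4) sequentially" using e0 by real_asymp
  then have "eventually (\<lambda>l. 4 * real l + 3 \<le> e\<^sup>2 * 2 ^ l / 4 \<and> 2 \<le> l \<and> s \<le> l) sequentially"
    by (intro eventually_conj eventually_ge_at_top)
  then obtain l where l: "4 * real l + 3 \<le> e\<^sup>2 * 2 ^ l / 4" "2 \<le> l" "s \<le> l"
    by (auto simp: eventually_at_top_linorder)
  define pA :: real where "pA = (1 / 2) ^ (l - s)"
  define q :: real where "q = (1 / 2) ^ (l - s + 3 * l)"
  define N :: real where "N = 2 ^ (4 * l)"
  define Q :: real where "Q = 2 ^ s"
  have Np: "1 \<le> N" by (simp add: N_def)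
  have q01: "0 < q" "q \<le> 1" by (auto simp: q_def power_le_one)
  have pD: "pA * real (2 ^ l) = Q" using l by (simp add: pA_def Q_def power_one_over power_diff)
  have qN: "q * N = Q"
  proof -
    have ll: "4 * l = (l - s + 3 * l) + s" using l by simp
    show ?thesis unfolding N_def ll power_add[of 2 _ s] by (simp add: q_def Q_def power_one_over)
  qed
  have Qb: "1 \<le> Q" "4 < \<alpha> * Q" using s assms by (auto simp: Q_def field_simps)
  show ?thesis
  proof
    show "q / 2 > 0" using q01 by simp
    fix \<zeta> :: real and n0 :: nat assume z: "0 < \<zeta>" "\<zeta> \<le> 1"
    define \<theta> where "\<theta> = \<zeta> / 8"
    \<comment> \<open>The coefficient of \<eta> in the error of \<open>tau3_ge\<close> once
      \<open>n / K\<close> is bounded by \<open>1 / \<theta>\<close>; 360 is 15 * 3 * 8.\<close>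
    define c where "c = 3 / (q * \<theta>) + 8 + 360 * Q / (q\<^sup>2 * \<theta>)"
    \<comment> \<open>The three bounds serve the edge density, the packing number and the covering
      number, in this order.\<close>
    define \<eta> where "\<eta> = min (q / 3) (min (1 / ((3 + \<alpha>) * 3 * N)) (\<zeta> / (2 * c)))"
    have th: "0 < \<theta>" "\<theta> \<le> 1" using z by (auto simp: \<theta>_def)
    have c: "1 \<le> c" unfolding c_def using q01 th Qb by (auto intro!: add_increasing2 add_increasing)
    have et: "0 < \<eta>" "\<eta> \<le> 1" "\<eta> \<le> q / 3" "\<eta> \<le> 1 / ((3 + \<alpha>) * 3 * N)" "\<eta> \<le> \<zeta> / (2 * c)"
      using q01 z c assms Np by (auto simp: \<eta>_def)
    define n1 where "n1 = max n0 (nat \<lceil>1 / \<theta>\<rceil>)"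
    obtain n S cl RA RB where nge: "n1 \<le> n" and cg: "clump_graph (4 * l) (2 ^ l) n S cl RA RB e pA q \<eta>"
      using clump_graph_exists[OF l(3,2) et(1,2) e_def l(1), of n1] unfolding pA_def q_def by blast
    interpret clump_graph "4 * l" "2 ^ l" n S cl RA RB e pA q \<eta> by (rule cg)
    have np: "0 < n" by (rule n_pos)
    have n2: "0 < (real n)\<^sup>2" using np by simp
    have Eq: "q / 2 * (real n)\<^sup>2 \<le> real (card E)"
    proof -
      have "q * (real n)\<^sup>2 \<le> (2 * q - 3 * \<eta>) * (real n)\<^sup>2" using et by (intro mult_right_mono) auto
      then show ?thesis using card_E_ge by linarith
    qed
    have nu: "real (nu3 E) < (1 + \<alpha>) * real (card E) / 4"
    proof -
      have qq: "q = Q / N" using qN Np by (simp add: field_simps)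
      \<comment> \<open>Pairs at distance two are negligible: with D = 2^l one has N = D^4,
        \<open>Q \<le> D\<close> and \<open>4 \<le> D\<close>.\<close>
      have d: "q * real ((2 ^ l)\<^sup>2) / N \<le> 1 / (4 * N)"
      proof -
        have "Q \<le> 2 ^ l" using l by (simp add: Q_def)
        then have "4 * Q * (2 ^ l)\<^sup>2 \<le> 2 ^ l * 2 ^ l * (2 ^ l)\<^sup>2"
          using l power_increasing[of 2 l "2::real"] Qb by (intro mult_mono) auto
        also have "\<dots> = N" by (simp add: N_def power_mult[symmetric] power_add[symmetric] power2_eq_square)
        finally have "4 * (q * (2 ^ l)\<^sup>2) \<le> 1" using Np by (simp add: qq field_simps)
        then show ?thesis using Np by (simp add: field_simps)
      qed
      have h1: "3 * \<eta> * (3 + \<alpha>) \<le> 1 / N"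
      proof -
        have "\<eta> * ((3 + \<alpha>) * 3 * N) \<le> 1" using et(4) Np assms by (simp add: pos_le_divide_eq)
        then show ?thesis using Np by (simp add: pos_le_divide_eq mult_ac)
      qed
      have h2: "2 / N < \<alpha> * q / 2" using Qb Np by (simp add: qq field_simps)
      have "1 / N + q * real ((2 ^ l)\<^sup>2) / N + q / 2 + 3 / 2 * \<eta> < (1 + \<alpha>) / 4 * (2 * q - 3 * \<eta>)"
      proof -
        have "(1 + \<alpha>) / 4 * (2 * q - 3 * \<eta>) = q / 2 + \<alpha> * q / 2 - 3 * \<eta> / 4 - 3 * \<eta> * \<alpha> / 4"
          by (simp add: field_simps)
        moreover have "3 * \<eta> * (3 + \<alpha>) = 9 * \<eta> + 3 * \<eta> * \<alpha>" by (simp add: algebra_simps)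
        moreover have "1 / (4 * N) = 1 / N / 4" "2 / N = 2 * (1 / N)" by simp_all
        moreover have "0 < 1 / N" using Np by simp
        moreover have "0 < \<eta>" by (rule et)
        moreover have "0 \<le> 3 * \<eta> * \<alpha>" using et assms by simp
        ultimately show ?thesis using d h1 h2 by linarith
      qed
      then have "(1 / N + q * real ((2 ^ l)\<^sup>2) / N + q / 2 + 3 / 2 * \<eta>) * (real n)\<^sup>2
         < (1 + \<alpha>) / 4 * (2 * q - 3 * \<eta>) * (real n)\<^sup>2" using n2 by (rule mult_strict_right_mono)
      then have "(1 / N + q * real ((2 ^ l)\<^sup>2) / N + q / 2 + 3 / 2 * \<eta>) * (real n)\<^sup>2
         < (1 + \<alpha>) / 4 * ((2 * q - 3 * \<eta>) * (real n)\<^sup>2)" by (simp only: mult.assoc)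
      moreover have "2 * real (nu3 E) \<le> (1 / N + q * real ((2 ^ l)\<^sup>2) / N + q / 2 + 3 / 2 * \<eta>) * (real n)\<^sup>2"
        using nu3_le by (simp add: N_def)
      moreover have "(1 + \<alpha>) / 4 * ((2 * q - 3 * \<eta>) * (real n)\<^sup>2) \<le> (1 + \<alpha>) / 4 * (2 * real (card E))"
        using card_E_ge assms by (intro mult_left_mono) auto
      ultimately have "2 * real (nu3 E) < (1 + \<alpha>) / 4 * (2 * real (card E))" by linarith
      then show ?thesis by simp
    qed
    have tau: "real (card E) / 2 - \<zeta> * (real n)\<^sup>2 \<le> real (tau3 E)"
    proof -
      \<comment> \<open>K of order \<open>\<theta> * n\<close> balances the matching error,
        proportional to \<open>n / K\<close>, against the leftover
        \<open>K / n \<le> 2 * \<theta>\<close>; the \<theta>-terms then total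
        \<open>4 * \<theta> = \<zeta> / 2\<close>.\<close>
      define K where "K = nat \<lceil>\<theta> * n\<rceil>"
      have K1: "\<theta> * n \<le> K" unfolding K_def by (rule real_nat_ceiling_ge)
      have K2: "real K \<le> \<theta> * n + 1" unfolding K_def using th by (simp add: of_nat_nat)
      have Kp: "0 < K" using K1 th np by (metis gr0I mult_pos_pos not_le of_nat_0 of_nat_0_less_iff)
      have "1 / \<theta> \<le> real (nat \<lceil>1 / \<theta>\<rceil>)" by (rule real_nat_ceiling_ge)
      also have "\<dots> \<le> n" using nge by (simp add: n1_def)
      finally have "1 \<le> \<theta> * n" using th by (simp add: field_simps)
      then have k2: "real K / n \<le> 2 * \<theta>" using K2 np by (simp add: field_simps)
      have k1: "3 * \<eta> * real n / (q * K) \<le> \<eta> * (3 / (q * \<theta>))"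
      proof -
        have "3 * \<eta> * real n / (q * K) \<le> 3 * \<eta> * real n / (q * (\<theta> * n))"
          using K1 th np q01 et Kp by (intro divide_left_mono mult_left_mono mult_pos_pos) auto
        also have "\<dots> = \<eta> * (3 / (q * \<theta>))" using np by simp
        finally show ?thesis .
      qed
      have k3: "15 * (3 * \<eta>) / (1 / (8 * (pA * real (2 ^ l))) * q\<^sup>2 * \<theta>) = \<eta> * (360 * Q / (q\<^sup>2 * \<theta>))"
        unfolding pD using Qb by simp
      have "\<eta> * c \<le> \<zeta> / 2" using et(5) c by (simp add: field_simps)
      moreover have "\<eta> * c = \<eta> * (3 / (q * \<theta>)) + 8 * \<eta> + \<eta> * (360 * Q / (q\<^sup>2 * \<theta>))"
        by (simp add: c_def algebra_simps)
      moreover have "2 * \<theta> + 2 * \<theta> = \<zeta> / 2" by (simp add: \<theta>_def)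
      ultimately have "3 * \<eta> * real n / (q * K) + 8 * \<eta> + real K / real n
         + 15 * (3 * \<eta>) / (1 / (8 * (pA * real (2 ^ l))) * q\<^sup>2 * \<theta>) + 2 * \<theta> \<le> \<zeta>"
        unfolding k3 using k1 k2 by linarith
      from mult_right_mono[OF this, of "(real n)\<^sup>2"] show ?thesis using tau3_ge[OF th Kp] by simp
    qed
    show "\<exists>n\<ge>n0. \<exists>E. n > 0 \<and> graph_on n E \<and> real (card E) \<ge> q / 2 * (real n)\<^sup>2
       \<and> real (nu3 E) < (1 + \<alpha>) * real (card E) / 4 \<and> real (tau3 E) \<ge> real (card E) / 2 - \<zeta> * (real n)\<^sup>2"
      using nge np graph_on_E Eq nu tau by (intro exI[of _ n] conjI exI[of _ E]) (auto simp: n1_def)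
  qed
qed

theorem mainTheorem1:
  fixes \<alpha> :: real
  assumes "\<alpha> > 0"
  shows "\<exists>(\<beta>::real) (n::nat \<Rightarrow> nat) (G::nat \<Rightarrow> nat set set).
           \<beta> > 0 \<and>
           (\<forall>j. graph_on (n j) (G j)) \<and>
           filterlim n at_top sequentially \<and>
           (\<forall>j. real (num_edges (G j)) \<ge> \<beta> * real (n j choose 2)) \<and>
           (\<exists>\<epsilon>::nat \<Rightarrow> real. \<epsilon> \<longlonglongrightarrow> 0 \<and>
              (\<forall>j. real (tau3 (G j)) > (1 - \<epsilon> j) * real (num_edges (G j)) / 2)) \<and>
           (\<forall>j. real (nu3 (G j)) < (1 + \<alpha>) * real (num_edges (G j)) / 4)"
proof -
  obtain \<beta> :: real where b: "\<beta> > 0" and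
    ex: "\<And>\<zeta> n0. 0 < \<zeta> \<Longrightarrow> \<zeta> \<le> 1 \<Longrightarrow> \<exists>n\<ge>n0. \<exists>E. n > 0 \<and> graph_on n E \<and> real (card E) \<ge> \<beta> * (real n)\<^sup>2
       \<and> real (nu3 E) < (1 + \<alpha>) * real (card E) / 4 \<and> real (tau3 E) \<ge> real (card E) / 2 - \<zeta> * (real n)\<^sup>2"
    using dense_tuza_graphs[OF assms] by blast
  have "\<exists>n E. j \<le> n \<and> n > 0 \<and> graph_on n E \<and> real (card E) \<ge> \<beta> * (real n)\<^sup>2
       \<and> real (nu3 E) < (1 + \<alpha>) * real (card E) / 4
       \<and> real (tau3 E) \<ge> real (card E) / 2 - 1 / (real j + 1) * (real n)\<^sup>2" for j
    using ex[of "1 / (real j + 1)" j] by auto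
  then obtain n G where nG: "\<And>j. j \<le> n j" "\<And>j. n j > 0" "\<And>j. graph_on (n j) (G j)"
    "\<And>j. real (card (G j)) \<ge> \<beta> * (real (n j))\<^sup>2" "\<And>j. real (nu3 (G j)) < (1 + \<alpha>) * real (card (G j)) / 4"
    "\<And>j. real (tau3 (G j)) \<ge> real (card (G j)) / 2 - 1 / (real j + 1) * (real (n j))\<^sup>2"
    by metis
  \<comment> \<open>The factor \<open>2 / \<beta>\<close> converts an error relative to
    \<open>(n j)\<^sup>2\<close> into one relative to half the edges; the added 1 makes the
    inequality strict.\<close>
  define \<epsilon> where "\<epsilon> j = (2 / \<beta> + 1) * (1 / (real j + 1))" for j
  have "\<epsilon> \<longlonglongrightarrow> 0" unfolding \<epsilon>_def by real_asymp
  moreover have "real (tau3 (G j)) > (1 - \<epsilon> j) * real (card (G j)) / 2" for j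
  proof -
    define z where "z = 1 / (real j + 1)"
    have z: "0 < z" by (simp add: z_def)
    have cp: "0 < real (card (G j))"
      using nG(4)[of j] nG(2)[of j] b by (metis less_le_trans mult_pos_pos of_nat_0_less_iff zero_less_power)
    have "z * (real (n j))\<^sup>2 \<le> z * (real (card (G j)) / \<beta>)"
      using nG(4)[of j] b z by (intro mult_left_mono) (auto simp: field_simps)
    also have "\<dots> < (2 / \<beta> + 1) * z * real (card (G j)) / 2"
      using z cp b by (simp add: field_simps)
    finally have "z * (real (n j))\<^sup>2 < \<epsilon> j * real (card (G j)) / 2" by (simp add: \<epsilon>_def z_def)
    then show ?thesis using nG(6)[of j] by (simp add: z_def left_diff_distrib diff_divide_distrib)
  qed
  moreover have "filterlim n at_top sequentially"
    by (rule filterlim_at_top_mono[OF filterlim_ident]) (use nG(1) in simp)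
  moreover have "real (card (G j)) \<ge> \<beta> * real (n j choose 2)" for j
  proof -
    have "real (n j choose 2) \<le> (real (n j))\<^sup>2"
      using binomial_le_pow2 by (simp add: choose_two) (metis div_le_dividend diff_le_self le_trans mult_le_mono2 of_nat_le_iff of_nat_power power2_eq_square)
    then have "\<beta> * real (n j choose 2) \<le> \<beta> * (real (n j))\<^sup>2" using b by (intro mult_left_mono) auto
    then show ?thesis using nG(4)[of j] by linarith
  qed
  ultimately show ?thesis using b nG(3,5) by blast
qed

end
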